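(* Let $R$ be any rule belonging to the class $\mathfrak{R}$ (defined in the context). Then there is a formula $Ax_R$ such that: (i) the calculus $\mathbf{LJ}+R$ feasibly proves the axiom $(\Rightarrow Ax_R)$; (ii) the calculus $\mathbf{LJ}+Ax_R$ feasibly proves the rule $R$. Moreover, $R$ is a constructive rule if and only if $Ax_R$ is a constructive formula.
   Context: Formulas of the language $\mathcal{L}$ are built from atoms $p,q,\dots$ and constants $\top,\bot$ by $\wedge,\vee,\to,\Box,\Diamond$; $\neg A:=A\to\bot$; $\bigwedge\varnothing=\top$, $\bigvee\varnothing=\bot$. A sequent is $\Sigma\Rightarrow\Lambda$ with $\Sigma,\Lambda$ finite multisets of formulas; it is single-conclusion if $\Lambda$ has at most one element. A rule consists of finitely many premises and one conclusion, each a meta-sequent built from formulas (whose atoms are schematic) and multiset variables such as $\Gamma,\Delta$; an instance of a rule is obtained by substituting formulas for atoms and finite multisets of formulas for multiset variables; a rule without premises is an axiom. A sequent calculus is a finite set of rules; for a calculus $G$ and a rule $R$, $G+R$ is $G$ with $R$ added, and for a formula $A$, $G+A$ is $G$ with the axiom $(\Rightarrow A)$ added. A $G$-proof of $S$ from assumptions $S_1,\dots,S_k$ is a finite (tree-like) sequence of sequents ending in $S$, each of which is an assumption, an instance of an axiom of $G$, or the conclusion of an instance of a rule of $G$ whose premises occur earlier. A rule $R$ is feasibly provable in $G$ ("$G$ feasibly proves $R$") if there is a polynomial-time algorithm that, given any instance of $R$ with premises $S_1,\dots,S_k$ and conclusion $S$, outputs a $G$-proof of $S$ from $S_1,\dots,S_k$.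 $\mathbf{LJ}$ is the single-conclusion calculus with the following rules, where $\Gamma,\Delta$ are multiset variables and $\Delta$ has at most one formula: axioms $\Gamma,p\Rightarrow p$; $\Gamma,\bot\Rightarrow\Delta$; $\Gamma\Rightarrow\top$; weakening $\frac{\Gamma\Rightarrow\Delta}{\Gamma,p\Rightarrow\Delta}$, $\frac{\Gamma\Rightarrow}{\Gamma\Rightarrow p}$; contraction $\frac{\Gamma,p,p\Rightarrow\Delta}{\Gamma,p\Rightarrow\Delta}$; cut $\frac{\Gamma\Rightarrow p\quad \Gamma,p\Rightarrow\Delta}{\Gamma\Rightarrow\Delta}$; $\frac{\Gamma,p\Rightarrow\Delta}{\Gamma,p\wedge q\Rightarrow\Delta}$, $\frac{\Gamma,q\Rightarrow\Delta}{\Gamma,p\wedge q\Rightarrow\Delta}$, $\frac{\Gamma\Rightarrow p\quad\Gamma\Rightarrow q}{\Gamma\Rightarrow p\wedge q}$; $\frac{\Gamma,p\Rightarrow\Delta\quad\Gamma,q\Rightarrow\Delta}{\Gamma,p\vee q\Rightarrow\Delta}$, $\frac{\Gamma\Rightarrow p}{\Gamma\Rightarrow p\vee q}$, $\frac{\Gamma\Rightarrow q}{\Gamma\Rightarrow p\vee q}$; $\frac{\Gamma\Rightarrow p\quad\Gamma,q\Rightarrow\Delta}{\Gamma,p\to q\Rightarrow\Delta}$, $\frac{\Gamma,p\Rightarrow q}{\Gamma\Rightarrow p\to q}$. The class $\mathfrak{R}$ consists of all rules of one of the two forms: a left rule with premises $\{\Gamma,\overline{\varphi}_i\Rightarrow\overline{\psi}_i\}_{i\in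 I}\cup\{\Gamma,\overline{\theta}_j\Rightarrow\Delta\}_{j\in J}$ and conclusion $\Gamma,\overline{\eta}\Rightarrow\Delta$; or a right rule with premises $\{\Gamma,\overline{\varphi}_i\Rightarrow\overline{\psi}_i\}_{i\in I}$ and conclusion $\Gamma,\overline{\theta}\Rightarrow\overline{\eta}$; here $I,J$ are finite (possibly empty) index sets, $\Gamma,\Delta$ are multiset variables, and the $\overline{\varphi}_i,\overline{\psi}_i,\overline{\theta}_j,\overline{\theta},\overline{\eta}$ are finite multisets of $\mathcal{L}$-formulas. Basic formulas: the smallest set containing atoms, $\top,\bot$ and closed under $\wedge,\vee,\Diamond$. Almost positive formulas: the smallest set containing the basic formulas and closed under $\wedge,\vee,\Box,\Diamond$ and under forming $A\to B$ with $A$ basic and $B$ almost positive. Constructive formulas: the smallest set containing the basic formulas and closed under $\wedge,\Box$ and under forming $A\to B$ with $A$ almost positive and $B$ constructive. A single-conclusion rule is constructive if it is left constructive or right constructive. Left constructive: premises $\{\Gamma,\overline{B_i}\Rightarrow\overline{P_i}\}_{i\in I}\cup\{\Gamma,\overline{C_j}\Rightarrow\Delta\}_{j\in J}$, conclusion $\Gamma,\overline{P}\Rightarrow\Delta$, where $\overline{P},\overline{P_i}$ are multisets of almost positive formulas, $\overline{C_j}$ multisets of constructive formulas, $\overline{B_i}$ multisets of basic formulas, each $\overline{P_i}$ has at most one formula, and if $|J|>1$ then all formulas in $\bigcup_j\overline{C_j}$ are basic. Right constructive: premises $\{\Gamma,\overline{B_i}\Rightarrow\overline{P_i}\}_{i\in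 I}$, conclusion $\Gamma,\overline{P}\Rightarrow\overline{C}$, with $\overline{B_i},\overline{P_i},\overline{P}$ as before and $\overline{C}$ a multiset of at most one constructive formula. (Axioms are the case of no premises.)
   Formalization: Instances of rules are restricted to single-conclusion sequents (so Δ has at most one formula, also in R); with multi-conclusion instances allowed, part (ii) fails, e.g. for the axiom Γ ⇒ p, q, since LJ + Ax_R derives only single-conclusion sequents. *)

theory Defs
  imports "HOL-Library.Multiset"
begin

section \<open>Formulas, sequents and rules\<close>

datatype fm =
    Atom nat
  | Top
  | Bot
  | And fm fm
  | Or fm fm
  | Imp fm fm
  | Box fm
  | Dia fm

primrec subst :: "(nat \<Rightarrow> fm) \<Rightarrow> fm \<Rightarrow> fm" where
  "subst \<sigma> (Atom n) = \<sigma> n"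
| "subst \<sigma> Top = Top"
| "subst \<sigma> Bot = Bot"
| "subst \<sigma> (And A B) = And (subst \<sigma> A) (subst \<sigma> B)"
| "subst \<sigma> (Or A B) = Or (subst \<sigma> A) (subst \<sigma> B)"
| "subst \<sigma> (Imp A B) = Imp (subst \<sigma> A) (subst \<sigma> B)"
| "subst \<sigma> (Box A) = Box (subst \<sigma> A)"
| "subst \<sigma> (Dia A) = Dia (subst \<sigma> A)"

datatype 'a seq = Seq (ante: "'a multiset") (succ: "'a multiset")  (infix "\<Rrightarrow>" 50)

type_synonym sequent = "fm seq"

definition single_conclusion :: "'a seq \<Rightarrow> bool" where
  "single_conclusion S \<longleftrightarrow> size (succ S) \<le> 1"

text \<open>An element of a side of a meta-sequent is a formula or a multiset variable.\<close>

datatype item = Fm fm | MV nat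

type_synonym meta_sequent = "item seq"

text \<open>The premises form a list, so a repeated premise counts with its multiplicity.\<close>

datatype rule = Rule (prems: "meta_sequent list") (concl: meta_sequent)

primrec inst_item :: "(nat \<Rightarrow> fm) \<Rightarrow> (nat \<Rightarrow> fm multiset) \<Rightarrow> item \<Rightarrow> fm multiset" where
  "inst_item \<sigma> \<mu> (Fm A) = {#subst \<sigma> A#}"
| "inst_item \<sigma> \<mu> (MV g) = \<mu> g"

definition inst_side :: "(nat \<Rightarrow> fm) \<Rightarrow> (nat \<Rightarrow> fm multiset) \<Rightarrow> item multiset \<Rightarrow> fm multiset" where
  "inst_side \<sigma> \<mu> M = \<Sum>\<^sub># (image_mset (inst_item \<sigma> \<mu>) M)"

definition inst_seq :: "(nat \<Rightarrow> fm) \<Rightarrow> (nat \<Rightarrow> fm multiset) \<Rightarrow> meta_sequent \<Rightarrow> sequent" where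
  "inst_seq \<sigma> \<mu> S = (inst_side \<sigma> \<mu> (ante S) \<Rrightarrow> inst_side \<sigma> \<mu> (succ S))"

text \<open>
  All calculi considered are single-conclusion, so an instance consists of
  single-conclusion sequents. In particular, a multiset variable in a succedent
  stands for at most one formula.
\<close>

definition rule_instance :: "rule \<Rightarrow> sequent list \<Rightarrow> sequent \<Rightarrow> bool" where
  "rule_instance R Ss S \<longleftrightarrow>
     (\<exists>\<sigma> \<mu>. Ss = map (inst_seq \<sigma> \<mu>) (prems R) \<and> S = inst_seq \<sigma> \<mu> (concl R)) \<and>
     (\<forall>T \<in> set (S # Ss). single_conclusion T)"

type_synonym calculus = "rule set"

definition axiom_rule :: "fm \<Rightarrow> rule" where
  "axiom_rule A = Rule [] ({#} \<Rrightarrow> {#Fm A#})"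

text \<open>
  A proof is a sequence of sequents. The list \<open>from i\<close> contains the positions of the premises
  from which line \<open>i\<close> is inferred; it is empty for assumptions and axioms. The last
  condition says that the proof is tree-like: every line but the last one is used as a premise
  exactly once.
\<close>

definition is_proof :: "calculus \<Rightarrow> sequent list \<Rightarrow> sequent list \<Rightarrow> sequent \<Rightarrow> bool" where
  "is_proof G As \<pi> S \<longleftrightarrow> \<pi> \<noteq> [] \<and> last \<pi> = S \<and>
     (\<exists>from :: nat \<Rightarrow> nat list.
        (\<forall>i < length \<pi>.
           (from i = [] \<and> \<pi> ! i \<in> set As) \<or>
           ((\<forall>j \<in> set (from i). j < i) \<and>
            (\<exists>R \<in> G. rule_instance R (map (\<lambda>j. \<pi> ! j) (from i)) (\<pi> ! i)))) \<and>
        mset (concat (map from [0..<length \<pi>])) = mset [0..<length \<pi> - 1])"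


section \<open>The calculus LJ\<close>

definition LJ :: calculus where
  "LJ = (let \<Gamma> = MV 0; \<Delta> = MV 1; p = Atom 0; q = Atom 1 in
    { Rule [] ({#\<Gamma>, Fm p#} \<Rrightarrow> {#Fm p#}),
      Rule [] ({#\<Gamma>, Fm Bot#} \<Rrightarrow> {#\<Delta>#}),
      Rule [] ({#\<Gamma>#} \<Rrightarrow> {#Fm Top#}),
      Rule [{#\<Gamma>#} \<Rrightarrow> {#\<Delta>#}] ({#\<Gamma>, Fm p#} \<Rrightarrow> {#\<Delta>#}),
      Rule [{#\<Gamma>#} \<Rrightarrow> {#}] ({#\<Gamma>#} \<Rrightarrow> {#Fm p#}),
      Rule [{#\<Gamma>, Fm p, Fm p#} \<Rrightarrow> {#\<Delta>#}] ({#\<Gamma>, Fm p#} \<Rrightarrow> {#\<Delta>#}),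
      Rule [{#\<Gamma>#} \<Rrightarrow> {#Fm p#}, {#\<Gamma>, Fm p#} \<Rrightarrow> {#\<Delta>#}] ({#\<Gamma>#} \<Rrightarrow> {#\<Delta>#}),
      Rule [{#\<Gamma>, Fm p#} \<Rrightarrow> {#\<Delta>#}] ({#\<Gamma>, Fm (And p q)#} \<Rrightarrow> {#\<Delta>#}),
      Rule [{#\<Gamma>, Fm q#} \<Rrightarrow> {#\<Delta>#}] ({#\<Gamma>, Fm (And p q)#} \<Rrightarrow> {#\<Delta>#}),
      Rule [{#\<Gamma>#} \<Rrightarrow> {#Fm p#}, {#\<Gamma>#} \<Rrightarrow> {#Fm q#}] ({#\<Gamma>#} \<Rrightarrow> {#Fm (And p q)#}),
      Rule [{#\<Gamma>, Fm p#} \<Rrightarrow> {#\<Delta>#}, {#\<Gamma>, Fm q#} \<Rrightarrow> {#\<Delta>#}] ({#\<Gamma>, Fm (Or p q)#} \<Rrightarrow> {#\<Delta>#}),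
      Rule [{#\<Gamma>#} \<Rrightarrow> {#Fm p#}] ({#\<Gamma>#} \<Rrightarrow> {#Fm (Or p q)#}),
      Rule [{#\<Gamma>#} \<Rrightarrow> {#Fm q#}] ({#\<Gamma>#} \<Rrightarrow> {#Fm (Or p q)#}),
      Rule [{#\<Gamma>#} \<Rrightarrow> {#Fm p#}, {#\<Gamma>, Fm q#} \<Rrightarrow> {#\<Delta>#}] ({#\<Gamma>, Fm (Imp p q)#} \<Rrightarrow> {#\<Delta>#}),
      Rule [{#\<Gamma>, Fm p#} \<Rrightarrow> {#Fm q#}] ({#\<Gamma>#} \<Rrightarrow> {#Fm (Imp p q)#}) })"


section \<open>The rule class and constructive rules\<close>

text \<open>
  Here \<open>I\<close> and \<open>J\<close> list the families of multisets indexed by the two index sets, and the premises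
  of the rule are compared up to order.
\<close>

abbreviation fms :: "fm multiset \<Rightarrow> item multiset" where
  "fms M \<equiv> image_mset Fm M"

definition left_rule ::
  "nat \<Rightarrow> nat \<Rightarrow> (fm multiset \<times> fm multiset) list \<Rightarrow> fm multiset list \<Rightarrow> fm multiset \<Rightarrow> rule \<Rightarrow> bool"
where
  "left_rule \<Gamma> \<Delta> I J \<eta> R \<longleftrightarrow> \<Gamma> \<noteq> \<Delta> \<and>
     mset (prems R) =
       mset (map (\<lambda>(\<phi>, \<psi>). {#MV \<Gamma>#} + fms \<phi> \<Rrightarrow> fms \<psi>) I) +
       mset (map (\<lambda>\<theta>. {#MV \<Gamma>#} + fms \<theta> \<Rrightarrow> {#MV \<Delta>#}) J) \<and>
     concl R = ({#MV \<Gamma>#} + fms \<eta> \<Rrightarrow> {#MV \<Delta>#})"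

definition right_rule ::
  "nat \<Rightarrow> (fm multiset \<times> fm multiset) list \<Rightarrow> fm multiset \<Rightarrow> fm multiset \<Rightarrow> rule \<Rightarrow> bool"
where
  "right_rule \<Gamma> I \<theta> \<eta> R \<longleftrightarrow>
     mset (prems R) = mset (map (\<lambda>(\<phi>, \<psi>). {#MV \<Gamma>#} + fms \<phi> \<Rrightarrow> fms \<psi>) I) \<and>
     concl R = ({#MV \<Gamma>#} + fms \<theta> \<Rrightarrow> fms \<eta>)"

definition rule_class :: "rule set" where
  "rule_class = {R. (\<exists>\<Gamma> \<Delta> I J \<eta>. left_rule \<Gamma> \<Delta> I J \<eta> R) \<or> (\<exists>\<Gamma> I \<theta> \<eta>. right_rule \<Gamma> I \<theta> \<eta> R)}"

inductive_set basic :: "fm set" where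
  "Atom n \<in> basic"
| "Top \<in> basic"
| "Bot \<in> basic"
| "A \<in> basic \<Longrightarrow> B \<in> basic \<Longrightarrow> And A B \<in> basic"
| "A \<in> basic \<Longrightarrow> B \<in> basic \<Longrightarrow> Or A B \<in> basic"
| "A \<in> basic \<Longrightarrow> Dia A \<in> basic"

inductive_set almost_positive :: "fm set" where
  "A \<in> basic \<Longrightarrow> A \<in> almost_positive"
| "A \<in> almost_positive \<Longrightarrow> B \<in> almost_positive \<Longrightarrow> And A B \<in> almost_positive"
| "A \<in> almost_positive \<Longrightarrow> B \<in> almost_positive \<Longrightarrow> Or A B \<in> almost_positive"
| "A \<in> almost_positive \<Longrightarrow> Box A \<in> almost_positive"
| "A \<in> almost_positive \<Longrightarrow> Dia A \<in> almost_positive"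
| "A \<in> basic \<Longrightarrow> B \<in> almost_positive \<Longrightarrow> Imp A B \<in> almost_positive"

inductive_set constructive :: "fm set" where
  "A \<in> basic \<Longrightarrow> A \<in> constructive"
| "A \<in> constructive \<Longrightarrow> B \<in> constructive \<Longrightarrow> And A B \<in> constructive"
| "A \<in> constructive \<Longrightarrow> Box A \<in> constructive"
| "A \<in> almost_positive \<Longrightarrow> B \<in> constructive \<Longrightarrow> Imp A B \<in> constructive"

definition left_constructive :: "rule \<Rightarrow> bool" where
  "left_constructive R \<longleftrightarrow> (\<exists>\<Gamma> \<Delta> I J P. left_rule \<Gamma> \<Delta> I J P R \<and>
     (\<forall>(B, Q) \<in> set I. set_mset B \<subseteq> basic \<and> set_mset Q \<subseteq> almost_positive \<and> size Q \<le> 1) \<and>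
     (\<forall>C \<in> set J. set_mset C \<subseteq> constructive) \<and>
     set_mset P \<subseteq> almost_positive \<and>
     (length J > 1 \<longrightarrow> (\<forall>C \<in> set J. set_mset C \<subseteq> basic)))"

definition right_constructive :: "rule \<Rightarrow> bool" where
  "right_constructive R \<longleftrightarrow> (\<exists>\<Gamma> I P C. right_rule \<Gamma> I P C R \<and>
     (\<forall>(B, Q) \<in> set I. set_mset B \<subseteq> basic \<and> set_mset Q \<subseteq> almost_positive \<and> size Q \<le> 1) \<and>
     set_mset P \<subseteq> almost_positive \<and>
     set_mset C \<subseteq> constructive \<and> size C \<le> 1)"

definition constructive_rule :: "rule \<Rightarrow> bool" where
  "constructive_rule R \<longleftrightarrow> left_constructive R \<or> right_constructive R"


section \<open>Polynomial-time computability\<close>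

text \<open>
  The machine model is Jones' WHILE language over binary trees: a program works on registers
  holding trees, its input and output are in register 0, and the empty tree stands for false.
  Evaluating an expression costs the number of constructors of the value of each of its
  subexpressions, so that shared subtrees are not available for free and the running time bounds
  the size of every tree produced. With this cost measure, WHILE programs and Turing machines simulate
  each other with polynomial overhead.
\<close>

datatype tree = Leaf | Node tree tree

type_synonym state = "nat \<Rightarrow> tree"

datatype expr =
    Reg nat
  | Const tree
  | Cons_of expr expr
  | Hd_of expr
  | Tl_of expr
  | Eq_of expr expr

primrec hd_tree :: "tree \<Rightarrow> tree" where
  "hd_tree Leaf = Leaf"
| "hd_tree (Node l r) = l"

primrec tl_tree :: "tree \<Rightarrow> tree" where
  "tl_tree Leaf = Leaf"
| "tl_tree (Node l r) = r"

primrec val :: "expr \<Rightarrow> state \<Rightarrow> tree" where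
  "val (Reg x) s = s x"
| "val (Const d) s = d"
| "val (Cons_of e1 e2) s = Node (val e1 s) (val e2 s)"
| "val (Hd_of e) s = hd_tree (val e s)"
| "val (Tl_of e) s = tl_tree (val e s)"
| "val (Eq_of e1 e2) s = (if val e1 s = val e2 s then Node Leaf Leaf else Leaf)"

text \<open>The function \<open>size\<close> counts the nodes, but not the leaves, of a tree.\<close>

primrec cost :: "expr \<Rightarrow> state \<Rightarrow> nat" where
  "cost (Reg x) s = size (s x) + 1"
| "cost (Const d) s = size d + 1"
| "cost (Cons_of e1 e2) s = cost e1 s + cost e2 s + size (val (Cons_of e1 e2) s) + 1"
| "cost (Hd_of e) s = cost e s + size (val (Hd_of e) s) + 1"
| "cost (Tl_of e) s = cost e s + size (val (Tl_of e) s) + 1"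
| "cost (Eq_of e1 e2) s = cost e1 s + cost e2 s + size (val (Eq_of e1 e2) s) + 1"

datatype com =
    Assign nat expr
  | Sequence com com
  | Cond expr com com
  | While expr com

inductive exec :: "com \<Rightarrow> state \<Rightarrow> nat \<Rightarrow> state \<Rightarrow> bool" where
  "exec (Assign x e) s (cost e s + 1) (s(x := val e s))"
| "exec c1 s t1 s1 \<Longrightarrow> exec c2 s1 t2 s2 \<Longrightarrow> exec (Sequence c1 c2) s (t1 + t2) s2"
| "val e s \<noteq> Leaf \<Longrightarrow> exec c1 s t s' \<Longrightarrow> exec (Cond e c1 c2) s (cost e s + t) s'"
| "val e s = Leaf \<Longrightarrow> exec c2 s t s' \<Longrightarrow> exec (Cond e c1 c2) s (cost e s + t) s'"
| "val e s = Leaf \<Longrightarrow> exec (While e c) s (cost e s) s"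
| "val e s \<noteq> Leaf \<Longrightarrow> exec c s t1 s1 \<Longrightarrow> exec (While e c) s1 t2 s2 \<Longrightarrow>
     exec (While e c) s (cost e s + t1 + t2) s2"

definition poly_time :: "(tree \<Rightarrow> tree) \<Rightarrow> bool" where
  "poly_time f \<longleftrightarrow> (\<exists>c a k. \<forall>x. \<exists>t s. exec c ((\<lambda>_. Leaf)(0 := x)) t s \<and>
     s 0 = f x \<and> t \<le> a * size x ^ k + a)"


section \<open>Encodings and feasible provability\<close>

primrec enc_list :: "tree list \<Rightarrow> tree" where
  "enc_list [] = Leaf"
| "enc_list (x # xs) = Node x (enc_list xs)"

text \<open>Numbers are encoded in binary.\<close>

fun enc_nat :: "nat \<Rightarrow> tree" where
  "enc_nat n =
     (if n = 0 then Leaf else Node (if odd n then Node Leaf Leaf else Leaf) (enc_nat (n div 2)))"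

declare enc_nat.simps [simp del]

primrec enc_fm :: "fm \<Rightarrow> tree" where
  "enc_fm (Atom n) = Node (enc_nat 0) (enc_nat n)"
| "enc_fm Top = Node (enc_nat 1) Leaf"
| "enc_fm Bot = Node (enc_nat 2) Leaf"
| "enc_fm (And A B) = Node (enc_nat 3) (Node (enc_fm A) (enc_fm B))"
| "enc_fm (Or A B) = Node (enc_nat 4) (Node (enc_fm A) (enc_fm B))"
| "enc_fm (Imp A B) = Node (enc_nat 5) (Node (enc_fm A) (enc_fm B))"
| "enc_fm (Box A) = Node (enc_nat 6) (enc_fm A)"
| "enc_fm (Dia A) = Node (enc_nat 7) (enc_fm A)"

text \<open>
  A sequent has several encodings, because its two multisets are represented by lists in an
  arbitrary order.
\<close>

definition encodes_seq :: "tree \<Rightarrow> sequent \<Rightarrow> bool" where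
  "encodes_seq x S \<longleftrightarrow> (\<exists>As Bs. mset As = ante S \<and> mset Bs = succ S \<and>
     x = Node (enc_list (map enc_fm As)) (enc_list (map enc_fm Bs)))"

definition encodes_seqs :: "tree \<Rightarrow> sequent list \<Rightarrow> bool" where
  "encodes_seqs x Ss \<longleftrightarrow> (\<exists>xs. list_all2 encodes_seq xs Ss \<and> x = enc_list xs)"

text \<open>
  The algorithm is given the sequents of an instance only, not the substitution that produces
  it, and it has to work for every encoding of these sequents.
\<close>

definition feasibly_proves :: "calculus \<Rightarrow> rule \<Rightarrow> bool" where
  "feasibly_proves G R \<longleftrightarrow> (\<exists>f. poly_time f \<and>
     (\<forall>Ss S x y. rule_instance R Ss S \<and> encodes_seqs x Ss \<and> encodes_seq y S \<longrightarrow>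
        (\<exists>\<pi>. encodes_seqs (f (Node x y)) \<pi> \<and> is_proof G Ss \<pi> S)))"

end

theory Submission
  imports Defs
begin

text \<open>
  Internalise the rule: \<open>Ax\<close> is the implication from the conjunction of the premises with succedent
  \<open>\<psi>\<^sub>i\<close>, written as \<open>\<And>\<phi>\<^sub>i \<rightarrow> \<Or>\<psi>\<^sub>i\<close>, and of \<open>\<And>\<eta>\<close> to the disjunction of the \<open>\<And>\<theta>\<^sub>j\<close> (for a right rule,
  to the conclusion). Applying \<open>R\<close> with \<open>\<Gamma>\<close> the antecedent of \<open>Ax\<close> and \<open>\<Delta>\<close> its succedent proves \<open>Ax\<close>;
  conversely a cut with \<open>Ax\<close> simulates \<open>R\<close>. Both derivations have a fixed shape that only has to be
  filled with the formulas of the given instance, except that \<open>Ax\<close> has to be weakened by the context.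
  The algorithm is not given the substitution: it tries all assignments of subformulas of the
  instance to the atoms of \<open>R\<close> and compares the sides of the sequents as multisets.
\<close>

section \<open>Polynomial-time functions on trees\<close>

text \<open>The substitution cannot be read off directly: the sides of the given sequents are lists
  in arbitrary order, so it is unknown which member instantiates which formula of the rule. Trying
  all choices is affordable because \<open>R\<close> is fixed: the search is nested once per atom of
  the rule, a depth independent of the input. Multiset variables are never guessed. Once the atoms
  are fixed, \<Gamma> is what remains of the antecedent of the conclusion after the instances of its
  formulas are subtracted, and \<Delta> in a left rule is the succedent of the conclusion. The
  substitution found may differ from the one that produced the instance. This is harmless, since the
  comparison certifies that the given sequents are also an instance under it. The equivalence for
  constructivity has its own obstacle: a rule is constructive if some presentation of it as a left
  or right rule is suitable. Presentations are therefore shown to be unique up to the order of the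
  families, so that the formula built from one of them decides the question.\<close>

inductive npoly :: "(nat \<Rightarrow> nat) \<Rightarrow> bool" where
  const: "npoly (\<lambda>_. c)"
| ident: "npoly (\<lambda>n. n)"
| add: "npoly p \<Longrightarrow> npoly q \<Longrightarrow> npoly (\<lambda>n. p n + q n)"
| mult: "npoly p \<Longrightarrow> npoly q \<Longrightarrow> npoly (\<lambda>n. p n * q n)"

lemma npoly_mono: "npoly p \<Longrightarrow> m \<le> n \<Longrightarrow> p m \<le> p n"
  by (induction rule: npoly.induct) (simp_all add: add_mono mult_le_mono)

lemma npoly_comp: "npoly p \<Longrightarrow> npoly q \<Longrightarrow> npoly (\<lambda>n. p (q n))"
  by (induction rule: npoly.induct) (simp_all add: npoly.intros)

text \<open>The summand 1 covers \<open>n = 0\<close>, where \<open>n ^ 0\<close> is 1 but higher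
  powers vanish.\<close>

lemma pow_le: "n ^ k \<le> n ^ (k + j) + (1::nat)"
proof (cases "n = 0")
  case False
  then have "n ^ k \<le> n ^ (k + j)" by (intro power_increasing) auto
  then show ?thesis by simp
qed (cases k; simp)

text \<open>Bounds are combined by the closure rules of \<open>npoly\<close>; the shape
  \<open>a * n ^ k + a\<close> demanded by \<open>poly_time\<close> is extracted only once, at the
  end.\<close>

lemma npoly_bound: "npoly p \<Longrightarrow> \<exists>a k. \<forall>n. p n \<le> a * n ^ k + a"
proof (induction rule: npoly.induct)
  case (const c)
  show ?case by (rule exI[of _ c]) auto
next
  case ident
  show ?case by (rule exI[of _ 1], rule exI[of _ 1]) auto
next
  case (add p q)
  then obtain a k b j where a: "\<And>n. p n \<le> a * n ^ k + a" and b: "\<And>n. q n \<le> b * n ^ j + b"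
    by blast
  have "p n + q n \<le> (2 * a + 2 * b) * n ^ (k + j) + (2 * a + 2 * b)" for n
  proof -
    have "n ^ k \<le> n ^ (k + j) + 1" "n ^ j \<le> n ^ (k + j) + 1"
      using pow_le[of n k j] pow_le[of n j k] by (simp_all add: add.commute)
    then have "a * n ^ k \<le> a * (n ^ (k + j) + 1)" "b * n ^ j \<le> b * (n ^ (k + j) + 1)"
      by (simp_all only: mult_le_mono2)
    with a[of n] b[of n] show ?thesis by (simp add: algebra_simps)
  qed
  then show ?case by blast
next
  case (mult p q)
  then obtain a k b j where a: "\<And>n. p n \<le> a * n ^ k + a" and b: "\<And>n. q n \<le> b * n ^ j + b"
    by blast
  \<comment> \<open>Expanding yields four products, each at most
    \<open>a * b * (n ^ (k + j) + 1)\<close>.\<close>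
  have "p n * q n \<le> (4 * a * b) * n ^ (k + j) + 4 * a * b" for n
  proof -
    have "n ^ k \<le> n ^ (k + j) + 1" "n ^ j \<le> n ^ (k + j) + 1"
      using pow_le[of n k j] pow_le[of n j k] by (simp_all add: add.commute)
    then have *: "a * b * n ^ k \<le> a * b * (n ^ (k + j) + 1)" "a * b * n ^ j \<le> a * b * (n ^ (k + j) + 1)"
      by (simp_all only: mult_le_mono2)
    have "p n * q n \<le> (a * n ^ k + a) * (b * n ^ j + b)"
      using a b by (rule mult_mono) auto
    also have "\<dots> = a * b * n ^ (k + j) + a * b * n ^ k + a * b * n ^ j + a * b"
      by (simp add: algebra_simps power_add)
    also have "\<dots> \<le> (4 * a * b) * n ^ (k + j) + 4 * a * b"
      using * by (simp add: algebra_simps)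
    finally show ?thesis .
  qed
  then show ?case by blast
qed

section \<open>Running time and size of the registers\<close>

lemma size_val_le_cost: "size (val e s) \<le> cost e s"
  by (cases e) auto

text \<open>An assignment costs at least the size of the value assigned, so every time bound also
  bounds the size of the output, as recorded in \<open>ptE\<close>.\<close>

lemma exec_size: "exec c s t s' \<Longrightarrow> size (s' r) \<le> size (s r) + t"
proof (induction rule: exec.induct)
  case (1 x e s)
  then show ?case using size_val_le_cost[of e s] by (cases "r = x") simp_all
qed simp_all

text \<open>
  The program must work whatever the registers below \<open>n\<close> other than the input contain, and it must
  leave those from \<open>n\<close> on alone; this is what makes programs composable.
\<close>

definition pt :: "(tree \<Rightarrow> tree) \<Rightarrow> bool" where
  "pt f \<longleftrightarrow> (\<exists>c n p. npoly p \<and> 0 < n \<and> (\<forall>s. \<exists>t s'. exec c s t s' \<and> s' 0 = f (s 0) \<and>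
     (\<forall>r\<ge>n. s' r = s r) \<and> t \<le> p (size (s 0))))"

lemma ptI:
  assumes "npoly p" "0 < n"
    "\<And>s. \<exists>t s'. exec c s t s' \<and> s' 0 = f (s 0) \<and> (\<forall>r\<ge>n. s' r = s r) \<and> t \<le> p (size (s 0))"
  shows "pt f"
  using assms unfolding pt_def by blast

lemma ptE:
  assumes "pt f"
  obtains c n p where "npoly p" "0 < n"
    "\<And>s. \<exists>t s'. exec c s t s' \<and> s' 0 = f (s 0) \<and> (\<forall>r\<ge>n. s' r = s r) \<and> t \<le> p (size (s 0)) \<and>
      size (f (s 0)) \<le> size (s 0) + p (size (s 0))"
proof -
  from assms obtain c n p where *: "npoly p" "0 < n"
    "\<And>s. \<exists>t s'. exec c s t s' \<and> s' 0 = f (s 0) \<and> (\<forall>r\<ge>n. s' r = s r) \<and> t \<le> p (size (s 0))"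
    unfolding pt_def by blast
  show thesis
  proof (rule that[OF *(1,2)])
    fix s
    obtain t s' where 1: "exec c s t s'" "s' 0 = f (s 0)" "\<forall>r\<ge>n. s' r = s r" "t \<le> p (size (s 0))"
      using *(3) by blast
    with exec_size[OF 1(1), of 0] show "\<exists>t s'. exec c s t s' \<and> s' 0 = f (s 0) \<and> (\<forall>r\<ge>n. s' r = s r) \<and>
        t \<le> p (size (s 0)) \<and> size (f (s 0)) \<le> size (s 0) + p (size (s 0))"
      by (intro exI[of _ t] exI[of _ s']) simp
  qed
qed

lemma pt_poly_time:
  assumes "pt f"
  shows "poly_time f"
proof -
  from assms obtain c n p where p: "npoly p" and ex: "\<And>s. \<exists>t s'. exec c s t s' \<and> s' 0 = f (s 0) \<and>
    (\<forall>r\<ge>n. s' r = s r) \<and> t \<le> p (size (s 0))"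
    unfolding pt_def by blast
  obtain a k where ak: "\<And>n. p n \<le> a * n ^ k + a" using npoly_bound[OF p] by blast
  show "poly_time f"
    unfolding poly_time_def
  proof (rule exI[of _ c], rule exI[of _ a], rule exI[of _ k], rule allI)
    fix x
    from ex[of "(\<lambda>_. Leaf)(0 := x)"] obtain t s' where 1: "exec c ((\<lambda>_. Leaf)(0 := x)) t s'"
      "s' 0 = f x" "t \<le> p (size x)" by auto
    have "t \<le> a * size x ^ k + a" by (rule le_trans[OF 1(3) ak])
    with 1 show "\<exists>t s. exec c ((\<lambda>_. Leaf)(0 := x)) t s \<and> s 0 = f x \<and> t \<le> a * size x ^ k + a"
      by blast
  qed
qed

section \<open>Closure properties of the polynomial-time functions\<close>

lemma exec_Assign: "t = cost e s + 1 \<Longrightarrow> s' = s(x := val e s) \<Longrightarrow> exec (Assign x e) s t s'"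
  by (simp only: exec.intros)

lemma exec_Sequence: "exec c1 s t1 s1 \<Longrightarrow> exec c2 s1 t2 s2 \<Longrightarrow> t = t1 + t2 \<Longrightarrow>
    exec (Sequence c1 c2) s t s2"
  by (simp only: exec.intros)

lemma pt_expr:
  assumes "npoly p" "\<And>s. val e s = f (s 0)" "\<And>s. cost e s \<le> p (size (s 0))"
  shows "pt f"
proof (rule ptI[where c = "Assign 0 e" and n = 1 and p = "\<lambda>n. p n + 1"])
  show "\<exists>t s'. exec (Assign 0 e) s t s' \<and> s' 0 = f (s 0) \<and> (\<forall>r\<ge>1. s' r = s r) \<and>
      t \<le> p (size (s 0)) + 1" for s
    using assms(2,3)[of s] by (intro exI conjI) (rule exec.intros, auto)
qed ((intro npoly.intros assms(1))[1], simp)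

lemma size_hd_tree [simp]: "size (hd_tree x) \<le> size x"
  by (cases x) auto

lemma size_tl_tree [simp]: "size (tl_tree x) \<le> size x"
  by (cases x) auto

lemma pt_id: "pt (\<lambda>x. x)"
  by (rule pt_expr[where e = "Reg 0" and p = "\<lambda>n. n + 1"]) ((intro npoly.intros)[1], auto)

lemma pt_const: "pt (\<lambda>_. d)"
  by (rule pt_expr[where e = "Const d" and p = "\<lambda>n. size d + 1"]) ((intro npoly.intros)[1], auto)

lemma pt_hd_tree: "pt hd_tree"
  by (rule pt_expr[where e = "Hd_of (Reg 0)" and p = "\<lambda>n. n + (n + 2)"])
    ((intro npoly.intros)[1], auto)

lemma pt_tl_tree: "pt tl_tree"
  by (rule pt_expr[where e = "Tl_of (Reg 0)" and p = "\<lambda>n. n + (n + 2)"])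
    ((intro npoly.intros)[1], auto)

lemma pt_comp:
  assumes "pt f" "pt g"
  shows "pt (\<lambda>x. f (g x))"
proof -
  obtain c n p where f: "npoly p" "0 < n"
    "\<And>s. \<exists>t s'. exec c s t s' \<and> s' 0 = f (s 0) \<and> (\<forall>r\<ge>n. s' r = s r) \<and> t \<le> p (size (s 0)) \<and>
      size (f (s 0)) \<le> size (s 0) + p (size (s 0))" using assms(1) by (rule ptE) blast
  obtain d m q where g: "npoly q" "0 < m"
    "\<And>s. \<exists>t s'. exec d s t s' \<and> s' 0 = g (s 0) \<and> (\<forall>r\<ge>m. s' r = s r) \<and> t \<le> q (size (s 0)) \<and>
      size (g (s 0)) \<le> size (s 0) + q (size (s 0))" using assms(2) by (rule ptE) blast
  show ?thesis
  \<comment> \<open>The argument \<open>n + q n\<close> bounds the intermediate value on which the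
    second program runs.\<close>
  proof (rule ptI[where c = "Sequence d c" and n = "max n m" and p = "\<lambda>n. q n + p (n + q n)"])
    fix s
    obtain t1 s1 where 1: "exec d s t1 s1" "s1 0 = g (s 0)" "\<forall>r\<ge>m. s1 r = s r" "t1 \<le> q (size (s 0))"
      "size (g (s 0)) \<le> size (s 0) + q (size (s 0))" using g(3) by blast
    obtain t2 s2 where 2: "exec c s1 t2 s2" "s2 0 = f (s1 0)" "\<forall>r\<ge>n. s2 r = s1 r"
      "t2 \<le> p (size (s1 0))" using f(3) by blast
    have "t1 + t2 \<le> q (size (s 0)) + p (size (s 0) + q (size (s 0)))"
      using 1 2 npoly_mono[OF f(1), of "size (s1 0)"] by fastforce
    then show "\<exists>t s'. exec (Sequence d c) s t s' \<and> s' 0 = f (g (s 0)) \<and>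
        (\<forall>r\<ge>max n m. s' r = s r) \<and> t \<le> q (size (s 0)) + p (size (s 0) + q (size (s 0)))"
      by (intro exI[of _ "t1 + t2"] exI[of _ s2]) (use 1 2 in \<open>simp add: exec.intros(2)[OF 1(1) 2(1)]\<close>)
  qed ((intro npoly.intros npoly_comp[OF f(1)] g(1))[1], use f(2) in simp)
qed

lemma pt_Node:
  assumes "pt f" "pt g"
  shows "pt (\<lambda>x. Node (f x) (g x))"
proof -
  obtain c n p where f: "npoly p" "0 < n"
    "\<And>s. \<exists>t s'. exec c s t s' \<and> s' 0 = f (s 0) \<and> (\<forall>r\<ge>n. s' r = s r) \<and> t \<le> p (size (s 0)) \<and>
      size (f (s 0)) \<le> size (s 0) + p (size (s 0))" using assms(1) by (rule ptE) blast
  obtain d m q where g: "npoly q" "0 < m"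
    "\<And>s. \<exists>t s'. exec d s t s' \<and> s' 0 = g (s 0) \<and> (\<forall>r\<ge>m. s' r = s r) \<and> t \<le> q (size (s 0)) \<and>
      size (g (s 0)) \<le> size (s 0) + q (size (s 0))" using assms(2) by (rule ptE) blast
  let ?k = "max n m"
  show ?thesis
  proof (rule ptI[where c = "Sequence (Assign ?k (Reg 0)) (Sequence c (Sequence
        (Assign (Suc ?k) (Reg 0)) (Sequence (Assign 0 (Reg ?k)) (Sequence d
        (Assign 0 (Cons_of (Reg (Suc ?k)) (Reg 0)))))))" and n = "?k + 2"
        and p = "\<lambda>n. 20 + (20 * n + (5 * p n + 5 * q n))"])
    fix s :: state
    let ?x = "s 0"
    obtain t1 s1 where 1: "exec c (s(?k := ?x)) t1 s1" "s1 0 = f ?x" "\<forall>r\<ge>n. s1 r = (s(?k := ?x)) r"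
      "t1 \<le> p (size ?x)" "size (f ?x) \<le> size ?x + p (size ?x)"
      using f(2) f(3)[of "s(?k := ?x)"] by auto
    let ?s = "s1(Suc ?k := f ?x, 0 := ?x)"
    obtain t2 s2 where 2: "exec d ?s t2 s2" "s2 0 = g ?x" "\<forall>r\<ge>m. s2 r = ?s r"
      "t2 \<le> q (size ?x)" "size (g ?x) \<le> size ?x + q (size ?x)"
      using g(3)[of ?s] by auto
    have pos: "n > 0" "m > 0" using f g by auto
    have k: "s1 ?k = ?x" "s2 (Suc ?k) = f ?x" using 1 2 pos by auto
    show "\<exists>t s'. exec (Sequence (Assign ?k (Reg 0)) (Sequence c (Sequence
        (Assign (Suc ?k) (Reg 0)) (Sequence (Assign 0 (Reg ?k)) (Sequence d
        (Assign 0 (Cons_of (Reg (Suc ?k)) (Reg 0)))))))) s t s' \<and> s' 0 = Node (f ?x) (g ?x) \<and>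
        (\<forall>r\<ge>?k + 2. s' r = s r) \<and>
        t \<le> 20 + (20 * size ?x + (5 * p (size ?x) + 5 * q (size ?x)))"
    proof (intro exI conjI)
      show "exec (Sequence (Assign ?k (Reg 0)) (Sequence c (Sequence
        (Assign (Suc ?k) (Reg 0)) (Sequence (Assign 0 (Reg ?k)) (Sequence d
        (Assign 0 (Cons_of (Reg (Suc ?k)) (Reg 0)))))))) s
        (size ?x + 2 + (t1 + (size (f ?x) + 2 + (size ?x + 2 +
          (t2 + (2 * size (f ?x) + 2 * size (g ?x) + 5))))))
        (s2(0 := Node (f ?x) (g ?x)))"
        by (rule exec_Sequence[OF exec_Assign[OF refl refl]],
            rule exec_Sequence, (simp, rule 1(1)),
            rule exec_Sequence[OF exec_Assign[OF refl refl]],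
            rule exec_Sequence[OF exec_Assign[OF refl refl]],
            rule exec_Sequence, (use k 1 2 pos in simp),
            rule exec_Assign[OF refl])
          (use k 1 2 pos in simp_all)
      show "\<forall>r\<ge>?k + 2. (s2(0 := Node (f ?x) (g ?x))) r = s r" using 1 2 by auto
    qed (use 1 2 in auto)
  qed ((intro npoly.intros f(1) g(1))[1], use f(2) in simp)
qed

lemma pt_hd: "pt f \<Longrightarrow> pt (\<lambda>x. hd_tree (f x))"
  by (rule pt_comp[OF pt_hd_tree])

lemma pt_tl: "pt f \<Longrightarrow> pt (\<lambda>x. tl_tree (f x))"
  by (rule pt_comp[OF pt_tl_tree])

abbreviation tru :: tree where
  "tru \<equiv> Node Leaf Leaf"

lemma pt_eq:
  assumes "pt f" "pt g"
  shows "pt (\<lambda>x. if f x = g x then tru else Leaf)"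
proof -
  have "pt (\<lambda>z. if hd_tree z = tl_tree z then tru else Leaf)"
  proof (rule pt_expr[where e = "Eq_of (Hd_of (Reg 0)) (Tl_of (Reg 0))" and p = "\<lambda>n. 4 * n + 6"])
    fix s :: state
    show "cost (Eq_of (Hd_of (Reg 0)) (Tl_of (Reg 0))) s \<le> 4 * size (s 0) + 6"
      using size_hd_tree[of "s 0"] size_tl_tree[of "s 0"] by (auto simp del: size_hd_tree size_tl_tree)
  qed ((intro npoly.intros)[1], simp)
  from pt_comp[OF this pt_Node[OF assms]] show ?thesis by simp
qed

text \<open>Computing the test may destroy the input, so its value is paired with a copy of the
  input; each branch starts by discarding that value.\<close>

lemma pt_if:
  assumes "pt b" "pt f" "pt g"
  shows "pt (\<lambda>x. if b x = Leaf then g x else f x)"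
proof -
  obtain c n p where f: "npoly p" "0 < n"
    "\<And>s. \<exists>t s'. exec c s t s' \<and> s' 0 = f (s 0) \<and> (\<forall>r\<ge>n. s' r = s r) \<and> t \<le> p (size (s 0)) \<and>
      size (f (s 0)) \<le> size (s 0) + p (size (s 0))" using assms(2) by (rule ptE) blast
  obtain d m q where g: "npoly q" "0 < m"
    "\<And>s. \<exists>t s'. exec d s t s' \<and> s' 0 = g (s 0) \<and> (\<forall>r\<ge>m. s' r = s r) \<and> t \<le> q (size (s 0)) \<and>
      size (g (s 0)) \<le> size (s 0) + q (size (s 0))" using assms(3) by (rule ptE) blast
  let ?a = "Assign 0 (Tl_of (Reg 0))"
  have "pt (\<lambda>z. if hd_tree z = Leaf then g (tl_tree z) else f (tl_tree z))"
  proof (rule ptI[where c = "Cond (Hd_of (Reg 0)) (Sequence ?a c) (Sequence ?a d)" and n = "max n m"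
        and p = "\<lambda>n. 4 * n + (10 + (p n + q n))"])
    fix s :: state
    let ?y = "tl_tree (s 0)"
    obtain t1 s1 where 1: "exec c (s(0 := ?y)) t1 s1" "s1 0 = f ?y" "\<forall>r\<ge>n. s1 r = (s(0 := ?y)) r"
      "t1 \<le> p (size ?y)" using f(3)[of "s(0 := ?y)"] by auto
    obtain t2 s2 where 2: "exec d (s(0 := ?y)) t2 s2" "s2 0 = g ?y" "\<forall>r\<ge>m. s2 r = (s(0 := ?y)) r"
      "t2 \<le> q (size ?y)" using g(3)[of "s(0 := ?y)"] by auto
    have le: "p (size ?y) \<le> p (size (s 0))" "q (size ?y) \<le> q (size (s 0))"
      using f(1) g(1) by (auto intro: npoly_mono)
    have sz: "size (hd_tree (s 0)) + size (tl_tree (s 0)) \<le> size (s 0)" by (cases "s 0") auto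
    have a: "exec ?a s (size (s 0) + size ?y + 3) (s(0 := ?y))"
      by (rule exec_Assign) simp_all
    show "\<exists>t s'. exec (Cond (Hd_of (Reg 0)) (Sequence ?a c) (Sequence ?a d)) s t s' \<and>
        s' 0 = (if hd_tree (s 0) = Leaf then g ?y else f ?y) \<and> (\<forall>r\<ge>max n m. s' r = s r) \<and>
        t \<le> 4 * size (s 0) + (10 + (p (size (s 0)) + q (size (s 0))))"
    proof (cases "hd_tree (s 0) = Leaf")
      case True
      then have "exec (Cond (Hd_of (Reg 0)) (Sequence ?a c) (Sequence ?a d)) s
          (cost (Hd_of (Reg 0)) s + (size (s 0) + size ?y + 3 + t2)) s2"
        by (intro exec.intros(4)[OF _ exec.intros(2)[OF a 2(1)]]) simp
      with True show ?thesis
        by (intro exI[of _ "cost (Hd_of (Reg 0)) s + (size (s 0) + size ?y + 3 + t2)"] exI[of _ s2])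
          (use 2 le g(2) sz in \<open>simp del: size_tl_tree\<close>)
    next
      case False
      then have "exec (Cond (Hd_of (Reg 0)) (Sequence ?a c) (Sequence ?a d)) s
          (cost (Hd_of (Reg 0)) s + (size (s 0) + size ?y + 3 + t1)) s1"
        by (intro exec.intros(3)[OF _ exec.intros(2)[OF a 1(1)]]) simp
      with False show ?thesis
        by (intro exI[of _ "cost (Hd_of (Reg 0)) s + (size (s 0) + size ?y + 3 + t1)"] exI[of _ s1])
          (use 1 le f(2) sz in \<open>simp del: size_tl_tree\<close>)
    qed
  qed ((intro npoly.intros f(1) g(1))[1], use f(2) in simp)
  from pt_comp[OF this pt_Node[OF assms(1) pt_id]] show ?thesis by (simp cong: if_cong)
qed

text \<open>The body receives the whole remaining list and not just its head, so that a loop can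
  also output suffixes. Parameters enter through \<open>c\<close>, because the body is one fixed
  function on trees.\<close>

primrec loop :: "(tree \<Rightarrow> tree) \<Rightarrow> tree \<Rightarrow> tree \<Rightarrow> tree \<Rightarrow> tree" where
  "loop g c Leaf acc = acc"
| "loop g c (Node h l) acc = loop g c l (g (Node c (Node (Node h l) acc)))"

text \<open>Growth is required to be additive: if each round could multiply the size of the
  accumulator, it might become exponential. The invariant is
  \<open>size acc + size l * Q \<le> A\<close>; as every list cell is a node, \<open>size l\<close>
  also bounds the number of rounds. The registers \<open>n\<close>, \<open>n + 1\<close>,
  \<open>n + 2\<close> hold the parameter, the remaining list and the accumulator.\<close>

lemma exec_loop:
  fixes g :: "tree \<Rightarrow> tree"
  assumes body: "npoly p" "0 < n"
    "\<And>s. \<exists>t s'. exec b s t s' \<and> s' 0 = g (s 0) \<and> (\<forall>r\<ge>n. s' r = s r) \<and> t \<le> p (size (s 0))"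
    and growth: "\<And>l acc. size l \<le> L \<Longrightarrow> size (g (Node c (Node l acc))) \<le> size acc + Q"
  defines "W \<equiv> While (Reg (n + 1)) (Sequence (Assign 0 (Cons_of (Reg n) (Cons_of (Reg (n + 1))
      (Reg (n + 2))))) (Sequence b (Sequence (Assign (n + 2) (Reg 0))
      (Assign (n + 1) (Tl_of (Reg (n + 1)))))))"
  shows "s n = c \<Longrightarrow> s (n + 1) = l \<Longrightarrow> s (n + 2) = acc \<Longrightarrow> size l \<le> L \<Longrightarrow>
    size acc + size l * Q \<le> A \<Longrightarrow>
    \<exists>t s'. exec W s t s' \<and> s' (n + 2) = loop g c l acc \<and> (\<forall>r\<ge>n + 3. s' r = s r) \<and>
      t \<le> (size l + 1) * (p (size c + L + A + 2) + 10 * (size c + L + A) + 30)"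
proof (induction l arbitrary: s acc)
  case Leaf
  have "exec W s (cost (Reg (n + 1)) s) s"
    unfolding W_def by (rule exec.intros) (use Leaf in simp)
  with Leaf show ?case by (intro exI[of _ "cost (Reg (n + 1)) s"] exI[of _ s]) simp
next
  case (Node h l)
  let ?T = "p (size c + L + A + 2) + 10 * (size c + L + A) + 30"
  let ?l = "Node h l"
  let ?x = "Node c (Node ?l acc)"
  let ?s = "s(0 := ?x)"
  obtain t1 s1 where 1: "exec b ?s t1 s1" "s1 0 = g ?x" "\<forall>r\<ge>n. s1 r = ?s r" "t1 \<le> p (size ?x)"
    using body(3)[of ?s] by auto
  let ?s1 = "s1(n + 2 := g ?x, n + 1 := l)"
  have s1: "s1 n = c" "s1 (Suc n) = ?l" using 1 Node.prems body(2) by auto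
  have sz: "size (g ?x) \<le> size acc + Q" using Node.prems growth by blast
  \<comment> \<open>\<open>size ?l\<close> exceeds \<open>size l\<close> by at least 1, which pays
    for the \<open>Q\<close> gained in this round.\<close>
  then have szA: "size (g ?x) \<le> A" "size acc \<le> A" "size (g ?x) + size l * Q \<le> A"
    using Node.prems by (auto simp: algebra_simps)
  have "\<exists>t s'. exec W ?s1 t s' \<and> s' (n + 2) = loop g c l (g ?x) \<and> (\<forall>r\<ge>n + 3. s' r = ?s1 r) \<and>
      t \<le> (size l + 1) * ?T"
    by (rule Node.IH(2)) (use Node.prems szA s1 in auto)
  then obtain t2 s2 where 2: "exec W ?s1 t2 s2" "s2 (n + 2) = loop g c l (g ?x)"
    "\<forall>r\<ge>n + 3. s2 r = ?s1 r" "t2 \<le> (size l + 1) * ?T" by blast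
  let ?cs = "size c + 2 * size ?l + 2 * size acc + size ?x + 6"
  have step: "exec (Sequence (Assign 0 (Cons_of (Reg n) (Cons_of (Reg (n + 1))
      (Reg (n + 2))))) (Sequence b (Sequence (Assign (n + 2) (Reg 0))
      (Assign (n + 1) (Tl_of (Reg (n + 1))))))) s
      (?cs + 1 + (t1 + (size (g ?x) + 2 + (size ?l + size l + 3)))) ?s1"
    by (rule exec_Sequence[OF exec_Assign[OF refl refl]],
        rule exec_Sequence, (use Node.prems in simp, rule 1(1)),
        rule exec_Sequence[OF exec_Assign[OF refl refl]],
        rule exec_Assign[OF refl])
      (use Node.prems s1 1 in simp_all)
  have "exec W s (cost (Reg (n + 1)) s + (?cs + 1 + (t1 + (size (g ?x) + 2 + (size ?l + size l + 3)))) + t2) s2"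
    unfolding W_def
    by (rule exec.intros(6)[OF _ step]) (use Node.prems 2 in \<open>simp_all add: W_def\<close>)
  moreover have "t1 \<le> p (size c + L + A + 2)"
    using 1(4) Node.prems szA by (auto elim!: order_trans intro!: npoly_mono[OF body(1)])
  then have "cost (Reg (n + 1)) s + (?cs + 1 + (t1 + (size (g ?x) + 2 + (size ?l + size l + 3)))) + t2
      \<le> (size ?l + 1) * ?T"
    using 2(4) Node.prems szA sz by (auto simp: algebra_simps)
  ultimately show ?case using 2 1 by (intro exI conjI) auto
qed

lemma pt_loop:
  assumes "pt g" "npoly q"
    and growth: "\<And>c l acc. size (g (Node c (Node l acc))) \<le> size acc + q (size c + size l)"
    and "pt c" "pt l" "pt a"
  shows "pt (\<lambda>x. loop g (c x) (l x) (a x))"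
proof -
  obtain b n p where g: "npoly p" "0 < n"
    "\<And>s. \<exists>t s'. exec b s t s' \<and> s' 0 = g (s 0) \<and> (\<forall>r\<ge>n. s' r = s r) \<and> t \<le> p (size (s 0)) \<and>
      size (g (s 0)) \<le> size (s 0) + p (size (s 0))" using assms(1) by (rule ptE) blast
  let ?W = "While (Reg (n + 1)) (Sequence (Assign 0 (Cons_of (Reg n) (Cons_of (Reg (n + 1))
      (Reg (n + 2))))) (Sequence b (Sequence (Assign (n + 2) (Reg 0))
      (Assign (n + 1) (Tl_of (Reg (n + 1)))))))"
  let ?I1 = "Assign n (Hd_of (Reg 0))" and ?I2 = "Assign (n + 1) (Hd_of (Tl_of (Reg 0)))"
    and ?I3 = "Assign (n + 2) (Tl_of (Tl_of (Reg 0)))" and ?E = "Assign 0 (Reg (n + 2))"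
  \<comment> \<open>On an input of size \<open>m\<close> the accumulator starts with size at most
    \<open>m\<close> and gains at most \<open>q (m + m)\<close> in each of at most \<open>m\<close>
    rounds.\<close>
  let ?A = "\<lambda>m. m + m * q (m + m)"
  let ?P = "\<lambda>m. (m + 1) * (p (m + m + ?A m + 2) + (10 * (m + m + ?A m) + 30))"
  let ?P' = "\<lambda>m. 12 * m + (60 + (?P m + ?P m))"
  have "pt (\<lambda>z. loop g (hd_tree z) (hd_tree (tl_tree z)) (tl_tree (tl_tree z)))"
  proof (rule ptI[where c = "Sequence ?I1 (Sequence ?I2 (Sequence ?I3 (Sequence ?W ?E)))"
        and n = "n + 3" and p = ?P'])
    fix s :: state
    let ?c = "hd_tree (s 0)" and ?l = "hd_tree (tl_tree (s 0))" and ?a = "tl_tree (tl_tree (s 0))"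
    let ?m = "size (s 0)"
    let ?s = "s(n := ?c, n + 1 := ?l, n + 2 := ?a)"
    have "size (hd_tree (s 0)) + size (tl_tree (s 0)) \<le> size (s 0)"
      by (cases "s 0") auto
    moreover have "size ?l + size ?a \<le> size (tl_tree (s 0))"
      by (cases "tl_tree (s 0)") auto
    ultimately have sz: "size ?c \<le> ?m" "size ?l \<le> ?m" "size ?a \<le> ?m" "size (tl_tree (s 0)) \<le> ?m"
      by auto
    have ex: "\<exists>t s'. exec b s t s' \<and> s' 0 = g (s 0) \<and> (\<forall>r\<ge>n. s' r = s r) \<and> t \<le> p (size (s 0))" for s
      using g(3)[of s] by blast
    have A: "size ?a + size ?l * q (?m + ?m) \<le> ?A ?m"
      by (intro add_mono mult_le_mono sz order_refl)
    have gr: "size (g (Node ?c (Node l acc))) \<le> size acc + q (?m + ?m)" if "size l \<le> ?m" for l acc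
      using growth[of ?c l acc] npoly_mono[OF assms(2), of "size ?c + size l" "?m + ?m"] that sz
      by linarith
    define T where "T = p (?m + ?m + ?A ?m + 2) + (10 * (?m + ?m + ?A ?m) + 30)"
    obtain t s1 where 1: "exec ?W ?s t s1" "s1 (n + 2) = loop g ?c ?l ?a"
      "\<forall>r\<ge>n + 3. s1 r = ?s r"
      "t \<le> (size ?l + 1) * (p (size ?c + ?m + ?A ?m + 2) + 10 * (size ?c + ?m + ?A ?m) + 30)"
      using exec_loop[where s = ?s and c = ?c and l = ?l and acc = ?a and A = "?A ?m", OF g(1,2) ex gr
          _ _ _ sz(2) A] by auto
    have "p (size ?c + ?m + ?A ?m + 2) \<le> p (?m + ?m + ?A ?m + 2)"
      by (intro npoly_mono[OF g(1)]) (use sz(1) in simp)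
    then have "p (size ?c + ?m + ?A ?m + 2) + (10 * (size ?c + ?m + ?A ?m) + 30) \<le> T"
      unfolding T_def by (intro add_mono mult_le_mono order_refl sz)
    then have "p (size ?c + ?m + ?A ?m + 2) + 10 * (size ?c + ?m + ?A ?m) + 30 \<le> T"
      by (simp only: add.assoc)
    with sz(2) have "(size ?l + 1) * (p (size ?c + ?m + ?A ?m + 2) + 10 * (size ?c + ?m + ?A ?m) + 30)
        \<le> (?m + 1) * T" by (intro mult_le_mono) simp_all
    with 1(4) have t: "t \<le> (?m + 1) * T" by (rule le_trans)
    have loop_sz: "size (loop g ?c ?l ?a) \<le> ?m + t"
      using exec_size[OF 1(1), of "n + 2"] 1(2) sz(3) by simp
    have P': "?P' ?m = 12 * ?m + (60 + ((?m + 1) * T + (?m + 1) * T))" by (simp only: T_def)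
    show "\<exists>t s'. exec (Sequence ?I1 (Sequence ?I2 (Sequence ?I3 (Sequence ?W ?E)))) s t s' \<and>
        s' 0 = loop g ?c ?l ?a \<and> (\<forall>r\<ge>n + 3. s' r = s r) \<and> t \<le> ?P' ?m"
    proof (intro exI conjI)
      show "exec (Sequence ?I1 (Sequence ?I2 (Sequence ?I3 (Sequence ?W ?E)))) s
          (size (s 0) + size ?c + 3 + (size (s 0) + size (tl_tree (s 0)) + size ?l + 4 +
          (size (s 0) + size (tl_tree (s 0)) + size ?a + 4 + (t + (size (loop g ?c ?l ?a) + 2)))))
          (s1(0 := loop g ?c ?l ?a))"
        by (rule exec_Sequence[OF exec_Assign[OF refl refl]],
            rule exec_Sequence[OF exec_Assign[OF refl refl]],
            rule exec_Sequence[OF exec_Assign[OF refl refl]],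
            rule exec_Sequence, (use 1(1) g(2) in simp),
            rule exec_Assign[OF refl])
          (use 1 g(2) in simp_all)
      show "\<forall>r\<ge>n + 3. (s1(0 := loop g ?c ?l ?a)) r = s r" using 1 by auto
      show "size (s 0) + size ?c + 3 + (size (s 0) + size (tl_tree (s 0)) + size ?l + 4 +
          (size (s 0) + size (tl_tree (s 0)) + size ?a + 4 + (t + (size (loop g ?c ?l ?a) + 2)))) \<le> ?P' ?m"
        unfolding P' using t loop_sz sz by linarith
    qed simp
  qed ((intro npoly.intros npoly_comp[OF g(1)] npoly_comp[OF assms(2)])[1], simp)
  from pt_comp[OF this pt_Node[OF assms(4) pt_Node[OF assms(5,6)]]] show ?thesis by simp
qed

lemmas pt_intros = pt_id pt_const pt_hd pt_tl pt_Node

section \<open>Schematic derivations\<close>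

text \<open>Proofs in postorder, read as instructions for a stack machine.\<close>

inductive stk :: "calculus \<Rightarrow> sequent set \<Rightarrow> sequent list \<Rightarrow> sequent list \<Rightarrow> bool" for G As where
  empty: "stk G As [] []"
| asm: "stk G As \<pi> ss \<Longrightarrow> S \<in> As \<Longrightarrow> stk G As (\<pi> @ [S]) (ss @ [S])"
| rule: "stk G As \<pi> (ss @ Ss) \<Longrightarrow> R \<in> G \<Longrightarrow> rule_instance R Ss S \<Longrightarrow>
    stk G As (\<pi> @ [S]) (ss @ [S])"

text \<open>\<open>rs\<close> lists the positions of the stack entries. These are exactly the lines
  not yet used as a premise, so the premise lists and \<open>rs\<close> together contain every line
  once; with a single entry left, this is tree-likeness.\<close>

lemma stk_forest:
  assumes "stk G As \<pi> ss"
  shows "\<exists>from rs. map ((!) \<pi>) rs = ss \<and> (\<forall>r\<in>set rs. r < length \<pi>) \<and>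
    (\<forall>i < length \<pi>. (from i = [] \<and> \<pi> ! i \<in> As) \<or>
      ((\<forall>j\<in>set (from i). j < i) \<and> (\<exists>R\<in>G. rule_instance R (map ((!) \<pi>) (from i)) (\<pi> ! i)))) \<and>
    mset (concat (map from [0..<length \<pi>])) + mset rs = mset [0..<length \<pi>]"
  using assms
proof (induction rule: stk.induct)
  case empty
  show ?case by simp
next
  case (asm \<pi> ss S)
  then obtain frm rs where *: "map ((!) \<pi>) rs = ss" "\<forall>r\<in>set rs. r < length \<pi>"
    "\<And>i. i < length \<pi> \<Longrightarrow> (frm i = [] \<and> \<pi> ! i \<in> As) \<or>
      ((\<forall>j\<in>set (frm i). j < i) \<and> (\<exists>R\<in>G. rule_instance R (map ((!) \<pi>) (frm i)) (\<pi> ! i)))"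
    "mset (concat (map frm [0..<length \<pi>])) + mset rs = mset [0..<length \<pi>]" by blast
  let ?n = "length \<pi>"
  have nth: "map ((!) (\<pi> @ [S])) xs = map ((!) \<pi>) xs" if "\<forall>x\<in>set xs. x < ?n" for xs
    using that by (simp add: nth_append)
  show ?case
  proof (intro exI[of _ "frm(?n := [])"] exI[of _ "rs @ [?n]"] conjI allI impI)
    fix i assume i: "i < length (\<pi> @ [S])"
    show "((frm(?n := [])) i = [] \<and> (\<pi> @ [S]) ! i \<in> As) \<or>
      ((\<forall>j\<in>set ((frm(?n := [])) i). j < i) \<and>
       (\<exists>R\<in>G. rule_instance R (map ((!) (\<pi> @ [S])) ((frm(?n := [])) i)) ((\<pi> @ [S]) ! i)))"
    proof (cases "i = ?n")
      case False
      with i have i: "i < ?n" by simp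
      from *(3)[OF this] show ?thesis
      proof (elim disjE conjE)
        assume 1: "\<forall>j\<in>set (frm i). j < i" and 2: "\<exists>R\<in>G. rule_instance R (map ((!) \<pi>) (frm i)) (\<pi> ! i)"
        have eq: "map ((!) (\<pi> @ [S])) (frm i) = map ((!) \<pi>) (frm i)" using 1 i by (intro nth) auto
        have eqi: "(\<pi> @ [S]) ! i = \<pi> ! i" using i by (simp add: nth_append)
        from 1 2 show ?thesis
          unfolding fun_upd_apply if_not_P[OF False] eq eqi by (intro disjI2 conjI)
      qed (use i in \<open>simp add: nth_append\<close>)
    qed (use asm.hyps in simp)
  next
    have "map (frm(?n := [])) [0..<?n] = map frm [0..<?n]" by simp
    then show "mset (concat (map (frm(?n := [])) [0..<length (\<pi> @ [S])])) + mset (rs @ [?n]) =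
        mset [0..<length (\<pi> @ [S])]"
      using *(4) by (simp del: map_eq_conv mset_upt)
  qed (use * nth[of rs] in \<open>simp_all add: less_Suc_eq\<close>)
next
  case (rule \<pi> ss Ss R S)
  then obtain frm rs where *: "map ((!) \<pi>) rs = ss @ Ss" "\<forall>r\<in>set rs. r < length \<pi>"
    "\<And>i. i < length \<pi> \<Longrightarrow> (frm i = [] \<and> \<pi> ! i \<in> As) \<or>
      ((\<forall>j\<in>set (frm i). j < i) \<and> (\<exists>R\<in>G. rule_instance R (map ((!) \<pi>) (frm i)) (\<pi> ! i)))"
    "mset (concat (map frm [0..<length \<pi>])) + mset rs = mset [0..<length \<pi>]" by blast
  obtain rs1 rs2 where rs: "rs = rs1 @ rs2" "map ((!) \<pi>) rs1 = ss" "map ((!) \<pi>) rs2 = Ss"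
    using *(1) by (auto simp: map_eq_append_conv)
  let ?n = "length \<pi>"
  have nth: "map ((!) (\<pi> @ [S])) xs = map ((!) \<pi>) xs" if "\<forall>x\<in>set xs. x < ?n" for xs
    using that by (simp add: nth_append)
  show ?case
  proof (intro exI[of _ "frm(?n := rs2)"] exI[of _ "rs1 @ [?n]"] conjI allI impI)
    fix i assume i: "i < length (\<pi> @ [S])"
    show "((frm(?n := rs2)) i = [] \<and> (\<pi> @ [S]) ! i \<in> As) \<or>
      ((\<forall>j\<in>set ((frm(?n := rs2)) i). j < i) \<and>
       (\<exists>R\<in>G. rule_instance R (map ((!) (\<pi> @ [S])) ((frm(?n := rs2)) i)) ((\<pi> @ [S]) ! i)))"
    proof (cases "i = ?n")
      case True
      have "map ((!) (\<pi> @ [S])) rs2 = Ss" using nth[of rs2] * rs by auto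
      with True rule.hyps * rs show ?thesis by auto
    next
      case False
      with i have i: "i < ?n" by simp
      from *(3)[OF this] show ?thesis
      proof (elim disjE conjE)
        assume 1: "\<forall>j\<in>set (frm i). j < i" and 2: "\<exists>R\<in>G. rule_instance R (map ((!) \<pi>) (frm i)) (\<pi> ! i)"
        have eq: "map ((!) (\<pi> @ [S])) (frm i) = map ((!) \<pi>) (frm i)" using 1 i by (intro nth) auto
        have eqi: "(\<pi> @ [S]) ! i = \<pi> ! i" using i by (simp add: nth_append)
        from 1 2 show ?thesis
          unfolding fun_upd_apply if_not_P[OF False] eq eqi by (intro disjI2 conjI)
      qed (use i in \<open>simp add: nth_append\<close>)
    qed
  next
    show "mset (concat (map (frm(?n := rs2)) [0..<length (\<pi> @ [S])])) + mset (rs1 @ [?n]) =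
        mset [0..<length (\<pi> @ [S])]"
    proof -
      have "map (frm(?n := rs2)) [0..<?n] = map frm [0..<?n]" by simp
      then show ?thesis using *(4) rs(1) by (simp add: ac_simps del: map_eq_conv mset_upt)
    qed
  qed (use * rs nth[of rs1] in \<open>simp_all add: less_Suc_eq\<close>)
qed

lemma stk_is_proof:
  assumes "stk G (set As) \<pi> [S]"
  shows "is_proof G As \<pi> S"
proof -
  from stk_forest[OF assms] obtain frm rs where *: "map ((!) \<pi>) rs = [S]" "\<forall>r\<in>set rs. r < length \<pi>"
    "\<forall>i < length \<pi>. (frm i = [] \<and> \<pi> ! i \<in> set As) \<or>
      ((\<forall>j\<in>set (frm i). j < i) \<and> (\<exists>R\<in>G. rule_instance R (map ((!) \<pi>) (frm i)) (\<pi> ! i)))"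
    "mset (concat (map frm [0..<length \<pi>])) + mset rs = mset [0..<length \<pi>]" by (elim exE conjE) (rule that; assumption)
  obtain r where r: "rs = [r]" "r < length \<pi>" "\<pi> ! r = S" using *(1,2) by auto
  obtain n where n: "length \<pi> = Suc n" using r(2) by (cases \<pi>) auto
  \<comment> \<open>Premises precede conclusions, so the last line is never a premise and must be
    the one line left on the stack.\<close>
  have "n \<in># mset [0..<length \<pi>]" using n by simp
  then have "n \<in># mset (concat (map frm [0..<length \<pi>])) + mset rs" by (simp only: *(4))
  moreover have "n \<notin># mset (concat (map frm [0..<length \<pi>]))"
  proof
    assume "n \<in># mset (concat (map frm [0..<length \<pi>]))"
    then obtain i where i: "i < length \<pi>" "n \<in> set (frm i)" by auto
    then have "n < i" using *(3)[rule_format, OF i(1)] by auto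
    with i(1) n show False by simp
  qed
  ultimately have "r = n" using r by simp
  have "\<pi> \<noteq> []" using n by auto
  moreover from this have "last \<pi> = S" using r n \<open>r = n\<close> by (simp add: last_conv_nth)
  moreover have "mset (concat (map frm [0..<length \<pi>])) = mset [0..<length \<pi> - 1]"
    using *(4) unfolding r(1) n \<open>r = n\<close> by simp
  ultimately show ?thesis using *(3) unfolding is_proof_def by (intro conjI exI[of _ frm]) simp_all
qed

text \<open>Quantifying over what was derived before makes proofs composable by
  concatenation.\<close>

definition yields :: "calculus \<Rightarrow> sequent set \<Rightarrow> sequent list \<Rightarrow> sequent list \<Rightarrow> bool" where
  "yields G As \<pi> Ts \<longleftrightarrow> (\<forall>\<pi>0 ss. stk G As \<pi>0 ss \<longrightarrow> stk G As (\<pi>0 @ \<pi>) (ss @ Ts))"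

lemma yields_Nil: "yields G As [] []"
  by (simp add: yields_def)

lemma yieldsD: "yields G As \<pi> Ts \<Longrightarrow> stk G As \<pi>0 ss \<Longrightarrow> stk G As (\<pi>0 @ \<pi>) (ss @ Ts)"
  by (simp add: yields_def)

lemma yields_append:
  assumes "yields G As \<pi> Ss" "yields G As \<pi>' Ts"
  shows "yields G As (\<pi> @ \<pi>') (Ss @ Ts)"
  unfolding yields_def
proof (intro allI impI)
  fix \<pi>0 ss
  assume "stk G As \<pi>0 ss"
  from yieldsD[OF assms(2) yieldsD[OF assms(1) this]]
  show "stk G As (\<pi>0 @ \<pi> @ \<pi>') (ss @ Ss @ Ts)" by simp
qed

lemma yields_asm: "S \<in> As \<Longrightarrow> yields G As [S] [S]"
  unfolding yields_def by (intro allI impI stk.asm)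

lemma yields_rule:
  assumes "yields G As \<pi> Ss" "R \<in> G" "rule_instance R Ss S"
  shows "yields G As (\<pi> @ [S]) [S]"
  unfolding yields_def
proof (intro allI impI)
  fix \<pi>0 ss
  assume "stk G As \<pi>0 ss"
  from stk.rule[OF yieldsD[OF assms(1) this] assms(2,3)]
  show "stk G As (\<pi>0 @ \<pi> @ [S]) (ss @ [S])" by simp
qed

lemma yields_is_proof:
  assumes "yields G (set As) \<pi> [S]"
  shows "is_proof G As \<pi> S"
  using yieldsD[OF assms stk.empty] by (intro stk_is_proof) simp

text \<open>
  A derivation of a meta-sequent from meta-sequents is a template: its instances under all
  \<open>\<sigma>\<close> and \<open>\<mu>\<close> are proofs. The variable \<open>D\<close> is the one that may occur in succedents.
\<close>

definition sder :: "calculus \<Rightarrow> meta_sequent set \<Rightarrow> nat \<Rightarrow> meta_sequent \<Rightarrow> bool" where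
  "sder G P D S \<longleftrightarrow> (\<exists>ts. \<forall>\<sigma> \<mu>. size (\<mu> D) \<le> 1 \<longrightarrow>
     yields G (inst_seq \<sigma> \<mu> ` P) (map (inst_seq \<sigma> \<mu>) ts) [inst_seq \<sigma> \<mu> S])"

lemma sder_asm: "S \<in> P \<Longrightarrow> sder G P D S"
  unfolding sder_def by (rule exI[of _ "[S]"]) (simp add: yields_asm)

lemma sder_list:
  assumes "\<forall>T\<in>set Ts. sder G P D T"
  shows "\<exists>ts. \<forall>\<sigma> \<mu>. size (\<mu> D) \<le> 1 \<longrightarrow>
     yields G (inst_seq \<sigma> \<mu> ` P) (map (inst_seq \<sigma> \<mu>) ts) (map (inst_seq \<sigma> \<mu>) Ts)"
  using assms
proof (induction Ts)
  case Nil
  show ?case by (rule exI[of _ "[]"]) (simp add: yields_Nil)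
next
  case (Cons T Ts)
  from Cons obtain ts where ts: "\<And>\<sigma> \<mu>. size (\<mu> D) \<le> 1 \<Longrightarrow>
     yields G (inst_seq \<sigma> \<mu> ` P) (map (inst_seq \<sigma> \<mu>) ts) (map (inst_seq \<sigma> \<mu>) Ts)" by auto
  from Cons.prems obtain us where us: "\<And>\<sigma> \<mu>. size (\<mu> D) \<le> 1 \<Longrightarrow>
     yields G (inst_seq \<sigma> \<mu> ` P) (map (inst_seq \<sigma> \<mu>) us) [inst_seq \<sigma> \<mu> T]"
    unfolding sder_def by auto
  show ?case
    using yields_append[OF us ts] by (intro exI[of _ "us @ ts"]) simp
qed

text \<open>Substitution at the level of meta-sequents: a template applies a rule to schematic
  formulas and contexts, and by \<open>inst_seq_lift\<close> every instance of the result is an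
  instance of the rule itself.\<close>

primrec lift_item :: "(nat \<Rightarrow> fm) \<Rightarrow> (nat \<Rightarrow> item multiset) \<Rightarrow> item \<Rightarrow> item multiset" where
  "lift_item \<tau> \<nu> (Fm A) = {#Fm (subst \<tau> A)#}"
| "lift_item \<tau> \<nu> (MV g) = \<nu> g"

definition lift_seq :: "(nat \<Rightarrow> fm) \<Rightarrow> (nat \<Rightarrow> item multiset) \<Rightarrow> meta_sequent \<Rightarrow> meta_sequent" where
  "lift_seq \<tau> \<nu> S = (\<Sum>\<^sub># (image_mset (lift_item \<tau> \<nu>) (ante S)) \<Rrightarrow>
     \<Sum>\<^sub># (image_mset (lift_item \<tau> \<nu>) (succ S)))"

lemma subst_subst: "subst \<sigma> (subst \<tau> A) = subst (\<lambda>n. subst \<sigma> (\<tau> n)) A"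
  by (induction A) auto

lemma subst_Atom [simp]: "subst Atom A = A"
  by (induction A) auto

lemma inst_side_simps [simp]:
  "inst_side \<sigma> \<mu> {#} = {#}"
  "inst_side \<sigma> \<mu> (add_mset x M) = inst_item \<sigma> \<mu> x + inst_side \<sigma> \<mu> M"
  "inst_side \<sigma> \<mu> (M + N) = inst_side \<sigma> \<mu> M + inst_side \<sigma> \<mu> N"
  "inst_side \<sigma> \<mu> (fms F) = image_mset (subst \<sigma>) F"
  by (induction F) (simp_all add: inst_side_def)

lemma inst_side_lift:
  "inst_side \<sigma> \<mu> (\<Sum>\<^sub># (image_mset (lift_item \<tau> \<nu>) M)) =
   inst_side (\<lambda>n. subst \<sigma> (\<tau> n)) (\<lambda>g. inst_side \<sigma> \<mu> (\<nu> g)) M"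
proof (induction M)
  case (add x M)
  then show ?case by (cases x) (simp_all add: subst_subst)
qed simp

lemma inst_seq_lift:
  "inst_seq \<sigma> \<mu> (lift_seq \<tau> \<nu> S) =
   inst_seq (\<lambda>n. subst \<sigma> (\<tau> n)) (\<lambda>g. inst_side \<sigma> \<mu> (\<nu> g)) S"
  by (simp add: inst_seq_def lift_seq_def inst_side_lift)

text \<open>The bound concerns instances and not the number of items, since a multiset variable may
  stand for many formulas; only \<open>D\<close> is known to stand for at most one.\<close>

definition at_most_one :: "nat \<Rightarrow> item multiset \<Rightarrow> bool" where
  "at_most_one D N \<longleftrightarrow> (\<forall>\<sigma> \<mu>. size (\<mu> D) \<le> 1 \<longrightarrow> size (inst_side \<sigma> \<mu> N) \<le> 1)"

lemma at_most_one_simps [simp]: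
  "at_most_one D {#}" "at_most_one D {#Fm A#}" "at_most_one D {#MV D#}"
  by (simp_all add: at_most_one_def)

lemma sder_rule:
  assumes "R \<in> G" "\<forall>T\<in>set (prems R). sder G P D (lift_seq \<tau> \<nu> T)"
    "\<forall>T\<in>set (concl R # prems R). at_most_one D (succ (lift_seq \<tau> \<nu> T))"
  shows "sder G P D (lift_seq \<tau> \<nu> (concl R))"
proof -
  obtain ts where ts: "\<And>\<sigma> \<mu>. size (\<mu> D) \<le> 1 \<Longrightarrow> yields G (inst_seq \<sigma> \<mu> ` P)
      (map (inst_seq \<sigma> \<mu>) ts) (map (inst_seq \<sigma> \<mu>) (map (lift_seq \<tau> \<nu>) (prems R)))"
    using sder_list[of "map (lift_seq \<tau> \<nu>) (prems R)" G P D] assms(2) by auto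
  have "rule_instance R (map (inst_seq \<sigma> \<mu>) (map (lift_seq \<tau> \<nu>) (prems R)))
      (inst_seq \<sigma> \<mu> (lift_seq \<tau> \<nu> (concl R)))" if "size (\<mu> D) \<le> 1" for \<sigma> \<mu>
    unfolding rule_instance_def
  proof
    show "\<exists>\<sigma>' \<mu>'. map (inst_seq \<sigma> \<mu>) (map (lift_seq \<tau> \<nu>) (prems R)) = map (inst_seq \<sigma>' \<mu>') (prems R) \<and>
        inst_seq \<sigma> \<mu> (lift_seq \<tau> \<nu> (concl R)) = inst_seq \<sigma>' \<mu>' (concl R)"
      by (intro exI[of _ "\<lambda>n. subst \<sigma> (\<tau> n)"] exI[of _ "\<lambda>g. inst_side \<sigma> \<mu> (\<nu> g)"])
        (simp add: inst_seq_lift)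
    show "\<forall>T\<in>set (inst_seq \<sigma> \<mu> (lift_seq \<tau> \<nu> (concl R)) #
        map (inst_seq \<sigma> \<mu>) (map (lift_seq \<tau> \<nu>) (prems R))). single_conclusion T"
      using assms(3) that by (auto simp: single_conclusion_def at_most_one_def inst_seq_def)
  qed
  from yields_rule[OF ts assms(1) this] show ?thesis
    unfolding sder_def
    by (intro exI[of _ "ts @ [lift_seq \<tau> \<nu> (concl R)]"]) simp
qed

primrec conjs :: "fm list \<Rightarrow> fm" where
  "conjs [] = Top"
| "conjs (A # As) = And A (conjs As)"

text \<open>
  A singleton must not become \<open>Or A Bot\<close>, since a disjunction is constructive only if it is basic.
\<close>

fun disjs :: "fm list \<Rightarrow> fm" where
  "disjs [] = Bot"
| "disjs [A] = A"
| "disjs (A # B # As) = Or A (disjs (B # As))"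

section \<open>Derived rules of \<open>LJ\<close> for templates\<close>

context
  fixes G :: calculus and P :: "meta_sequent set" and D :: nat
  assumes LJ: "LJ \<subseteq> G"
begin

abbreviation der :: "item multiset \<Rightarrow> item multiset \<Rightarrow> bool" where
  "der M N \<equiv> sder G P D (M \<Rrightarrow> N)"

lemma LJ_rule:
  assumes "Rule Ts S \<in> LJ" "\<forall>T\<in>set Ts. sder G P D (lift_seq \<tau> \<nu> T)"
    "\<forall>T\<in>set (S # Ts). at_most_one D (succ (lift_seq \<tau> \<nu> T))"
  shows "sder G P D (lift_seq \<tau> \<nu> S)"
  using sder_rule[of "Rule Ts S" G P D \<tau> \<nu>] assms LJ by auto

lemma der_rules:
  fixes A B M N
  assumes N: "at_most_one D N"
  shows der_id: "der (add_mset (Fm A) M) {#Fm A#}"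
    and der_Bot: "der (add_mset (Fm Bot) M) N"
    and der_Top: "der M {#Fm Top#}"
    and der_weakL: "der M N \<Longrightarrow> der (add_mset (Fm A) M) N"
    and der_weakR: "der M {#} \<Longrightarrow> der M {#Fm A#}"
    and der_cut: "der M {#Fm A#} \<Longrightarrow> der (add_mset (Fm A) M) N \<Longrightarrow> der M N"
    and der_AndL1: "der (add_mset (Fm A) M) N \<Longrightarrow> der (add_mset (Fm (And A B)) M) N"
    and der_AndL2: "der (add_mset (Fm B) M) N \<Longrightarrow> der (add_mset (Fm (And A B)) M) N"
    and der_AndR: "der M {#Fm A#} \<Longrightarrow> der M {#Fm B#} \<Longrightarrow> der M {#Fm (And A B)#}"
    and der_OrL: "der (add_mset (Fm A) M) N \<Longrightarrow> der (add_mset (Fm B) M) N \<Longrightarrow>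
      der (add_mset (Fm (Or A B)) M) N"
    and der_OrR1: "der M {#Fm A#} \<Longrightarrow> der M {#Fm (Or A B)#}"
    and der_OrR2: "der M {#Fm B#} \<Longrightarrow> der M {#Fm (Or A B)#}"
    and der_ImpL: "der M {#Fm A#} \<Longrightarrow> der (add_mset (Fm B) M) N \<Longrightarrow>
      der (add_mset (Fm (Imp A B)) M) N"
    and der_ImpR: "der (add_mset (Fm A) M) {#Fm B#} \<Longrightarrow> der M {#Fm (Imp A B)#}"
proof -
  \<comment> \<open>\<open>LJ\<close> is stated with the atoms 0, 1 and the multiset variables 0, 1
    only, so these two assignments cover all its rules.\<close>
  let ?\<tau> = "\<lambda>n. if n = 0 then A else B" and ?\<nu> = "\<lambda>n. if n = 0 then M else N"
  note rule = LJ_rule[unfolded LJ_def Let_def, where \<tau> = ?\<tau> and \<nu> = ?\<nu>]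
  note simps = lift_seq_def N
  show "der (add_mset (Fm A) M) {#Fm A#}"
    using rule[of "[]" "{#MV 0, Fm (Atom 0)#} \<Rrightarrow> {#Fm (Atom 0)#}"] by (simp add: simps)
  show "der (add_mset (Fm Bot) M) N"
    using rule[of "[]" "{#MV 0, Fm Bot#} \<Rrightarrow> {#MV 1#}"] by (simp add: simps)
  show "der M {#Fm Top#}"
    using rule[of "[]" "{#MV 0#} \<Rrightarrow> {#Fm Top#}"] by (simp add: simps)
  show "der M N \<Longrightarrow> der (add_mset (Fm A) M) N"
    using rule[of "[{#MV 0#} \<Rrightarrow> {#MV 1#}]" "{#MV 0, Fm (Atom 0)#} \<Rrightarrow> {#MV 1#}"]
    by (simp add: simps)
  show "der M {#} \<Longrightarrow> der M {#Fm A#}"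
    using rule[of "[{#MV 0#} \<Rrightarrow> {#}]" "{#MV 0#} \<Rrightarrow> {#Fm (Atom 0)#}"] by (simp add: simps)
  show "der M {#Fm A#} \<Longrightarrow> der (add_mset (Fm A) M) N \<Longrightarrow> der M N"
    using rule[of "[{#MV 0#} \<Rrightarrow> {#Fm (Atom 0)#}, {#MV 0, Fm (Atom 0)#} \<Rrightarrow> {#MV 1#}]"
      "{#MV 0#} \<Rrightarrow> {#MV 1#}"] by (simp add: simps)
  show "der (add_mset (Fm A) M) N \<Longrightarrow> der (add_mset (Fm (And A B)) M) N"
    using rule[of "[{#MV 0, Fm (Atom 0)#} \<Rrightarrow> {#MV 1#}]"
      "{#MV 0, Fm (And (Atom 0) (Atom 1))#} \<Rrightarrow> {#MV 1#}"] by (simp add: simps)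
  show "der (add_mset (Fm B) M) N \<Longrightarrow> der (add_mset (Fm (And A B)) M) N"
    using rule[of "[{#MV 0, Fm (Atom 1)#} \<Rrightarrow> {#MV 1#}]"
      "{#MV 0, Fm (And (Atom 0) (Atom 1))#} \<Rrightarrow> {#MV 1#}"] by (simp add: simps)
  show "der M {#Fm A#} \<Longrightarrow> der M {#Fm B#} \<Longrightarrow> der M {#Fm (And A B)#}"
    using rule[of "[{#MV 0#} \<Rrightarrow> {#Fm (Atom 0)#}, {#MV 0#} \<Rrightarrow> {#Fm (Atom 1)#}]"
      "{#MV 0#} \<Rrightarrow> {#Fm (And (Atom 0) (Atom 1))#}"] by (simp add: simps)
  show "der (add_mset (Fm A) M) N \<Longrightarrow> der (add_mset (Fm B) M) N \<Longrightarrow>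
      der (add_mset (Fm (Or A B)) M) N"
    using rule[of "[{#MV 0, Fm (Atom 0)#} \<Rrightarrow> {#MV 1#}, {#MV 0, Fm (Atom 1)#} \<Rrightarrow> {#MV 1#}]"
      "{#MV 0, Fm (Or (Atom 0) (Atom 1))#} \<Rrightarrow> {#MV 1#}"] by (simp add: simps)
  show "der M {#Fm A#} \<Longrightarrow> der M {#Fm (Or A B)#}"
    using rule[of "[{#MV 0#} \<Rrightarrow> {#Fm (Atom 0)#}]"
      "{#MV 0#} \<Rrightarrow> {#Fm (Or (Atom 0) (Atom 1))#}"] by (simp add: simps)
  show "der M {#Fm B#} \<Longrightarrow> der M {#Fm (Or A B)#}"
    using rule[of "[{#MV 0#} \<Rrightarrow> {#Fm (Atom 1)#}]"
      "{#MV 0#} \<Rrightarrow> {#Fm (Or (Atom 0) (Atom 1))#}"] by (simp add: simps)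
  show "der M {#Fm A#} \<Longrightarrow> der (add_mset (Fm B) M) N \<Longrightarrow> der (add_mset (Fm (Imp A B)) M) N"
    using rule[of "[{#MV 0#} \<Rrightarrow> {#Fm (Atom 0)#}, {#MV 0, Fm (Atom 1)#} \<Rrightarrow> {#MV 1#}]"
      "{#MV 0, Fm (Imp (Atom 0) (Atom 1))#} \<Rrightarrow> {#MV 1#}"] by (simp add: simps)
  show "der (add_mset (Fm A) M) {#Fm B#} \<Longrightarrow> der M {#Fm (Imp A B)#}"
    using rule[of "[{#MV 0, Fm (Atom 0)#} \<Rrightarrow> {#Fm (Atom 1)#}]"
      "{#MV 0#} \<Rrightarrow> {#Fm (Imp (Atom 0) (Atom 1))#}"] by (simp add: simps)
qed

lemmas der_right = der_id[OF at_most_one_simps(1)] der_Top[OF at_most_one_simps(1)]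
  der_weakR[OF at_most_one_simps(1)] der_AndR[OF at_most_one_simps(1)]
  der_OrR1[OF at_most_one_simps(1)] der_OrR2[OF at_most_one_simps(1)]
  der_ImpR[OF at_most_one_simps(1)]

lemma der_weak: "at_most_one D N \<Longrightarrow> der M N \<Longrightarrow> der (fms F + M) N"
  by (induction F) (simp_all add: der_weakL)

lemma der_mcut:
  assumes N: "at_most_one D N" and "\<forall>A\<in>#F. der M {#Fm A#}" "der (fms F + M) N"
  shows "der M N"
  using assms(2,3)
proof (induction F)
  case (add A F)
  have "der (fms F + M) N"
    by (rule der_cut[OF N, of _ A]) (use add.prems der_weak in auto)
  with add show ?case by simp
qed simp

lemma der_conjR: "\<forall>A\<in>set As. der M {#Fm A#} \<Longrightarrow> der M {#Fm (conjs As)#}"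
  by (induction As) (simp_all add: der_right)

lemma der_conj_elim: "A \<in> set As \<Longrightarrow> der (add_mset (Fm (conjs As)) M) {#Fm A#}"
proof (induction As)
  case (Cons B As)
  show ?case
  proof (cases "A = B")
    case True
    then show ?thesis by (simp add: der_AndL1 der_right)
  next
    case False
    with Cons show ?thesis by (simp add: der_AndL2)
  qed
qed simp

text \<open>Every conjunct is derivable from the conjunction, so all conjuncts can be cut away; this
  replaces repeated left rules with contractions.\<close>

lemma der_conjL:
  assumes "at_most_one D N" "der (fms (mset As) + M) N"
  shows "der (add_mset (Fm (conjs As)) M) N"
  by (rule der_mcut[OF assms(1), of "mset As"]) (use assms in \<open>simp_all add: der_conj_elim der_weakL\<close>)

lemma der_disjL:
  assumes N: "at_most_one D N"
  shows "\<forall>A\<in>set As. der (add_mset (Fm A) M) N \<Longrightarrow> der (add_mset (Fm (disjs As)) M) N"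
  by (induction As rule: disjs.induct) (simp_all add: der_Bot[OF N] der_OrL[OF N])

lemma der_disjR: "A \<in> set As \<Longrightarrow> der M {#Fm A#} \<Longrightarrow> der M {#Fm (disjs As)#}"
  by (induction As rule: disjs.induct) (auto simp: der_right)

end

section \<open>Rules as lists of patterns and the formulas built from them\<close>

definition list_of :: "'a multiset \<Rightarrow> 'a list" where
  "list_of M = (SOME xs. mset xs = M)"

lemma mset_list_of [simp]: "mset (list_of M) = M"
  unfolding list_of_def by (rule someI_ex) (rule ex_mset)

lemma set_list_of [simp]: "set (list_of M) = set_mset M"
  by (metis mset_list_of set_mset_mset)

lemma list_of_simps [simp]: "list_of {#} = []" "list_of {#A#} = [A]"
  using mset_list_of[of "{#}"] mset_list_of[of "{#A#}"] by (simp_all del: mset_list_of)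

text \<open>
  Both kinds of rules in the class are treated uniformly: a pair \<open>(\<phi>, Some \<psi>)\<close> stands for the
  meta-sequent \<open>\<Gamma>, \<phi> \<Rrightarrow> \<psi>\<close> and a pair \<open>(\<theta>, None)\<close> for \<open>\<Gamma>, \<theta> \<Rrightarrow> \<Delta>\<close>.
\<close>

type_synonym pattern = "fm multiset \<times> fm multiset option"

definition pat_seq :: "nat \<Rightarrow> nat \<Rightarrow> pattern \<Rightarrow> meta_sequent" where
  "pat_seq \<Gamma> \<Delta> p = (add_mset (MV \<Gamma>) (fms (fst p)) \<Rrightarrow>
     (case snd p of None \<Rightarrow> {#MV \<Delta>#} | Some \<psi> \<Rightarrow> fms \<psi>))"

definition somes :: "pattern list \<Rightarrow> (fm multiset \<times> fm multiset) list" where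
  "somes ps = map (\<lambda>p. (fst p, the (snd p))) (filter (\<lambda>p. snd p \<noteq> None) ps)"

definition nones :: "pattern list \<Rightarrow> fm multiset list" where
  "nones ps = map fst (filter (\<lambda>p. snd p = None) ps)"

definition hyps :: "pattern list \<Rightarrow> fm list" where
  "hyps ps = map (\<lambda>(\<phi>, \<psi>). Imp (conjs (list_of \<phi>)) (disjs (list_of \<psi>))) (somes ps)"

definition alts :: "pattern list \<Rightarrow> fm list" where
  "alts ps = map (\<lambda>\<theta>. conjs (list_of \<theta>)) (nones ps)"

definition ax_ante :: "pattern list \<Rightarrow> pattern \<Rightarrow> fm" where
  "ax_ante ps c = And (conjs (hyps ps)) (conjs (list_of (fst c)))"

definition ax_succ :: "pattern list \<Rightarrow> pattern \<Rightarrow> fm" where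
  "ax_succ ps c = (case snd c of None \<Rightarrow> disjs (alts ps) | Some \<psi> \<Rightarrow> disjs (list_of \<psi>))"

definition ax_fm :: "pattern list \<Rightarrow> pattern \<Rightarrow> fm" where
  "ax_fm ps c = Imp (ax_ante ps c) (ax_succ ps c)"

text \<open>Substitution preserves the number of formulas, so a pattern violating this has no
  single-conclusion instance.\<close>

definition instantiable :: "pattern \<Rightarrow> bool" where
  "instantiable p \<longleftrightarrow> (\<forall>\<psi>. snd p = Some \<psi> \<longrightarrow> size \<psi> \<le> 1)"

lemma set_somes: "set (somes ps) = {(\<phi>, \<psi>). (\<phi>, Some \<psi>) \<in> set ps}"
  by (force simp: somes_def)

lemma set_nones: "set (nones ps) = {\<theta>. (\<theta>, None) \<in> set ps}"
  by (force simp: nones_def)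

lemma set_hyps: "set (hyps ps) = {Imp (conjs (list_of \<phi>)) (disjs (list_of \<psi>)) |\<phi> \<psi>. (\<phi>, Some \<psi>) \<in> set ps}"
  by (force simp: hyps_def set_somes)

lemma set_alts: "set (alts ps) = {conjs (list_of \<theta>) |\<theta>. (\<theta>, None) \<in> set ps}"
  by (force simp: alts_def set_nones)

lemma size_le_1_cases:
  assumes "size M \<le> 1"
  obtains "M = {#}" | A where "M = {#A#}"
  using assms by (cases "size M = 0") (auto simp: le_Suc_eq dest: size_1_singleton_mset[unfolded One_nat_def])

lemma at_most_one_pat:
  assumes "instantiable p"
  shows "at_most_one \<Delta> (case snd p of None \<Rightarrow> {#MV \<Delta>#} | Some \<psi> \<Rightarrow> fms \<psi>)"
  using assms by (auto simp: instantiable_def at_most_one_def split: option.splits)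

text \<open>A premise with its own succedent follows by modus ponens with a conjunct of
  \<open>?X\<close>; a premise ending in \<Delta> follows because its formulas imply a disjunct of
  \<open>?Y\<close>. In the latter case the conclusion must end in \<Delta> as well, as only then is
  \<open>?Y\<close> the disjunction of the alternatives; this is the condition on
  \<open>snd c\<close>.\<close>

lemma der_axiom:
  assumes LJ: "LJ \<subseteq> G" and G: "R \<in> G"
    and R: "R = Rule (map (pat_seq \<Gamma> \<Delta>) ps) (pat_seq \<Gamma> \<Delta> c)" and neq: "\<Gamma> \<noteq> \<Delta>"
    and inst: "\<forall>p\<in>set (c # ps). instantiable p"
    and right: "snd c = None \<or> (\<forall>p\<in>set ps. snd p \<noteq> None)"
  shows "sder G {} D ({#} \<Rrightarrow> {#Fm (ax_fm ps c)#})"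
proof -
  let ?der = "\<lambda>M N. sder G {} D (M \<Rrightarrow> N)"
  let ?X = "ax_ante ps c" and ?Y = "ax_succ ps c"
  let ?\<nu> = "\<lambda>g. if g = \<Gamma> then {#Fm ?X#} else {#Fm ?Y#}"
  have sum_fms: "\<Sum>\<^sub># (image_mset (lift_item Atom \<nu>) (fms F)) = fms F" for \<nu> F
    by (induction F) simp_all
  have lift: "lift_seq Atom ?\<nu> (pat_seq \<Gamma> \<Delta> p) =
      (add_mset (Fm ?X) (fms (fst p)) \<Rrightarrow> (case snd p of None \<Rightarrow> {#Fm ?Y#} | Some \<psi> \<Rightarrow> fms \<psi>))" for p
    using neq by (auto simp: lift_seq_def pat_seq_def sum_fms[unfolded multiset.map_comp o_def] sum_fms split: option.splits)
  have amo: "at_most_one D (case snd p of None \<Rightarrow> {#Fm ?Y#} | Some \<psi> \<Rightarrow> fms \<psi>)"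
    if "p \<in> set (c # ps)" for p
    using inst that by (auto simp: instantiable_def at_most_one_def split: option.splits)
  have id: "?der M {#Fm A#}" if "Fm A \<in># M" for M A
    using der_right(1)[OF LJ] that by (metis insert_DiffM)
  have "?der (add_mset (Fm ?X) (fms (fst p))) (case snd p of None \<Rightarrow> {#Fm ?Y#} | Some \<psi> \<Rightarrow> fms \<psi>)"
    if p: "p \<in> set ps" for p
  proof (cases "snd p")
    case None
    have "?der (add_mset (Fm ?X) (fms (fst p))) {#Fm (conjs (list_of (fst p)))#}"
      by (rule der_conjR[OF LJ]) (intro ballI id, simp)
    moreover have "conjs (list_of (fst p)) \<in> set (alts ps)"
      using None p by (cases p) (auto simp: set_alts)
    ultimately have "?der (add_mset (Fm ?X) (fms (fst p))) {#Fm (disjs (alts ps))#}"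
      by (rule der_disjR[OF LJ, rotated])
    with None p right show ?thesis by (auto simp: ax_succ_def)
  next
    case (Some \<psi>)
    let ?M = "add_mset (Fm ?X) (fms (fst p))" and ?K = "Imp (conjs (list_of (fst p))) (disjs (list_of \<psi>))"
    have "?K \<in> set (hyps ps)" using Some p by (cases p) (auto simp: set_hyps)
    then have 1: "?der ?M {#Fm ?K#}"
      unfolding ax_ante_def by (intro der_AndL1[OF LJ] der_conj_elim[OF LJ]) simp_all
    have 2: "?der ?M {#Fm (conjs (list_of (fst p)))#}"
      by (rule der_conjR[OF LJ]) (intro ballI id, simp)
    have "size \<psi> \<le> 1" using inst p Some by (auto simp: instantiable_def)
    then have "?der (add_mset (Fm (disjs (list_of \<psi>))) ?M) (fms \<psi>)"
      by (cases rule: size_le_1_cases) (simp_all add: der_Bot[OF LJ] der_right(1)[OF LJ])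
    moreover have "at_most_one D (fms \<psi>)" using amo[of p] p Some by simp
    ultimately have "?der ?M (fms \<psi>)"
      using der_cut[OF LJ _ 1] der_ImpL[OF LJ _ 2] by blast
    with Some show ?thesis by simp
  qed
  then have "?der (add_mset (Fm ?X) (fms (fst c))) (case snd c of None \<Rightarrow> {#Fm ?Y#} | Some \<psi> \<Rightarrow> fms \<psi>)"
    using sder_rule[of R G "{}" D Atom ?\<nu>] amo G by (simp add: R lift)
  moreover have "size \<psi> \<le> 1" if "snd c = Some \<psi>" for \<psi>
    using inst that by (simp add: instantiable_def)
  \<comment> \<open>If the conclusion has an empty succedent, right weakening supplies the formula
    \<open>Bot\<close>.\<close>
  ultimately have "?der (add_mset (Fm ?X) (fms (fst c))) {#Fm ?Y#}"
  proof (cases "snd c")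
    case (Some \<psi>)
    assume *: "?der (add_mset (Fm ?X) (fms (fst c)))
      (case snd c of None \<Rightarrow> {#Fm ?Y#} | Some \<psi> \<Rightarrow> fms \<psi>)"
      and "\<And>\<psi>. snd c = Some \<psi> \<Longrightarrow> size \<psi> \<le> 1"
    from this(2)[OF Some] show ?thesis
      by (elim size_le_1_cases) (use * Some in \<open>simp_all add: ax_succ_def der_right(3)[OF LJ]\<close>)
  qed simp
  \<comment> \<open>The formulas that the rule puts beside \<open>?X\<close> are conjuncts of
    \<open>?X\<close> and can be cut away.\<close>
  then have main: "?der (fms (fst c) + {#Fm ?X#}) {#Fm ?Y#}" by simp
  have "\<forall>A\<in>#fst c. ?der {#Fm ?X#} {#Fm A#}"
    unfolding ax_ante_def by (intro ballI der_AndL2[OF LJ] der_conj_elim[OF LJ]) simp_all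
  from der_mcut[OF LJ at_most_one_simps(2) this main] have "?der {#Fm ?X#} {#Fm ?Y#}" .
  then show ?thesis unfolding ax_fm_def by (intro der_right(7)[OF LJ])
qed

text \<open>The axiom stays in the antecedent: weakening it by the context takes a number of steps
  that depends on the instance, which no template can express. That part and the final cut are added
  to the concrete proof.\<close>

lemma der_conclusion:
  assumes LJ: "LJ \<subseteq> G"
    and inst: "\<forall>p\<in>set (c # ps). instantiable p"
    and right: "snd c = None \<or> (\<forall>p\<in>set ps. snd p \<noteq> None)"
  shows "sder G (set (map (pat_seq \<Gamma> \<Delta>) ps)) \<Delta>
    (add_mset (Fm (ax_fm ps c)) (ante (pat_seq \<Gamma> \<Delta> c)) \<Rrightarrow> succ (pat_seq \<Gamma> \<Delta> c))"
proof -
  let ?P = "set (map (pat_seq \<Gamma> \<Delta>) ps)"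
  let ?der = "\<lambda>M N. sder G ?P \<Delta> (M \<Rrightarrow> N)"
  let ?M = "ante (pat_seq \<Gamma> \<Delta> c)" and ?N = "succ (pat_seq \<Gamma> \<Delta> c)"
  have M: "?M = add_mset (MV \<Gamma>) (fms (fst c))" by (simp add: pat_seq_def)
  have amo: "at_most_one \<Delta> (succ (pat_seq \<Gamma> \<Delta> p))" if "p \<in> set (c # ps)" for p
    using at_most_one_pat[of p \<Delta>] inst that by (auto simp: pat_seq_def)
  have id: "?der M {#Fm A#}" if "Fm A \<in># M" for M A
    using der_right(1)[OF LJ] that by (metis insert_DiffM)
  have prem: "?der (add_mset (Fm (conjs (list_of (fst p)))) ?M) (succ (pat_seq \<Gamma> \<Delta> p))"
    if p: "p \<in> set ps" for p
  proof (rule der_conjL[OF LJ])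
    have "?der (add_mset (MV \<Gamma>) (fms (fst p))) (succ (pat_seq \<Gamma> \<Delta> p))"
      by (rule sder_asm) (use p in \<open>auto simp: pat_seq_def\<close>)
    from der_weak[OF LJ _ this, of "fst c"]
    show "?der (fms (mset (list_of (fst p))) + ?M) (succ (pat_seq \<Gamma> \<Delta> p))"
      using amo p by (simp add: M ac_simps)
  qed (use amo p in simp)
  have hyp: "?der ?M {#Fm A#}" if A: "A \<in> set (hyps ps)" for A
  proof -
    from A obtain \<phi> \<psi> where p: "(\<phi>, Some \<psi>) \<in> set ps"
      and A: "A = Imp (conjs (list_of \<phi>)) (disjs (list_of \<psi>))" by (auto simp: set_hyps)
    from prem[OF p] have "?der (add_mset (Fm (conjs (list_of \<phi>))) ?M) (fms \<psi>)"
      by (simp add: pat_seq_def)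
    moreover have "size \<psi> \<le> 1" using inst p by (auto simp: instantiable_def)
    ultimately have "?der (add_mset (Fm (conjs (list_of \<phi>))) ?M) {#Fm (disjs (list_of \<psi>))#}"
      by (elim size_le_1_cases) (simp_all add: der_right(3)[OF LJ])
    then show ?thesis unfolding A by (rule der_right(7)[OF LJ])
  qed
  have "?der ?M {#Fm (ax_ante ps c)#}"
    unfolding ax_ante_def
    by (intro der_right(4)[OF LJ] der_conjR[OF LJ] ballI hyp id) (simp_all add: M)
  moreover have "?der (add_mset (Fm (ax_succ ps c)) ?M) ?N"
  proof (cases "snd c")
    case None
    then have N: "?N = {#MV \<Delta>#}" by (simp add: pat_seq_def)
    have "?der (add_mset (Fm A) ?M) ?N" if A: "A \<in> set (alts ps)" for A
    proof -
      from A obtain \<theta> where p: "(\<theta>, None) \<in> set ps" and A: "A = conjs (list_of \<theta>)"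
        by (auto simp: set_alts)
      from prem[OF p] show ?thesis using None by (simp add: A pat_seq_def)
    qed
    then show ?thesis
      using None by (simp add: ax_succ_def N der_disjL[OF LJ])
  next
    case (Some \<psi>)
    then have "size \<psi> \<le> 1" using inst by (simp add: instantiable_def)
    then show ?thesis
      by (elim size_le_1_cases) (use Some in \<open>simp_all add: ax_succ_def pat_seq_def der_Bot[OF LJ] der_right(1)[OF LJ]\<close>)
  qed
  ultimately show ?thesis
    unfolding ax_fm_def by (intro der_ImpL[OF LJ]) (simp_all add: amo)
qed

text \<open>An instance of an axiom has no context, so the context is added one formula at a time.\<close>

primrec weakenings :: "fm \<Rightarrow> fm list \<Rightarrow> sequent list" where
  "weakenings A [] = [{#} \<Rrightarrow> {#A#}]"
| "weakenings A (B # Bs) = weakenings A Bs @ [mset (B # Bs) \<Rrightarrow> {#A#}]"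

lemma yields_weakenings:
  assumes "LJ \<subseteq> G" "axiom_rule A \<in> G"
  shows "yields G As (weakenings (subst \<sigma> A) Bs) [mset Bs \<Rrightarrow> {#subst \<sigma> A#}]"
proof (induction Bs)
  case Nil
  have "rule_instance (axiom_rule A) [] ({#} \<Rrightarrow> {#subst \<sigma> A#})"
    unfolding rule_instance_def
    by (auto simp: axiom_rule_def inst_seq_def single_conclusion_def)
  from yields_rule[OF yields_Nil assms(2) this] show ?case by simp
next
  case (Cons B Bs)
  let ?R = "Rule [{#MV 0#} \<Rrightarrow> {#MV 1#}] ({#MV 0, Fm (Atom 0)#} \<Rrightarrow> {#MV 1#})"
  have "?R \<in> G" using assms(1) by (auto simp: LJ_def Let_def)
  moreover have "rule_instance ?R [mset Bs \<Rrightarrow> {#subst \<sigma> A#}] (mset (B # Bs) \<Rrightarrow> {#subst \<sigma> A#})"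
    unfolding rule_instance_def
    by (auto simp: inst_seq_def single_conclusion_def
        intro!: exI[of _ "\<lambda>_. B"] exI[of _ "\<lambda>n. if n = 0 then mset Bs else {#subst \<sigma> A#}"])
  ultimately show ?case using yields_rule[OF Cons] by simp
qed

lemma yields_cut:
  assumes "LJ \<subseteq> G" "size N \<le> 1"
    "yields G As \<pi> [M \<Rrightarrow> {#A#}]" "yields G As \<pi>' [add_mset A M \<Rrightarrow> N]"
  shows "yields G As (\<pi> @ \<pi>' @ [M \<Rrightarrow> N]) [M \<Rrightarrow> N]"
proof -
  let ?R = "Rule [{#MV 0#} \<Rrightarrow> {#Fm (Atom 0)#}, {#MV 0, Fm (Atom 0)#} \<Rrightarrow> {#MV 1#}] ({#MV 0#} \<Rrightarrow> {#MV 1#})"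
  have "?R \<in> G" using assms(1) by (auto simp: LJ_def Let_def)
  moreover have "rule_instance ?R ([M \<Rrightarrow> {#A#}] @ [add_mset A M \<Rrightarrow> N]) (M \<Rrightarrow> N)"
    unfolding rule_instance_def using assms(2)
    by (auto simp: inst_seq_def single_conclusion_def
        intro!: exI[of _ "\<lambda>_. A"] exI[of _ "\<lambda>n. if n = 0 then M else N"])
  ultimately show ?thesis using yields_rule[OF yields_append[OF assms(3,4)]] by simp
qed

section \<open>List programs\<close>

text \<open>Every tree codes a list along its right spine, so decoding is total.\<close>

primrec elems :: "tree \<Rightarrow> tree list" where
  "elems Leaf = []"
| "elems (Node x l) = x # elems l"

abbreviation ms :: "tree \<Rightarrow> tree multiset" where
  "ms l \<equiv> mset (elems l)"

lemma elems_enc_list [simp]: "elems (enc_list xs) = xs"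
  by (induction xs) auto

lemma enc_list_elems [simp]: "enc_list (elems l) = l"
  by (induction l) auto

lemma ms_empty_iff [simp]: "ms l = {#} \<longleftrightarrow> l = Leaf"
  by (cases l) auto

text \<open>The size of a list does not depend on its order, so growth bounds for programs that
  reorder lists reduce to inclusions of multisets.\<close>

lemma size_ms: "size l = (\<Sum>x\<in>#ms l. size x + 1)"
  by (induction l) auto

lemma size_mono_ms:
  assumes "ms l \<subseteq># ms l'"
  shows "size l \<le> size l'"
proof -
  obtain M where "ms l' = ms l + M" using assms by (auto simp: mset_subset_eq_exists_conv)
  then show ?thesis by (simp add: size_ms[of l] size_ms[of l'])
qed

text \<open>Reversing one argument is harmless, as any order of the formulas encodes the same side
  of a sequent.\<close>

definition rev_app :: "tree \<Rightarrow> tree \<Rightarrow> tree" where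
  "rev_app = loop (\<lambda>z. Node (hd_tree (hd_tree (tl_tree z))) (tl_tree (tl_tree z))) Leaf"

lemma ms_rev_app [simp]: "ms (rev_app l acc) = ms l + ms acc"
  unfolding rev_app_def by (induction l arbitrary: acc) auto

lemma pt_rev_app: "pt l \<Longrightarrow> pt acc \<Longrightarrow> pt (\<lambda>x. rev_app (l x) (acc x))"
  unfolding rev_app_def
proof (rule pt_loop[where q = "\<lambda>n. n + 1"])
  show "size (Node (hd_tree (hd_tree (tl_tree (Node c (Node l acc))))) (tl_tree (tl_tree (Node c (Node l acc)))))
    \<le> size acc + (size c + size l + 1)" for c l acc
    by (simp add: trans_le_add2)
qed (intro pt_intros npoly.intros | assumption)+

text \<open>The head of the accumulator is a flag telling whether an occurrence has been removed
  already, its tail the list of kept elements. The inner conditional is a conjunction of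
  tests.\<close>

definition remove_step :: "tree \<Rightarrow> tree" where
  "remove_step z = (let a = hd_tree z; h = hd_tree (hd_tree (tl_tree z)); acc = tl_tree (tl_tree z) in
    if (if hd_tree acc = Leaf then if h = a then tru else Leaf else Leaf) = Leaf
    then Node (hd_tree acc) (Node h (tl_tree acc)) else Node tru (tl_tree acc))"

lemma remove_step_Node:
  "remove_step (Node a (Node (Node h l) acc)) = (if hd_tree acc = Leaf \<and> h = a
    then Node tru (tl_tree acc) else Node (hd_tree acc) (Node h (tl_tree acc)))"
  by (simp add: remove_step_def Let_def)

definition remove :: "tree \<Rightarrow> tree \<Rightarrow> tree" where
  "remove a l = tl_tree (loop remove_step a l Leaf)"

lemma ms_remove [simp]: "ms (remove a l) = ms l - {#a#}"
proof -
  have 1: "hd_tree acc \<noteq> Leaf \<Longrightarrow> ms (tl_tree (loop remove_step a l acc)) = ms l + ms (tl_tree acc)" for acc l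
    by (induction l arbitrary: acc) (auto simp: remove_step_Node)
  have "hd_tree acc = Leaf \<Longrightarrow>
      ms (tl_tree (loop remove_step a l acc)) = (ms l - {#a#}) + ms (tl_tree acc)" for acc
  proof (induction l arbitrary: acc)
    case (Node h l)
    then show ?case
      by (cases "h = a") (simp_all add: remove_step_Node 1)
  qed simp
  from this[of Leaf] show ?thesis by (simp add: remove_def)
qed

lemma pt_remove: "pt a \<Longrightarrow> pt l \<Longrightarrow> pt (\<lambda>x. remove (a x) (l x))"
  unfolding remove_def
proof (rule pt_tl, rule pt_loop[where q = "\<lambda>n. n + 4"])
  show "pt remove_step"
    unfolding remove_step_def Let_def by (intro pt_intros pt_if pt_eq)
  show "size (remove_step (Node c (Node l acc))) \<le> size acc + (size c + size l + 4)" for c l acc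
    using size_hd_tree[of l] by (cases acc) (simp_all add: remove_step_def Let_def del: size_hd_tree)
qed (intro pt_intros npoly.intros | assumption)+

definition difference :: "tree \<Rightarrow> tree \<Rightarrow> tree" where
  "difference l l' = loop (\<lambda>z. remove (hd_tree (hd_tree (tl_tree z))) (tl_tree (tl_tree z))) Leaf l' l"

lemma ms_difference [simp]: "ms (difference l l') = ms l - ms l'"
  unfolding difference_def by (induction l' arbitrary: l) auto

lemma pt_difference: "pt l \<Longrightarrow> pt l' \<Longrightarrow> pt (\<lambda>x. difference (l x) (l' x))"
  unfolding difference_def
proof (rule pt_loop[where q = "\<lambda>n. n"])
  show "size (remove (hd_tree (hd_tree (tl_tree (Node c (Node l acc))))) (tl_tree (tl_tree (Node c (Node l acc)))))
    \<le> size acc + (size c + size l)" for c l acc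
    by (rule trans_le_add1, rule size_mono_ms) simp
qed (intro pt_intros npoly.intros pt_remove | assumption)+

definition same_ms :: "tree \<Rightarrow> tree \<Rightarrow> tree" where
  "same_ms l l' = (if difference l l' = Leaf then if difference l' l = Leaf then tru else Leaf else Leaf)"

lemma same_ms_iff: "same_ms l l' = Leaf \<longleftrightarrow> ms l \<noteq> ms l'"
proof -
  have "difference l l' = Leaf \<longleftrightarrow> ms l \<subseteq># ms l'" "difference l' l = Leaf \<longleftrightarrow> ms l' \<subseteq># ms l"
    by (simp_all flip: ms_empty_iff add: Diff_eq_empty_iff_mset)
  then show ?thesis unfolding same_ms_def by auto
qed

lemma pt_same_ms: "pt l \<Longrightarrow> pt l' \<Longrightarrow> pt (\<lambda>x. same_ms (l x) (l' x))"
  unfolding same_ms_def by (intro pt_intros pt_if pt_difference)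

text \<open>\<open>Leaf\<close> doubles as the failure value. This is safe for the search because
  the code of a proof, being a nonempty list, is never \<open>Leaf\<close>.\<close>

definition first_success :: "(tree \<Rightarrow> tree) \<Rightarrow> tree \<Rightarrow> tree \<Rightarrow> tree" where
  "first_success g c l = loop (\<lambda>z. if tl_tree (tl_tree z) = Leaf
     then g (Node (hd_tree z) (hd_tree (hd_tree (tl_tree z)))) else tl_tree (tl_tree z)) c l Leaf"

lemma first_success:
  "first_success g c l \<noteq> Leaf \<Longrightarrow> \<exists>e\<in>set (elems l). first_success g c l = g (Node c e)"
  "e \<in> set (elems l) \<Longrightarrow> g (Node c e) \<noteq> Leaf \<Longrightarrow> first_success g c l \<noteq> Leaf"
proof -
  let ?f = "\<lambda>z. if tl_tree (tl_tree z) = Leaf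
     then g (Node (hd_tree z) (hd_tree (hd_tree (tl_tree z)))) else tl_tree (tl_tree z)"
  have stop: "acc \<noteq> Leaf \<Longrightarrow> loop ?f c l acc = acc" for l acc
    by (induction l) auto
  have step: "loop ?f c (Node h l) Leaf = (if g (Node c h) = Leaf then loop ?f c l Leaf else g (Node c h))" for h l
    using stop[of "g (Node c h)" l] by simp
  show "first_success g c l \<noteq> Leaf \<Longrightarrow> \<exists>e\<in>set (elems l). first_success g c l = g (Node c e)"
    unfolding first_success_def
  proof (induction l)
    case (Node h l)
    then show ?case unfolding step by (auto split: if_splits)
  qed simp
  show "e \<in> set (elems l) \<Longrightarrow> g (Node c e) \<noteq> Leaf \<Longrightarrow> first_success g c l \<noteq> Leaf"
    unfolding first_success_def
  proof (induction l)
    case (Node h l)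
    then show ?case unfolding step by auto
  qed simp
qed

text \<open>Supplies the growth bound for a loop that replaces its accumulator by a new value
  instead of extending it.\<close>

lemma pt_size:
  assumes "pt g"
  obtains p where "npoly p" "\<And>x. size (g x) \<le> p (size x)"
proof -
  from assms obtain c n p where p: "npoly p" "0 < n"
    "\<And>s. \<exists>t s'. exec c s t s' \<and> s' 0 = g (s 0) \<and> (\<forall>r\<ge>n. s' r = s r) \<and> t \<le> p (size (s 0)) \<and>
      size (g (s 0)) \<le> size (s 0) + p (size (s 0))" by (rule ptE) blast
  have "size (g x) \<le> size x + p (size x)" for x using p(3)[of "\<lambda>_. x"] by blast
  then show thesis by (intro that[of "\<lambda>n. n + p n"] npoly.intros p(1))
qed

lemma pt_first_success:
  assumes "pt g" "pt c" "pt l"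
  shows "pt (\<lambda>x. first_success g (c x) (l x))"
proof -
  obtain p where p: "npoly p" "\<And>x. size (g x) \<le> p (size x)" using pt_size[OF assms(1)] by blast
  show ?thesis
    unfolding first_success_def
  proof (rule pt_loop[where q = "\<lambda>n. p (n + 1)"])
    fix c l acc
    have "size (g (Node c (hd_tree l))) \<le> p (size c + size l + 1)"
      by (rule order_trans[OF p(2)], rule npoly_mono[OF p(1)]) simp
    then show "size (if tl_tree (tl_tree (Node c (Node l acc))) = Leaf
        then g (Node (hd_tree (Node c (Node l acc))) (hd_tree (hd_tree (tl_tree (Node c (Node l acc))))))
        else tl_tree (tl_tree (Node c (Node l acc)))) \<le> size acc + p (size c + size l + 1)"
      by simp
  qed (intro pt_intros pt_if pt_comp[OF assms(1)] npoly.intros npoly_comp[OF p(1)] assms(2,3))+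
qed

section \<open>Exhaustive search for a substitution\<close>

text \<open>An assignment is a function and not a tree, so feasibility in this argument is expressed
  by plugging in polynomial-time functions for its values.\<close>

definition uniform_pt :: "((nat \<Rightarrow> tree) \<Rightarrow> tree \<Rightarrow> tree) \<Rightarrow> bool" where
  "uniform_pt H \<longleftrightarrow> (\<forall>e g. (\<forall>a. pt (e a)) \<longrightarrow> pt g \<longrightarrow> pt (\<lambda>x. H (\<lambda>a. e a x) (g x)))"

text \<open>One loop per atom, nested; the number of atoms is fixed, so the time remains polynomial.
  The two conclusions are soundness and completeness: a nonempty result comes from some assignment,
  and a successful assignment among the candidates forces a nonempty result. The default value pins
  down the atoms outside the list.\<close>

lemma assignment_search:
  assumes "uniform_pt H" "\<forall>a\<in>set as. pt (cand a)" "\<forall>a\<in>set as. pt (proj a)"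
  shows "\<exists>F. pt F \<and>
    (\<forall>x. F x \<noteq> Leaf \<longrightarrow> (\<exists>d. F x = H d x \<and> (\<forall>a. a \<notin> set as \<longrightarrow> d a = dflt))) \<and>
    (\<forall>x d. (\<forall>a\<in>set as. d a \<in> proj a ` set (elems (cand a x))) \<longrightarrow>
      (\<forall>a. a \<notin> set as \<longrightarrow> d a = dflt) \<longrightarrow> H d x \<noteq> Leaf \<longrightarrow> F x \<noteq> Leaf)"
  using assms
proof (induction as arbitrary: H cand)
  case Nil
  have "pt (\<lambda>x. H (\<lambda>a. dflt) x)"
    using Nil.prems(1)[unfolded uniform_pt_def, rule_format, of "\<lambda>a x. dflt" "\<lambda>x. x"]
    by (simp add: pt_intros)
  moreover have "(\<forall>a. d a = dflt) \<longleftrightarrow> d = (\<lambda>a. dflt)" for d :: "nat \<Rightarrow> tree" by auto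
  ultimately show ?case by (intro exI[of _ "\<lambda>x. H (\<lambda>a. dflt) x"]) simp
next
  case (Cons a as)
  \<comment> \<open>The outer loop hands the value tried for \<open>a\<close> to the inner search by
    pairing it with the input.\<close>
  let ?H = "\<lambda>d z. H (d(a := tl_tree z)) (hd_tree z)"
  have "uniform_pt ?H"
    unfolding uniform_pt_def
  proof (intro allI impI)
    fix e :: "nat \<Rightarrow> tree \<Rightarrow> tree" and g
    assume e: "\<forall>a. pt (e a)" and g: "pt g"
    have "pt (\<lambda>x. H (\<lambda>b. (e(a := \<lambda>x. tl_tree (g x))) b x) (hd_tree (g x)))"
      by (rule Cons.prems(1)[unfolded uniform_pt_def, rule_format]) (use e g in \<open>simp_all add: pt_intros\<close>)
    moreover have "(\<lambda>b. (e(a := \<lambda>x. tl_tree (g x))) b x) = (\<lambda>b. e b x)(a := tl_tree (g x))" for x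
      by auto
    ultimately show "pt (\<lambda>x. H ((\<lambda>b. e b x)(a := tl_tree (g x))) (hd_tree (g x)))" by simp
  qed
  moreover have "\<forall>b\<in>set as. pt (\<lambda>z. cand b (hd_tree z))"
    using Cons.prems(2) by (auto intro: pt_comp[OF _ pt_hd_tree])
  moreover have "\<forall>b\<in>set as. pt (proj b)" using Cons.prems(3) by simp
  ultimately have "\<exists>F. pt F \<and>
    (\<forall>x. F x \<noteq> Leaf \<longrightarrow> (\<exists>d. F x = ?H d x \<and> (\<forall>a. a \<notin> set as \<longrightarrow> d a = dflt))) \<and>
    (\<forall>x d. (\<forall>a\<in>set as. d a \<in> proj a ` set (elems (cand a (hd_tree x)))) \<longrightarrow>
      (\<forall>a. a \<notin> set as \<longrightarrow> d a = dflt) \<longrightarrow> ?H d x \<noteq> Leaf \<longrightarrow> F x \<noteq> Leaf)"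
    by (rule Cons.IH)
  then obtain F where F: "pt F"
    "\<forall>x. F x \<noteq> Leaf \<longrightarrow> (\<exists>d. F x = ?H d x \<and> (\<forall>a. a \<notin> set as \<longrightarrow> d a = dflt))"
    "\<forall>x d. (\<forall>a\<in>set as. d a \<in> proj a ` set (elems (cand a (hd_tree x)))) \<longrightarrow>
      (\<forall>a. a \<notin> set as \<longrightarrow> d a = dflt) \<longrightarrow> ?H d x \<noteq> Leaf \<longrightarrow> F x \<noteq> Leaf"
    by (elim exE conjE) (rule that; assumption)
  let ?g = "\<lambda>z. F (Node (hd_tree z) (proj a (tl_tree z)))"
  let ?F = "\<lambda>x. first_success ?g x (cand a x)"
  show ?case
  proof (rule exI[of _ ?F], intro conjI allI impI)
    show "pt ?F"
      by (rule pt_first_success[OF pt_comp[OF F(1) pt_Node[OF pt_hd_tree pt_comp[OF _ pt_tl_tree]]] pt_id])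
        (use Cons.prems(2,3) in simp_all)
  next
    fix x
    assume "?F x \<noteq> Leaf"
    from first_success(1)[OF this] obtain e where e: "?F x = F (Node x (proj a e))" by auto
    with \<open>?F x \<noteq> Leaf\<close> have "F (Node x (proj a e)) \<noteq> Leaf" by simp
    from F(2)[rule_format, OF this] obtain d where "F (Node x (proj a e)) = H (d(a := proj a e)) x"
      "\<forall>a. a \<notin> set as \<longrightarrow> d a = dflt" by auto
    with e show "\<exists>d. ?F x = H d x \<and> (\<forall>b. b \<notin> set (a # as) \<longrightarrow> d b = dflt)"
      by (intro exI[of _ "d(a := proj a e)"]) simp
  next
    fix x d
    assume d: "\<forall>b\<in>set (a # as). d b \<in> proj b ` set (elems (cand b x))"
      "\<forall>b. b \<notin> set (a # as) \<longrightarrow> d b = dflt" "H d x \<noteq> Leaf"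
    then obtain e where e: "e \<in> set (elems (cand a x))" "d a = proj a e" by auto
    \<comment> \<open>If \<open>a\<close> recurs in \<open>as\<close>, the inner search assigns it
      too and its value must be kept; otherwise the inner search expects the default at
      \<open>a\<close>.\<close>
    let ?d = "if a \<in> set as then d else d(a := dflt)"
    have upd: "?d(a := proj a e) = d" using e by auto
    have "F (Node x (proj a e)) \<noteq> Leaf"
      by (rule F(3)[rule_format, of ?d]) (use d upd in auto)
    with e show "?F x \<noteq> Leaf" by (intro first_success(2)) simp_all
  qed
qed

section \<open>Encodings\<close>

lemma enc_nat_inject: "enc_nat m = enc_nat n \<longleftrightarrow> m = n"
proof
  show "enc_nat m = enc_nat n \<Longrightarrow> m = n"
  proof (induction m arbitrary: n rule: less_induct)
    case (less m)
    show ?case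
    proof (cases "m = 0 \<or> n = 0")
      case True
      with less.prems show ?thesis
        by (auto simp: enc_nat.simps[of m] enc_nat.simps[of n] split: if_splits)
    next
      case False
      with less.prems have "odd m = odd n" "enc_nat (m div 2) = enc_nat (n div 2)"
        by (auto simp: enc_nat.simps[of m] enc_nat.simps[of n] split: if_splits)
      moreover from this less.IH[of "m div 2"] False have "m div 2 = n div 2" by simp
      ultimately show ?thesis by (metis odd_two_times_div_two_succ even_two_times_div_two)
    qed
  qed
qed simp

text \<open>Substitution followed by encoding, but for arbitrary trees at the atoms: a value tried
  by the search need not be the code of a formula.\<close>

primrec fill :: "(nat \<Rightarrow> tree) \<Rightarrow> fm \<Rightarrow> tree" where
  "fill d (Atom n) = d n"
| "fill d Top = Node (enc_nat 1) Leaf"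
| "fill d Bot = Node (enc_nat 2) Leaf"
| "fill d (And A B) = Node (enc_nat 3) (Node (fill d A) (fill d B))"
| "fill d (Or A B) = Node (enc_nat 4) (Node (fill d A) (fill d B))"
| "fill d (Imp A B) = Node (enc_nat 5) (Node (fill d A) (fill d B))"
| "fill d (Box A) = Node (enc_nat 6) (fill d A)"
| "fill d (Dia A) = Node (enc_nat 7) (fill d A)"

lemma fill_enc [simp]: "fill (\<lambda>a. enc_fm (\<sigma> a)) A = enc_fm (subst \<sigma> A)"
  by (induction A) auto

lemma enc_fm_inject: "enc_fm A = enc_fm B \<longleftrightarrow> A = B"
proof
  show "enc_fm A = enc_fm B \<Longrightarrow> A = B"
    by (induction A arbitrary: B; case_tac B) (auto simp: enc_nat_inject)
qed simp

primrec atoms :: "fm \<Rightarrow> nat set" where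
  "atoms (Atom n) = {n}"
| "atoms Top = {}"
| "atoms Bot = {}"
| "atoms (And A B) = atoms A \<union> atoms B"
| "atoms (Or A B) = atoms A \<union> atoms B"
| "atoms (Imp A B) = atoms A \<union> atoms B"
| "atoms (Box A) = atoms A"
| "atoms (Dia A) = atoms A"

lemma finite_atoms [simp]: "finite (atoms A)"
  by (induction A) auto

lemma subst_cong: "\<forall>a\<in>atoms A. \<sigma> a = \<tau> a \<Longrightarrow> subst \<sigma> A = subst \<tau> A"
  by (induction A) auto

text \<open>The code of a compound formula determines its constructor and has codes as parts. Hence
  values that produce the code of a formula are codes themselves, and an assignment found by the
  search is a substitution.\<close>

lemma fill_eq_enc: "fill d A = enc_fm F \<Longrightarrow> a \<in> atoms A \<Longrightarrow> \<exists>B. d a = enc_fm B"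
proof (induction A arbitrary: F)
  case (Atom n)
  then show ?case by auto
qed (case_tac F; auto simp: enc_nat_inject)+

lemma fill_proj_step:
  assumes "\<exists>h. pt h \<and> (\<forall>d :: nat \<Rightarrow> tree. h (f d) = d a)" "pt g" "\<And>d. g (f' d) = f d"
  shows "\<exists>h. pt h \<and> (\<forall>d. h (f' d) = d a)"
proof -
  from assms(1) obtain h where "pt h" "\<forall>d. h (f d) = d a" by blast
  with assms(2,3) pt_comp[of h g] show ?thesis by (intro exI[of _ "\<lambda>x. h (g x)"]) simp
qed

text \<open>The position of an occurrence of \<open>a\<close> in \<open>A\<close> is fixed, so it is
  reached by a fixed sequence of heads and tails.\<close>

lemma fill_proj: "a \<in> atoms A \<Longrightarrow> \<exists>h. pt h \<and> (\<forall>d. h (fill d A) = d a)"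
proof (induction A)
  case (Atom n)
  then show ?case by (auto intro!: exI[of _ "\<lambda>x. x"] pt_id)
next
  case (And A B)
  then consider "\<exists>h. pt h \<and> (\<forall>d. h (fill d A) = d a)" | "\<exists>h. pt h \<and> (\<forall>d. h (fill d B) = d a)"
    by auto
  then show ?case
    by cases (erule fill_proj_step[where g = "\<lambda>x. hd_tree (tl_tree x)"]
        fill_proj_step[where g = "\<lambda>x. tl_tree (tl_tree x)"]; simp add: pt_intros)+
next
  case (Or A B)
  then consider "\<exists>h. pt h \<and> (\<forall>d. h (fill d A) = d a)" | "\<exists>h. pt h \<and> (\<forall>d. h (fill d B) = d a)"
    by auto
  then show ?case
    by cases (erule fill_proj_step[where g = "\<lambda>x. hd_tree (tl_tree x)"]
        fill_proj_step[where g = "\<lambda>x. tl_tree (tl_tree x)"]; simp add: pt_intros)+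
next
  case (Imp A B)
  then consider "\<exists>h. pt h \<and> (\<forall>d. h (fill d A) = d a)" | "\<exists>h. pt h \<and> (\<forall>d. h (fill d B) = d a)"
    by auto
  then show ?case
    by cases (erule fill_proj_step[where g = "\<lambda>x. hd_tree (tl_tree x)"]
        fill_proj_step[where g = "\<lambda>x. tl_tree (tl_tree x)"]; simp add: pt_intros)+
next
  case (Box A)
  then have "\<exists>h. pt h \<and> (\<forall>d. h (fill d A) = d a)" by simp
  then show ?case by (rule fill_proj_step[OF _ pt_tl_tree]) simp
next
  case (Dia A)
  then have "\<exists>h. pt h \<and> (\<forall>d. h (fill d A) = d a)" by simp
  then show ?case by (rule fill_proj_step[OF _ pt_tl_tree]) simp
qed simp_all

lemma pt_fill: "\<forall>a. pt (e a) \<Longrightarrow> pt (\<lambda>x. fill (\<lambda>a. e a x) A)"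
  by (induction A) (simp_all add: pt_intros)

section \<open>Filling meta-sequents with trees\<close>

primrec fill_side :: "(nat \<Rightarrow> tree) \<Rightarrow> (nat \<Rightarrow> tree) \<Rightarrow> item list \<Rightarrow> tree" where
  "fill_side d m [] = Leaf"
| "fill_side d m (it # its) = (case it of Fm A \<Rightarrow> Node (fill d A) (fill_side d m its)
     | MV g \<Rightarrow> rev_app (m g) (fill_side d m its))"

definition fill_seq :: "(nat \<Rightarrow> tree) \<Rightarrow> (nat \<Rightarrow> tree) \<Rightarrow> meta_sequent \<Rightarrow> tree" where
  "fill_seq d m S = Node (fill_side d m (list_of (ante S))) (fill_side d m (list_of (succ S)))"

lemma pt_fill_side:
  "\<forall>a. pt (e a) \<Longrightarrow> \<forall>g. pt (m g) \<Longrightarrow> pt (\<lambda>x. fill_side (\<lambda>a. e a x) (\<lambda>g. m g x) its)"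
proof (induction its)
  case (Cons it its)
  then show ?case by (cases it) (simp_all add: pt_intros pt_fill pt_rev_app)
qed (simp add: pt_const)

lemma pt_fill_seq:
  "\<forall>a. pt (e a) \<Longrightarrow> \<forall>g. pt (m g) \<Longrightarrow> pt (\<lambda>x. fill_seq (\<lambda>a. e a x) (\<lambda>g. m g x) S)"
  unfolding fill_seq_def by (intro pt_Node pt_fill_side)

lemma fill_in_side: "Fm A \<in> set its \<Longrightarrow> fill d A \<in># ms (fill_side d m its)"
proof (induction its)
  case (Cons it its)
  then show ?case by (cases it) auto
qed simp

section \<open>Encodings as multisets of trees\<close>

definition enc_ms :: "fm multiset \<Rightarrow> tree multiset" where
  "enc_ms M = image_mset enc_fm M"

lemma enc_ms_simps [simp]: "enc_ms (M + N) = enc_ms M + enc_ms N" "enc_ms {#} = {#}"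
  "enc_ms (add_mset A M) = add_mset (enc_fm A) (enc_ms M)"
  by (simp_all add: enc_ms_def)

lemma enc_ms_inject: "enc_ms M = enc_ms N \<longleftrightarrow> M = N"
proof -
  have "inj enc_fm" by (auto intro: injI simp: enc_fm_inject)
  then show ?thesis unfolding enc_ms_def by (simp add: inj_eq multiset.inj_map)
qed

lemma enc_ms_subset:
  assumes "M \<subseteq># enc_ms N"
  obtains K where "M = enc_ms K"
  using assms unfolding enc_ms_def by (metis image_mset_subseteq_mono mset_subset_eq_exists_conv image_mset_eq_plusD)

lemma ms_eq_enc_ms:
  assumes "ms l = enc_ms M"
  obtains As where "mset As = M" "l = enc_list (map enc_fm As)"
proof -
  have "set (elems l) \<subseteq> range enc_fm"
    using arg_cong[OF assms, of set_mset] by (auto simp: enc_ms_def)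
  then obtain As where "elems l = map enc_fm As"
    by (metis ex_map_conv image_iff subset_eq)
  then have As: "elems l = map enc_fm As" .
  with assms have "enc_ms (mset As) = enc_ms M" by (simp add: enc_ms_def)
  then have "mset As = M" by (simp add: enc_ms_inject)
  moreover have "l = enc_list (map enc_fm As)" by (metis As enc_list_elems)
  ultimately show thesis by (rule that)
qed

text \<open>Removes the arbitrary order of the lists: from here on, being an encoding is a pair of
  multiset equations.\<close>

lemma encodes_seq_iff:
  "encodes_seq x S \<longleftrightarrow> (\<exists>l r. x = Node l r \<and> ms l = enc_ms (ante S) \<and> ms r = enc_ms (succ S))"
proof
  assume "encodes_seq x S"
  then show "\<exists>l r. x = Node l r \<and> ms l = enc_ms (ante S) \<and> ms r = enc_ms (succ S)"
    by (auto simp: encodes_seq_def enc_ms_def)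
next
  assume "\<exists>l r. x = Node l r \<and> ms l = enc_ms (ante S) \<and> ms r = enc_ms (succ S)"
  then obtain l r where x: "x = Node l r" "ms l = enc_ms (ante S)" "ms r = enc_ms (succ S)" by blast
  from x(2) obtain As where "mset As = ante S" "l = enc_list (map enc_fm As)" by (rule ms_eq_enc_ms)
  moreover from x(3) obtain Bs where "mset Bs = succ S" "r = enc_list (map enc_fm Bs)" by (rule ms_eq_enc_ms)
  ultimately show "encodes_seq x S" using x(1) unfolding encodes_seq_def by blast
qed

lemma encodes_seqs_iff: "encodes_seqs x Ss \<longleftrightarrow> list_all2 encodes_seq (elems x) Ss"
  unfolding encodes_seqs_def by (metis elems_enc_list enc_list_elems)

lemma encodes_unique: "encodes_seq x S \<Longrightarrow> encodes_seq x T \<Longrightarrow> S = T"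
  by (cases S; cases T) (auto simp: encodes_seq_iff enc_ms_inject)

lemma ms_fill_side:
  assumes "\<forall>g. ms (m g) = enc_ms (\<mu> g)"
  shows "ms (fill_side (\<lambda>a. enc_fm (\<sigma> a)) m its) = enc_ms (inst_side \<sigma> \<mu> (mset its))"
proof (induction its)
  case (Cons it its)
  then show ?case using assms by (cases it) simp_all
qed simp

lemma encodes_fill_seq:
  assumes "\<forall>g. ms (m g) = enc_ms (\<mu> g)"
  shows "encodes_seq (fill_seq (\<lambda>a. enc_fm (\<sigma> a)) m S) (inst_seq \<sigma> \<mu> S)"
  using ms_fill_side[OF assms] by (auto simp: encodes_seq_iff fill_seq_def inst_seq_def)

section \<open>Feasible provability of the axiom\<close>

primrec fill_seqs :: "(nat \<Rightarrow> tree) \<Rightarrow> (nat \<Rightarrow> tree) \<Rightarrow> meta_sequent list \<Rightarrow> tree \<Rightarrow> tree" where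
  "fill_seqs d m [] z = z"
| "fill_seqs d m (S # Ss) z = Node (fill_seq d m S) (fill_seqs d m Ss z)"

lemma pt_fill_seqs:
  "\<forall>a. pt (e a) \<Longrightarrow> \<forall>g. pt (m g) \<Longrightarrow> pt z \<Longrightarrow>
    pt (\<lambda>x. fill_seqs (\<lambda>a. e a x) (\<lambda>g. m g x) Ss (z x))"
  by (induction Ss) (simp_all add: pt_Node pt_fill_seq)

lemma encodes_fill_seqs:
  assumes "\<forall>g. ms (m g) = enc_ms (\<mu> g)" "encodes_seqs z \<pi>"
  shows "encodes_seqs (fill_seqs (\<lambda>a. enc_fm (\<sigma> a)) m Ss z) (map (inst_seq \<sigma> \<mu>) Ss @ \<pi>)"
  using assms(2) encodes_fill_seq[OF assms(1)] by (induction Ss) (auto simp: encodes_seqs_iff)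

text \<open>Here no search takes place: the instance shows the substituted axiom as its only
  formula, and the values of the atoms are read off along fixed paths.\<close>

lemma feasibly_proves_axiom:
  assumes "sder G {} D ({#} \<Rrightarrow> {#Fm Ax#})"
  shows "feasibly_proves G (axiom_rule Ax)"
proof -
  obtain ts where ts: "\<And>\<sigma> \<mu>. size (\<mu> D) \<le> 1 \<Longrightarrow>
     yields G (inst_seq \<sigma> \<mu> ` {}) (map (inst_seq \<sigma> \<mu>) ts) [inst_seq \<sigma> \<mu> ({#} \<Rrightarrow> {#Fm Ax#})]"
    using assms unfolding sder_def by blast
  have "\<forall>a. \<exists>h. pt h \<and> (a \<in> atoms Ax \<longrightarrow> (\<forall>d. h (fill d Ax) = d a)) \<and>
      (a \<notin> atoms Ax \<longrightarrow> h = (\<lambda>_. enc_fm Top))"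
    using fill_proj pt_const by metis
  then obtain h where h: "\<And>a. pt (h a)" "\<And>a d. a \<in> atoms Ax \<Longrightarrow> h a (fill d Ax) = d a"
    "\<And>a. a \<notin> atoms Ax \<Longrightarrow> h a = (\<lambda>_. enc_fm Top)" by metis
  \<comment> \<open>In \<open>z = Node x y\<close> this path leads to the sequent \<open>y\<close>,
    then to its succedent and to the first formula there.\<close>
  let ?f = "\<lambda>z. fill_seqs (\<lambda>a. h a (hd_tree (tl_tree (tl_tree z)))) (\<lambda>_. Leaf) ts Leaf"
  have "pt ?f"
    by (intro pt_fill_seqs pt_intros allI pt_comp[OF h(1)])
  then have "poly_time ?f" by (rule pt_poly_time)
  moreover have "\<exists>\<pi>. encodes_seqs (?f (Node x y)) \<pi> \<and> is_proof G Ss \<pi> S"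
    if "rule_instance (axiom_rule Ax) Ss S" "encodes_seqs x Ss" "encodes_seq y S" for Ss S x y
  proof -
    from that(1) obtain \<sigma> where S: "Ss = []" "S = ({#} \<Rrightarrow> {#subst \<sigma> Ax#})"
      by (auto simp: rule_instance_def axiom_rule_def inst_seq_def)
    with that(3) have y: "hd_tree (tl_tree y) = enc_fm (subst \<sigma> Ax)"
    proof -
      from that(3) S obtain l r where "y = Node l r" "ms r = {#enc_fm (subst \<sigma> Ax)#}"
        by (auto simp: encodes_seq_iff)
      then show ?thesis by (cases r) auto
    qed
    \<comment> \<open>The template may contain atoms foreign to \<open>Ax\<close>; they receive
      \<open>Top\<close>, which does not affect the end sequent.\<close>
    define \<sigma>' where "\<sigma>' a = (if a \<in> atoms Ax then \<sigma> a else Top)" for a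
    have d: "(\<lambda>a. h a (hd_tree (tl_tree (tl_tree (Node x y))))) = (\<lambda>a. enc_fm (\<sigma>' a))"
    proof
      fix a
      show "h a (hd_tree (tl_tree (tl_tree (Node x y)))) = enc_fm (\<sigma>' a)"
        using h(2)[of a "\<lambda>a. enc_fm (\<sigma> a)"] h(3)[of a] y by (simp add: \<sigma>'_def)
    qed
    let ?\<pi> = "map (inst_seq \<sigma>' (\<lambda>_. {#})) ts"
    have "subst \<sigma>' Ax = subst \<sigma> Ax" by (rule subst_cong) (simp add: \<sigma>'_def)
    then have "yields G (set Ss) ?\<pi> [S]"
      using ts[of "\<lambda>_. {#}" \<sigma>'] by (simp add: S inst_seq_def)
    then have "is_proof G Ss ?\<pi> S" by (rule yields_is_proof)
    moreover have "encodes_seqs (?f (Node x y)) (?\<pi> @ [])"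
      unfolding d by (rule encodes_fill_seqs) (simp_all add: encodes_seqs_iff)
    ultimately show ?thesis by auto
  qed
  ultimately show ?thesis unfolding feasibly_proves_def by blast
qed

section \<open>Feasible provability of the rule\<close>

primrec check :: "(nat \<Rightarrow> tree) \<Rightarrow> (nat \<Rightarrow> tree) \<Rightarrow> meta_sequent list \<Rightarrow> tree \<Rightarrow> tree" where
  "check d m [] t = tru"
| "check d m (S # Ss) t =
    (if same_ms (hd_tree (hd_tree t)) (fill_side d m (list_of (ante S))) = Leaf then Leaf else
     if same_ms (tl_tree (hd_tree t)) (fill_side d m (list_of (succ S))) = Leaf then Leaf else
     check d m Ss (tl_tree t))"

lemma pt_check:
  "\<forall>a. pt (e a) \<Longrightarrow> \<forall>g. pt (m g) \<Longrightarrow> pt t \<Longrightarrow> pt (\<lambda>x. check (\<lambda>a. e a x) (\<lambda>g. m g x) Ss (t x))"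
proof (induction Ss arbitrary: t)
  case (Cons S Ss)
  have *: "pt (\<lambda>x. if b x = Leaf then Leaf else f x)" if "pt b" "pt f" for b f
    using that by (rule pt_if) (rule pt_const)
  show ?case
    unfolding check.simps
    by (intro * pt_same_ms pt_fill_side pt_intros Cons.IH Cons.prems)
qed (simp add: pt_const)

lemma check_iff:
  assumes "length xs = length Ss"
  shows "check d m Ss (enc_list xs) \<noteq> Leaf \<longleftrightarrow>
    list_all2 (\<lambda>x S. ms (hd_tree x) = ms (fill_side d m (list_of (ante S))) \<and>
      ms (tl_tree x) = ms (fill_side d m (list_of (succ S)))) xs Ss"
  using assms by (induction xs Ss rule: list_induct2) (simp_all add: same_ms_iff)

definition rule_atoms :: "meta_sequent list \<Rightarrow> nat set" where
  "rule_atoms Ss = (\<Union>S\<in>set Ss. \<Union>A\<in>{A. Fm A \<in># ante S + succ S}. atoms A)"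

lemma finite_rule_atoms: "finite (rule_atoms Ss)"
proof -
  have "finite {A. Fm A \<in># M}" for M
    by (rule finite_subset[of _ "(\<lambda>x. case x of Fm A \<Rightarrow> A | MV _ \<Rightarrow> Top) ` set_mset M"])
      (force intro: image_eqI)+
  then show ?thesis unfolding rule_atoms_def by auto
qed

lemma inst_seq_cong:
  assumes "S \<in> set Ss" "\<forall>a\<in>rule_atoms Ss. \<sigma> a = \<tau> a"
    "\<forall>g. MV g \<in># ante S + succ S \<longrightarrow> \<mu> g = \<nu> g"
  shows "inst_seq \<sigma> \<mu> S = inst_seq \<tau> \<nu> S"
proof -
  have "inst_item \<sigma> \<mu> it = inst_item \<tau> \<nu> it" if "it \<in># ante S + succ S" for it
  proof (cases it)
    case (Fm A)
    have "subst \<sigma> A = subst \<tau> A"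
      by (rule subst_cong) (use assms(1,2) that Fm in \<open>auto simp: rule_atoms_def\<close>)
    with Fm show ?thesis by simp
  qed (use assms(3) that in auto)
  then show ?thesis
    by (auto simp: inst_seq_def inst_side_def intro!: arg_cong[of _ _ sum_mset] image_mset_cong)
qed

text \<open>
  The value of an atom can be read off from a member of a fixed side of a fixed sequent, so there are
  polynomially many substitutions to try.
\<close>

lemma atom_candidates:
  assumes "a \<in> rule_atoms Ss"
  shows "\<exists>cand proj A. pt cand \<and> pt proj \<and> a \<in> atoms A \<and> (\<forall>d. proj (fill d A) = d a) \<and>
    (\<forall>d m xs. length xs = length Ss \<longrightarrow> check d m Ss (enc_list xs) \<noteq> Leaf \<longrightarrow>
      fill d A \<in> set (elems (cand (enc_list xs)))) \<and>
    (\<forall>xs. length xs = length Ss \<longrightarrow>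
      (\<exists>x\<in>set xs. cand (enc_list xs) \<in> {hd_tree x, tl_tree x}))"
proof -
  from assms obtain S A where S: "S \<in> set Ss" and A: "Fm A \<in># ante S + succ S" and a: "a \<in> atoms A"
    by (auto simp: rule_atoms_def)
  from S obtain i where i: "i < length Ss" "Ss ! i = S" by (auto simp: in_set_conv_nth)
  obtain proj where proj: "pt proj" "\<forall>d. proj (fill d A) = d a" using fill_proj[OF a] by blast
  define item where "item t = hd_tree ((tl_tree ^^ i) t)" for t
  have "pt (\<lambda>t. (tl_tree ^^ i) t)" by (induction i) (simp_all add: pt_intros)
  then have pt_item: "pt item" unfolding item_def by (rule pt_hd)
  have item: "item (enc_list xs) = xs ! i" if "i < length xs" for xs
    using that unfolding item_def
  proof (induction i arbitrary: xs)
    case 0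
    then show ?case by (cases xs) auto
  next
    case (Suc i)
    then show ?case by (cases xs) (auto simp: funpow_swap1)
  qed
  have side: "ms (hd_tree (item (enc_list xs))) = ms (fill_side d m (list_of (ante S)))"
    "ms (tl_tree (item (enc_list xs))) = ms (fill_side d m (list_of (succ S)))"
    if "length xs = length Ss" "check d m Ss (enc_list xs) \<noteq> Leaf" for d m xs
    using that i by (auto simp: check_iff item list_all2_conv_all_nth)
  have mem: "item (enc_list xs) \<in> set xs" if "length xs = length Ss" for xs
    using that i item by simp
  from A consider "Fm A \<in># ante S" | "Fm A \<in># succ S" by auto
  then show ?thesis
  proof cases
    case 1
    have f: "fill d A \<in> set (elems (hd_tree (item (enc_list xs))))"
      if "length xs = length Ss" "check d m Ss (enc_list xs) \<noteq> Leaf" for d m xs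
      using fill_in_side[of A "list_of (ante S)" d m] 1 side(1)[OF that]
      by (metis set_list_of set_mset_mset)
    show ?thesis
      using f mem pt_hd[OF pt_item] proj a
      by (intro exI[of _ "\<lambda>t. hd_tree (item t)"] exI[of _ proj] exI[of _ A]) blast
  next
    case 2
    have f: "fill d A \<in> set (elems (tl_tree (item (enc_list xs))))"
      if "length xs = length Ss" "check d m Ss (enc_list xs) \<noteq> Leaf" for d m xs
      using fill_in_side[of A "list_of (succ S)" d m] 2 side(2)[OF that]
      by (metis set_list_of set_mset_mset)
    show ?thesis
      using f mem pt_tl[OF pt_item] proj a
      by (intro exI[of _ "\<lambda>t. tl_tree (item t)"] exI[of _ proj] exI[of _ A]) blast
  qed
qed

text \<open>The antecedents of the weakening lines are the suffixes of the context list. The loop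
  meets the longest suffix first and conses, so shorter ones end up in front, preceded by the axiom
  with empty antecedent: the order of \<open>weakenings\<close>.\<close>

definition add_weakenings :: "tree \<Rightarrow> tree \<Rightarrow> tree \<Rightarrow> tree" where
  "add_weakenings r l z = Node (Node Leaf r)
    (loop (\<lambda>z. Node (Node (hd_tree (tl_tree z)) (hd_tree z)) (tl_tree (tl_tree z))) r l z)"

lemma pt_add_weakenings:
  "pt r \<Longrightarrow> pt l \<Longrightarrow> pt z \<Longrightarrow> pt (\<lambda>x. add_weakenings (r x) (l x) (z x))"
  unfolding add_weakenings_def
  by (rule pt_Node, rule pt_Node[OF pt_const], assumption, rule pt_loop[where q = "\<lambda>n. n + 2"])
    (intro pt_intros npoly.intros | assumption | simp)+

lemma encodes_add_weakenings:
  assumes "ms r = {#enc_fm A#}" "encodes_seqs z \<pi>"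
  shows "encodes_seqs (add_weakenings r (enc_list (map enc_fm Bs)) z) (weakenings A Bs @ \<pi>)"
proof -
  let ?g = "\<lambda>z. Node (Node (hd_tree (tl_tree z)) (hd_tree z)) (tl_tree (tl_tree z))"
  have "encodes_seqs (Node (Node Leaf r) (loop ?g r (enc_list (map enc_fm Bs)) z))
      (weakenings A Bs @ \<pi>)"
    using assms(2)
  proof (induction Bs arbitrary: z \<pi>)
    case Nil
    then show ?case using assms(1) by (simp add: encodes_seqs_iff encodes_seq_iff)
  next
    case (Cons B Bs)
    have "encodes_seq (Node (enc_list (map enc_fm (B # Bs))) r) (mset (B # Bs) \<Rrightarrow> {#A#})"
      using assms(1) by (simp add: encodes_seq_iff enc_ms_def)
    with Cons.prems have "encodes_seqs (Node (Node (enc_list (map enc_fm (B # Bs))) r) z)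
        ((mset (B # Bs) \<Rrightarrow> {#A#}) # \<pi>)" by (simp add: encodes_seqs_iff)
    from Cons.IH[OF this] show ?case by simp
  qed
  then show ?thesis by (simp add: add_weakenings_def)
qed

lemma encodes_seq_Node:
  "x \<noteq> Leaf \<Longrightarrow>
    encodes_seq x S \<longleftrightarrow> ms (hd_tree x) = enc_ms (ante S) \<and> ms (tl_tree x) = enc_ms (succ S)"
  by (cases x) (auto simp: encodes_seq_iff)

lemma list_all2_encodes_unique:
  "list_all2 encodes_seq xs Ss \<Longrightarrow> list_all2 encodes_seq xs Ts \<longleftrightarrow> Ss = Ts"
proof (induction xs Ss arbitrary: Ts rule: list_all2_induct)
  case (Cons x xs S Ss)
  then show ?case using encodes_unique by (cases Ts) auto
qed auto

lemma choice3:
  assumes "\<And>a. a \<in> S \<Longrightarrow> \<exists>x y z. P a x y z"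
  shows "\<exists>f g h. \<forall>a\<in>S. P a (f a) (g a) (h a)"
proof -
  have "\<exists>f. \<forall>a\<in>S. P a (fst (f a)) (fst (snd (f a))) (snd (snd (f a)))"
    by (rule bchoice) (use assms in force)
  then obtain f where "\<forall>a\<in>S. P a (fst (f a)) (fst (snd (f a))) (snd (snd (f a)))" ..
  then show ?thesis
    by (intro exI[of _ "\<lambda>a. fst (f a)"] exI[of _ "\<lambda>a. fst (snd (f a))"] exI[of _ "\<lambda>a. snd (snd (f a))"])
qed

text \<open>The search succeeds because the original substitution is among the candidates, and its
  outcome can be trusted because \<open>check\<close> holds exactly when the given sequents are the
  instance under the values tried.\<close>

lemma feasibly_proves_rule:
  assumes R: "R = Rule (map (pat_seq \<Gamma> \<Delta>) ps) (pat_seq \<Gamma> \<Delta> c)" and neq: "\<Gamma> \<noteq> \<Delta>"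
    and right: "snd c = None \<or> (\<forall>p\<in>set ps. snd p \<noteq> None)"
    and LJ: "LJ \<subseteq> G" and Ax: "axiom_rule Ax \<in> G"
    and der: "sder G (set (map (pat_seq \<Gamma> \<Delta>) ps)) \<Delta>
      (add_mset (Fm Ax) (ante (pat_seq \<Gamma> \<Delta> c)) \<Rrightarrow> succ (pat_seq \<Gamma> \<Delta> c))"
  shows "feasibly_proves G R"
proof -
  let ?Ss = "map (pat_seq \<Gamma> \<Delta>) (c # ps)"
  let ?concl = "pat_seq \<Gamma> \<Delta> c"
  obtain ts where ts: "\<And>\<sigma> \<mu>. size (\<mu> \<Delta>) \<le> 1 \<Longrightarrow>
     yields G (inst_seq \<sigma> \<mu> ` set (map (pat_seq \<Gamma> \<Delta>) ps)) (map (inst_seq \<sigma> \<mu>) ts)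
       [inst_seq \<sigma> \<mu> (add_mset (Fm Ax) (ante ?concl) \<Rrightarrow> succ ?concl)]"
    using der unfolding sder_def by blast
  define gam where "gam d z = difference (hd_tree (tl_tree z))
      (fill_side d (\<lambda>_. Leaf) (map Fm (list_of (fst c))))" for d z
  \<comment> \<open>\<Delta> takes the succedent of the conclusion. In a right rule it does not
    occur in the rule, and this value still has at most one formula, as the template
    demands.\<close>
  define m where "m d z g = (if g = \<Gamma> then gam d z else tl_tree (tl_tree z))" for d z g
  define seqs where "seqs z = Node (tl_tree z) (hd_tree z)" for z
  \<comment> \<open>The output consists of the weakened axiom, the filled template and, as
    conclusion of the final cut, the given sequent itself.\<close>
  define out where "out d z = add_weakenings (Node (fill d Ax) Leaf) (hd_tree (tl_tree z))
      (fill_seqs d (m d z) ts (Node (tl_tree z) Leaf))" for d z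
  define H where "H d z = (if check d (m d z) ?Ss (seqs z) = Leaf then Leaf else out d z)" for d z
  have "uniform_pt H"
    unfolding uniform_pt_def
  proof (intro allI impI)
    fix e :: "nat \<Rightarrow> tree \<Rightarrow> tree" and g
    assume e: "\<forall>a. pt (e a)" and g: "pt g"
    have m: "pt (\<lambda>x. m (\<lambda>a. e a x) (g x) b)" for b
    proof (cases "b = \<Gamma>")
      case True
      then show ?thesis unfolding m_def gam_def if_P[OF True]
        using pt_fill_side[OF e, of "\<lambda>_ _. Leaf"] by (intro pt_difference pt_intros g) (simp add: pt_const)
    next
      case False
      then show ?thesis unfolding m_def if_not_P[OF False] by (intro pt_intros g)
    qed
    have "pt (\<lambda>x. check (\<lambda>a. e a x) (\<lambda>b. m (\<lambda>a. e a x) (g x) b) ?Ss (seqs (g x)))"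
      unfolding seqs_def by (intro pt_check allI m pt_intros g e[rule_format])
    moreover have "pt (\<lambda>x. out (\<lambda>a. e a x) (g x))"
      unfolding out_def
      by (intro pt_add_weakenings pt_intros pt_fill pt_fill_seqs allI m g e[rule_format])
    ultimately show "pt (\<lambda>x. H (\<lambda>a. e a x) (g x))"
      unfolding H_def by (intro pt_if pt_const)
  qed
  moreover obtain as where as: "set as = rule_atoms ?Ss"
    using finite_list[OF finite_rule_atoms] by blast
  have "\<exists>cand proj A. \<forall>a\<in>set as. pt (cand a) \<and> pt (proj a) \<and> a \<in> atoms (A a) \<and>
      (\<forall>d. proj a (fill d (A a)) = d a) \<and>
    (\<forall>d m xs. length xs = length ?Ss \<longrightarrow> check d m ?Ss (enc_list xs) \<noteq> Leaf \<longrightarrow>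
      fill d (A a) \<in> set (elems (cand a (enc_list xs)))) \<and>
    (\<forall>xs. length xs = length ?Ss \<longrightarrow>
      (\<exists>x\<in>set xs. cand a (enc_list xs) \<in> {hd_tree x, tl_tree x}))"
    by (rule choice3, rule atom_candidates) (simp only: as)
  then obtain cand proj A where *: "\<forall>a\<in>set as. pt (cand a) \<and> pt (proj a) \<and> a \<in> atoms (A a) \<and>
      (\<forall>d. proj a (fill d (A a)) = d a) \<and>
    (\<forall>d m xs. length xs = length ?Ss \<longrightarrow> check d m ?Ss (enc_list xs) \<noteq> Leaf \<longrightarrow>
      fill d (A a) \<in> set (elems (cand a (enc_list xs)))) \<and>
    (\<forall>xs. length xs = length ?Ss \<longrightarrow>
      (\<exists>x\<in>set xs. cand a (enc_list xs) \<in> {hd_tree x, tl_tree x}))"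
    by (elim exE) (rule that)
  have cp: "pt (cand a)" "pt (proj a)" if "a \<in> set as" for a
    using *[rule_format, OF that] by blast+
  have A: "a \<in> atoms (A a)" if "a \<in> set as" for a
    using *[rule_format, OF that] by blast
  have proj: "proj a (fill d (A a)) = d a" if "a \<in> set as" for a d
    using *[rule_format, OF that] by blast
  have cand: "fill d (A a) \<in> set (elems (cand a (enc_list xs)))"
    if "a \<in> set as" "length xs = length ?Ss" "check d m ?Ss (enc_list xs) \<noteq> Leaf" for a d m xs
    using *[rule_format, OF that(1)] that(2,3) by blast
  have cand_side: "\<exists>x\<in>set xs. cand a (enc_list xs) \<in> {hd_tree x, tl_tree x}"
    if "a \<in> set as" "length xs = length ?Ss" for a xs
    using *[rule_format, OF that(1)] that(2) by blast
  moreover have "pt (\<lambda>z. cand a (seqs z))" if "a \<in> set as" for a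
    unfolding seqs_def by (rule pt_comp[of "cand a"]) (use cp(1) that in \<open>simp_all add: pt_intros\<close>)
  ultimately have "\<exists>F. pt F \<and>
    (\<forall>x. F x \<noteq> Leaf \<longrightarrow> (\<exists>d. F x = H d x \<and> (\<forall>a. a \<notin> set as \<longrightarrow> d a = enc_fm Top))) \<and>
    (\<forall>x d. (\<forall>a\<in>set as. d a \<in> proj a ` set (elems (cand a (seqs x)))) \<longrightarrow>
      (\<forall>a. a \<notin> set as \<longrightarrow> d a = enc_fm Top) \<longrightarrow> H d x \<noteq> Leaf \<longrightarrow> F x \<noteq> Leaf)"
    by (intro assignment_search[where cand = "\<lambda>a z. cand a (seqs z)"]) (simp_all add: cp)
  then obtain F where F: "pt F"
    "\<forall>x. F x \<noteq> Leaf \<longrightarrow> (\<exists>d. F x = H d x \<and> (\<forall>a. a \<notin> set as \<longrightarrow> d a = enc_fm Top))"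
    "\<forall>x d. (\<forall>a\<in>set as. d a \<in> proj a ` set (elems (cand a (seqs x)))) \<longrightarrow>
      (\<forall>a. a \<notin> set as \<longrightarrow> d a = enc_fm Top) \<longrightarrow> H d x \<noteq> Leaf \<longrightarrow> F x \<noteq> Leaf"
    by (elim exE conjE) (rule that; assumption)
  have "\<exists>\<pi>. encodes_seqs (F (Node x y)) \<pi> \<and> is_proof G Ss \<pi> S"
    if inst: "rule_instance R Ss S" and x: "encodes_seqs x Ss" and y: "encodes_seq y S" for Ss S x y
  proof -
    let ?z = "Node x y"
    let ?xs = "y # elems x"
    have seqs: "seqs ?z = enc_list ?xs" by (simp add: seqs_def)
    from inst obtain \<sigma> \<mu> where \<sigma>: "Ss = map (inst_seq \<sigma> \<mu>) (map (pat_seq \<Gamma> \<Delta>) ps)"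
      "S = inst_seq \<sigma> \<mu> ?concl" and S1: "size (succ S) \<le> 1"
      unfolding rule_instance_def R single_conclusion_def by auto
    from x y have enc: "list_all2 encodes_seq ?xs (S # Ss)" by (simp add: encodes_seqs_iff)
    then have len: "length ?xs = length ?Ss" using \<sigma> by (auto dest: list_all2_lengthD)
    obtain l r where lr: "y = Node l r" "ms l = enc_ms (ante S)" "ms r = enc_ms (succ S)"
      using y by (auto simp: encodes_seq_iff)
    have nonleaf: "x' \<noteq> Leaf" if "x' \<in> set ?xs" for x'
    proof -
      from that enc obtain T where "encodes_seq x' T"
        by (metis in_set_conv_nth list_all2_conv_all_nth)
      then show ?thesis by (auto simp: encodes_seq_iff)
    qed
    have check_m: "check (\<lambda>a. enc_fm (\<tau> a)) n ?Ss (seqs ?z) \<noteq> Leaf \<longleftrightarrow>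
        S # Ss = map (inst_seq \<tau> \<nu>) ?Ss" if n: "\<forall>g. ms (n g) = enc_ms (\<nu> g)" for \<tau> \<nu> n
    proof -
      have "check (\<lambda>a. enc_fm (\<tau> a)) n ?Ss (seqs ?z) \<noteq> Leaf \<longleftrightarrow>
          list_all2 (\<lambda>x T. ms (hd_tree x) = enc_ms (ante (inst_seq \<tau> \<nu> T)) \<and>
            ms (tl_tree x) = enc_ms (succ (inst_seq \<tau> \<nu> T))) ?xs ?Ss"
        unfolding seqs check_iff[OF len] by (simp only: ms_fill_side[OF n] mset_list_of inst_seq_def seq.sel)
      also have "\<dots> \<longleftrightarrow> list_all2 (\<lambda>x T. encodes_seq x (inst_seq \<tau> \<nu> T)) ?xs ?Ss"
        by (rule list.rel_cong[OF refl refl]) (simp only: encodes_seq_Node[OF nonleaf])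
      also have "\<dots> \<longleftrightarrow> list_all2 encodes_seq ?xs (map (inst_seq \<tau> \<nu>) ?Ss)"
        by (simp only: list_all2_map2)
      also have "\<dots> \<longleftrightarrow> S # Ss = map (inst_seq \<tau> \<nu>) ?Ss"
        by (rule list_all2_encodes_unique[OF enc])
      finally show ?thesis .
    qed
    have m_enc: "\<forall>g. ms (m (\<lambda>a. enc_fm (\<tau> a)) ?z g) = enc_ms (if g = \<Gamma> then K else succ S)"
      if "ms (gam (\<lambda>a. enc_fm (\<tau> a)) ?z) = enc_ms K" for \<tau> K
      using that lr by (simp add: m_def)
    have gam: "ms (gam (\<lambda>a. enc_fm (\<tau> a)) ?z) = enc_ms (ante S) - enc_ms (image_mset (subst \<tau>) (fst c))" for \<tau>
      using ms_fill_side[of "\<lambda>_. Leaf" "\<lambda>_. {#}" \<tau> "map Fm (list_of (fst c))"] lr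
      by (simp add: gam_def)
    \<comment> \<open>Completeness: the substitution of the instance, reset to \<open>Top\<close>
      outside the atoms of the rule, passes the test.\<close>
    have "F ?z \<noteq> Leaf"
    proof -
      define \<sigma>' where "\<sigma>' a = (if a \<in> set as then \<sigma> a else Top)" for a
      let ?d = "\<lambda>a. enc_fm (\<sigma>' a)"
      \<comment> \<open>\<open>\<mu>\<close> changes only where this is invisible: if \<Delta>
        occurs at all, the conclusion ends in it, and then \<open>\<mu> \<Delta>\<close> is
        \<open>succ S\<close>.\<close>
      let ?\<mu> = "\<lambda>g. if g = \<Gamma> then \<mu> \<Gamma> else succ S"
      have inst_eq: "inst_seq \<sigma>' ?\<mu> T = inst_seq \<sigma> \<mu> T" if T: "T \<in> set ?Ss" for T
      proof (rule inst_seq_cong[OF T])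
        show "\<forall>a\<in>rule_atoms ?Ss. \<sigma>' a = \<sigma> a" by (simp add: \<sigma>'_def as)
        show "\<forall>g. MV g \<in># ante T + succ T \<longrightarrow> ?\<mu> g = \<mu> g"
          using T right \<sigma>(2) by (auto simp: pat_seq_def inst_seq_def split: option.splits)
      qed
      then have "ante S = ante (inst_seq \<sigma>' ?\<mu> ?concl)" using \<sigma>(2) by simp
      then have "ante S = \<mu> \<Gamma> + image_mset (subst \<sigma>') (fst c)"
        by (simp add: pat_seq_def inst_seq_def)
      then have "ms (gam ?d ?z) = enc_ms (\<mu> \<Gamma>)" by (simp add: gam)
      from check_m[OF m_enc[OF this]] have chk: "check ?d (m ?d ?z) ?Ss (seqs ?z) \<noteq> Leaf"
        using inst_eq \<sigma> by simp
      show ?thesis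
      proof (rule F(3)[rule_format, of ?d])
        show "?d a \<in> proj a ` set (elems (cand a (seqs ?z)))" if "a \<in> set as" for a
          using cand[OF that len chk[unfolded seqs]] proj[OF that, of ?d] unfolding seqs
          by (metis image_eqI)
        show "H ?d ?z \<noteq> Leaf" using chk by (simp add: H_def out_def add_weakenings_def)
      qed (simp add: \<sigma>'_def)
    qed
    \<comment> \<open>Soundness: from here on only the assignment found is used, which may differ
      from the original one.\<close>
    with F(2) obtain d where d: "F ?z = H d ?z" "\<forall>a. a \<notin> set as \<longrightarrow> d a = enc_fm Top" by blast
    with \<open>F ?z \<noteq> Leaf\<close> have chk: "check d (m d ?z) ?Ss (seqs ?z) \<noteq> Leaf" and out: "F ?z = out d ?z"
      by (auto simp: H_def split: if_splits)
    \<comment> \<open>For an atom of the rule, the filled formula \<open>A a\<close> is a member of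
      a side of a given sequent and hence the code of a formula; its parts at the atoms are then
      codes as well.\<close>
    have "\<exists>B. d a = enc_fm B" for a
    proof (cases "a \<in> set as")
      case True
      from cand_side[OF True len] obtain x' where x': "x' \<in> set ?xs"
        "cand a (enc_list ?xs) \<in> {hd_tree x', tl_tree x'}" by blast
      from x'(1) enc obtain T where T: "encodes_seq x' T"
        by (metis in_set_conv_nth list_all2_conv_all_nth)
      from T x'(2) obtain M where M: "ms (cand a (enc_list ?xs)) = enc_ms M"
        by (auto simp: encodes_seq_iff)
      have "fill d (A a) \<in># enc_ms M"
        unfolding M[symmetric] using cand[OF True len chk[unfolded seqs]] by simp
      then obtain B where "fill d (A a) = enc_fm B" by (auto simp: enc_ms_def)
      then show ?thesis using fill_eq_enc A[OF True] by blast
    qed (use d(2) in blast)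
    then obtain \<tau> where "\<And>a. d a = enc_fm (\<tau> a)" by metis
    then have d_eq: "d = (\<lambda>a. enc_fm (\<tau> a))" by auto
    obtain K where K: "ms (gam d ?z) = enc_ms K"
    proof (rule enc_ms_subset)
      show "ms (gam d ?z) \<subseteq># enc_ms (ante S)" unfolding d_eq gam by simp
    qed
    define \<nu> where "\<nu> g = (if g = \<Gamma> then K else succ S)" for g
    have n: "\<forall>g. ms (m d ?z g) = enc_ms (\<nu> g)"
      using m_enc K unfolding d_eq \<nu>_def by blast
    have \<nu>1: "size (\<nu> \<Delta>) \<le> 1" using S1 neq by (simp add: \<nu>_def)
    have eq: "S # Ss = map (inst_seq \<tau> \<nu>) ?Ss"
      using check_m[OF n[unfolded d_eq]] chk unfolding d_eq by blast
    let ?A = "subst \<tau> Ax"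
    obtain Bs where Bs: "mset Bs = ante S" "l = enc_list (map enc_fm Bs)"
      using lr(2) by (rule ms_eq_enc_ms)
    let ?\<pi> = "weakenings ?A Bs @ map (inst_seq \<tau> \<nu>) ts @ [S]"
    have "encodes_seqs (fill_seqs d (m d ?z) ts (Node y Leaf)) (map (inst_seq \<tau> \<nu>) ts @ [S])"
      using encodes_fill_seqs[OF n, of "Node y Leaf" "[S]" \<tau> ts] y by (simp add: encodes_seqs_iff d_eq)
    then have "encodes_seqs (F ?z) ?\<pi>"
      unfolding out out_def using encodes_add_weakenings[of "Node (fill d Ax) Leaf" ?A] lr(1) Bs(2)
      by (simp add: d_eq)
    moreover have "is_proof G Ss ?\<pi> S"
    proof -
      have "S = inst_seq \<tau> \<nu> ?concl" using eq by simp
      then have S: "ante S = inst_side \<tau> \<nu> (ante ?concl)" "succ S = inst_side \<tau> \<nu> (succ ?concl)"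
        by (simp_all add: inst_seq_def)
      have Ss: "set Ss = inst_seq \<tau> \<nu> ` set (map (pat_seq \<Gamma> \<Delta>) ps)" using eq by auto
      have "yields G (set Ss) (map (inst_seq \<tau> \<nu>) ts) [add_mset ?A (ante S) \<Rrightarrow> succ S]"
        using ts[of \<nu> \<tau>] \<nu>1 by (simp add: Ss S inst_seq_def)
      moreover have "yields G (set Ss) (weakenings ?A Bs) [ante S \<Rrightarrow> {#?A#}]"
        using yields_weakenings[OF LJ Ax, of _ \<tau> Bs] by (simp add: Bs)
      ultimately show ?thesis
        using yields_cut[OF LJ S1] by (intro yields_is_proof) (metis seq.collapse)
    qed
    ultimately show ?thesis by blast
  qed
  with pt_poly_time[OF F(1)] show ?thesis unfolding feasibly_proves_def by blast
qed

section \<open>Constructive rules and formulas\<close>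

text \<open>Rules of the class fix their premises only up to order, whereas the patterns have to
  follow the order of \<open>prems\<close>.\<close>

lemma ex_map_eq_mset:
  "mset xs = image_mset f M \<Longrightarrow> \<exists>ys. mset ys = M \<and> xs = map f ys"
proof (induction xs arbitrary: M)
  case Nil
  then show ?case by auto
next
  case (Cons x xs)
  then have "image_mset f M = add_mset x (mset xs)" by simp
  then obtain M' a where M: "M = add_mset a M'" "f a = x" "image_mset f M' = mset xs"
    by (auto dest: msed_map_invR)
  from Cons.IH[OF M(3)[symmetric]] obtain ys where "mset ys = M'" "xs = map f ys" by blast
  with M show ?case by (intro exI[of _ "a # ys"]) simp
qed

lemma inj_Fm: "inj Fm"
  by (simp add: inj_def)

text \<open>The formula parts contain no multiset variable, so \<Gamma> and the kind of succedent
  are visible in the meta-sequent. Only \<Delta> is lost, when the succedent consists of formulas.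
  This gives uniqueness of presentations.\<close>

lemma pat_seq_eq_iff:
  "pat_seq \<Gamma> \<Delta> p = pat_seq \<Gamma>' \<Delta>' p' \<longleftrightarrow> \<Gamma> = \<Gamma>' \<and> p = p' \<and> (snd p = None \<longrightarrow> \<Delta> = \<Delta>')"
proof
  assume eq: "pat_seq \<Gamma> \<Delta> p = pat_seq \<Gamma>' \<Delta>' p'"
  have fms_eq: "fms M = fms N \<longleftrightarrow> M = N" for M N :: "fm multiset"
    using multiset.inj_map[OF inj_Fm] by (simp add: inj_eq)
  have MV: "MV g \<notin># fms M" for g and M :: "fm multiset" by auto
  from eq have ante: "add_mset (MV \<Gamma>) (fms (fst p)) = add_mset (MV \<Gamma>') (fms (fst p'))"
    and suc: "(case snd p of None \<Rightarrow> {#MV \<Delta>#} | Some \<psi> \<Rightarrow> fms \<psi>) =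
      (case snd p' of None \<Rightarrow> {#MV \<Delta>'#} | Some \<psi> \<Rightarrow> fms \<psi>)"
    by (simp_all add: pat_seq_def)
  have "MV \<Gamma> \<in># add_mset (MV \<Gamma>') (fms (fst p'))" unfolding ante[symmetric] by simp
  then have "\<Gamma> = \<Gamma>'" using MV by auto
  with ante have "fst p = fst p'" by (simp add: fms_eq)
  moreover have "snd p = snd p' \<and> (snd p = None \<longrightarrow> \<Delta> = \<Delta>')"
  proof (cases "snd p"; cases "snd p'")
    fix \<psi> assume "snd p = None" "snd p' = Some \<psi>"
    with suc have "MV \<Delta> \<in># fms \<psi>" by (metis option.simps(4,5) union_single_eq_member add_mset_add_single empty_neutral(1))
    with MV show ?thesis by blast
  next
    fix \<psi> assume "snd p = Some \<psi>" "snd p' = None"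
    with suc have "MV \<Delta>' \<in># fms \<psi>" by simp
    with MV show ?thesis by blast
  qed (use suc in \<open>simp_all add: fms_eq\<close>)
  ultimately show "\<Gamma> = \<Gamma>' \<and> p = p' \<and> (snd p = None \<longrightarrow> \<Delta> = \<Delta>')"
    using \<open>\<Gamma> = \<Gamma>'\<close> by (simp add: prod_eq_iff)
qed (auto simp: pat_seq_def)

lemma pats_of_families:
  assumes "mset ps = mset (map (\<lambda>(\<phi>, \<psi>). (\<phi>, Some \<psi>)) I @ map (\<lambda>\<theta>. (\<theta>, None)) J)"
  shows "mset (somes ps) = mset I" "mset (nones ps) = mset J"
proof -
  have "mset (somes ps) = mset (somes (map (\<lambda>(\<phi>, \<psi>). (\<phi>, Some \<psi>)) I @ map (\<lambda>\<theta>. (\<theta>, None)) J))"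
    unfolding somes_def mset_map mset_filter assms ..
  also have "somes (map (\<lambda>(\<phi>, \<psi>). (\<phi>, Some \<psi>)) I @ map (\<lambda>\<theta>. (\<theta>, None)) J) = I"
    by (simp add: somes_def filter_map o_def case_prod_unfold)
  finally show "mset (somes ps) = mset I" .
  have "mset (nones ps) = mset (nones (map (\<lambda>(\<phi>, \<psi>). (\<phi>, Some \<psi>)) I @ map (\<lambda>\<theta>. (\<theta>, None)) J))"
    unfolding nones_def mset_map mset_filter assms ..
  also have "nones (map (\<lambda>(\<phi>, \<psi>). (\<phi>, Some \<psi>)) I @ map (\<lambda>\<theta>. (\<theta>, None)) J) = J"
    by (simp add: nones_def filter_map o_def case_prod_unfold)
  finally show "mset (nones ps) = mset J" .
qed

lemma families_of_pats:
  "mset ps = mset (map (\<lambda>(\<phi>, \<psi>). (\<phi>, Some \<psi>)) (somes ps) @ map (\<lambda>\<theta>. (\<theta>, None)) (nones ps))"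
  by (induction ps) (auto simp: somes_def nones_def)

lemma left_rule_iff:
  "left_rule \<Gamma> \<Delta> I J \<eta> R \<longleftrightarrow> \<Gamma> \<noteq> \<Delta> \<and> (\<exists>ps.
     mset ps = mset (map (\<lambda>(\<phi>, \<psi>). (\<phi>, Some \<psi>)) I @ map (\<lambda>\<theta>. (\<theta>, None)) J) \<and>
     R = Rule (map (pat_seq \<Gamma> \<Delta>) ps) (pat_seq \<Gamma> \<Delta> (\<eta>, None)))"
proof -
  let ?qs = "map (\<lambda>(\<phi>, \<psi>). (\<phi>, Some \<psi>)) I @ map (\<lambda>\<theta>. (\<theta>, None)) J"
  have 1: "image_mset (pat_seq \<Gamma> \<Delta>) (mset ?qs) =
      mset (map (\<lambda>(\<phi>, \<psi>). {#MV \<Gamma>#} + fms \<phi> \<Rrightarrow> fms \<psi>) I) +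
      mset (map (\<lambda>\<theta>. {#MV \<Gamma>#} + fms \<theta> \<Rrightarrow> {#MV \<Delta>#}) J)"
    by (simp add: pat_seq_def multiset.map_comp o_def case_prod_unfold)
  have 2: "pat_seq \<Gamma> \<Delta> (\<eta>, None) = ({#MV \<Gamma>#} + fms \<eta> \<Rrightarrow> {#MV \<Delta>#})"
    by (simp add: pat_seq_def)
  show ?thesis
    unfolding left_rule_def 1[symmetric] 2[symmetric]
  proof (intro conj_cong refl iffI)
    assume *: "mset (prems R) = image_mset (pat_seq \<Gamma> \<Delta>) (mset ?qs) \<and> concl R = pat_seq \<Gamma> \<Delta> (\<eta>, None)"
    then obtain ps where "mset ps = mset ?qs" "prems R = map (pat_seq \<Gamma> \<Delta>) ps"
      using ex_map_eq_mset by blast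
    with * show "\<exists>ps. mset ps = mset ?qs \<and> R = Rule (map (pat_seq \<Gamma> \<Delta>) ps) (pat_seq \<Gamma> \<Delta> (\<eta>, None))"
      by (intro exI[of _ ps]) (auto intro: rule.expand)
  next
    assume "\<exists>ps. mset ps = mset ?qs \<and> R = Rule (map (pat_seq \<Gamma> \<Delta>) ps) (pat_seq \<Gamma> \<Delta> (\<eta>, None))"
    then obtain ps where "mset ps = mset ?qs" "R = Rule (map (pat_seq \<Gamma> \<Delta>) ps) (pat_seq \<Gamma> \<Delta> (\<eta>, None))"
      by blast
    then show "mset (prems R) = image_mset (pat_seq \<Gamma> \<Delta>) (mset ?qs) \<and> concl R = pat_seq \<Gamma> \<Delta> (\<eta>, None)"
      by (simp only: rule.sel mset_map simp_thms)
  qed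
qed

text \<open>\<Delta> is arbitrary, because no pattern involved mentions it.\<close>

lemma right_rule_iff:
  "right_rule \<Gamma> I \<theta> \<eta> R \<longleftrightarrow> (\<exists>ps. mset ps = mset (map (\<lambda>(\<phi>, \<psi>). (\<phi>, Some \<psi>)) I) \<and>
     R = Rule (map (pat_seq \<Gamma> \<Delta>) ps) (pat_seq \<Gamma> \<Delta> (\<theta>, Some \<eta>)))"
proof -
  let ?qs = "map (\<lambda>(\<phi>, \<psi>). (\<phi>, Some \<psi>)) I"
  have 1: "image_mset (pat_seq \<Gamma> \<Delta>) (mset ?qs) =
      mset (map (\<lambda>(\<phi>, \<psi>). {#MV \<Gamma>#} + fms \<phi> \<Rrightarrow> fms \<psi>) I)"
    by (simp add: pat_seq_def multiset.map_comp o_def case_prod_unfold)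
  have 2: "pat_seq \<Gamma> \<Delta> (\<theta>, Some \<eta>) = ({#MV \<Gamma>#} + fms \<theta> \<Rrightarrow> fms \<eta>)"
    by (simp add: pat_seq_def)
  show ?thesis
    unfolding right_rule_def 1[symmetric] 2[symmetric]
  proof
    assume *: "mset (prems R) = image_mset (pat_seq \<Gamma> \<Delta>) (mset ?qs) \<and> concl R = pat_seq \<Gamma> \<Delta> (\<theta>, Some \<eta>)"
    then obtain ps where "mset ps = mset ?qs" "prems R = map (pat_seq \<Gamma> \<Delta>) ps"
      using ex_map_eq_mset by blast
    with * show "\<exists>ps. mset ps = mset ?qs \<and> R = Rule (map (pat_seq \<Gamma> \<Delta>) ps) (pat_seq \<Gamma> \<Delta> (\<theta>, Some \<eta>))"
      by (intro exI[of _ ps]) (auto intro: rule.expand)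
  next
    assume "\<exists>ps. mset ps = mset ?qs \<and> R = Rule (map (pat_seq \<Gamma> \<Delta>) ps) (pat_seq \<Gamma> \<Delta> (\<theta>, Some \<eta>))"
    then obtain ps where "mset ps = mset ?qs" "R = Rule (map (pat_seq \<Gamma> \<Delta>) ps) (pat_seq \<Gamma> \<Delta> (\<theta>, Some \<eta>))"
      by blast
    then show "mset (prems R) = image_mset (pat_seq \<Gamma> \<Delta>) (mset ?qs) \<and> concl R = pat_seq \<Gamma> \<Delta> (\<theta>, Some \<eta>)"
      by (simp only: rule.sel mset_map simp_thms)
  qed
qed

definition has_pats :: "rule \<Rightarrow> nat \<Rightarrow> nat \<Rightarrow> pattern list \<Rightarrow> pattern \<Rightarrow> bool" where
  "has_pats R \<Gamma> \<Delta> ps c \<longleftrightarrow> \<Gamma> \<noteq> \<Delta> \<and> R = Rule (map (pat_seq \<Gamma> \<Delta>) ps) (pat_seq \<Gamma> \<Delta> c) \<and>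
     (snd c = None \<or> (\<forall>p\<in>set ps. snd p \<noteq> None))"

lemma rule_class_has_pats:
  assumes "R \<in> rule_class"
  obtains \<Gamma> \<Delta> ps c where "has_pats R \<Gamma> \<Delta> ps c"
proof -
  from assms consider \<Gamma> \<Delta> I J \<eta> where "left_rule \<Gamma> \<Delta> I J \<eta> R" | \<Gamma> I \<theta> \<eta> where "right_rule \<Gamma> I \<theta> \<eta> R"
    unfolding rule_class_def by blast
  then show thesis
  proof cases
    case 1
    then show ?thesis using that unfolding left_rule_iff has_pats_def by fastforce
  next
    case 2
    \<comment> \<open>\<open>Suc \<Gamma>\<close> merely serves as some variable other than
      \<Gamma>.\<close>
    then obtain ps where ps: "mset ps = mset (map (\<lambda>(\<phi>, \<psi>). (\<phi>, Some \<psi>)) I)"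
      "R = Rule (map (pat_seq \<Gamma> (Suc \<Gamma>)) ps) (pat_seq \<Gamma> (Suc \<Gamma>) (\<theta>, Some \<eta>))"
      unfolding right_rule_iff[where \<Delta> = "Suc \<Gamma>"] by blast
    have "\<forall>p\<in>set ps. snd p \<noteq> None"
      using mset_eq_setD[OF ps(1)] by auto
    with ps(2) show ?thesis by (intro that[of \<Gamma> "Suc \<Gamma>" ps]) (auto simp: has_pats_def)
  qed
qed

definition constructive_pats :: "pattern list \<Rightarrow> pattern \<Rightarrow> bool" where
  "constructive_pats ps c \<longleftrightarrow>
     (\<forall>(B, Q)\<in>set (somes ps). set_mset B \<subseteq> basic \<and> set_mset Q \<subseteq> almost_positive \<and> size Q \<le> 1) \<and>
     set_mset (fst c) \<subseteq> almost_positive \<and>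
     (case snd c of
        None \<Rightarrow> (\<forall>C\<in>set (nones ps). set_mset C \<subseteq> constructive) \<and>
          (length (nones ps) > 1 \<longrightarrow> (\<forall>C\<in>set (nones ps). set_mset C \<subseteq> basic))
      | Some C \<Rightarrow> set_mset C \<subseteq> constructive \<and> size C \<le> 1)"

text \<open>The variables and the kind of rule are determined by \<open>R\<close>, and the families
  up to order. The conditions on them depend only on their members and on the length of
  \<open>J\<close>, so they can be read off the patterns.\<close>

lemma constructive_rule_iff:
  assumes "has_pats R \<Gamma> \<Delta> ps c"
  shows "constructive_rule R \<longleftrightarrow> constructive_pats ps c"
proof -
  have R: "R = Rule (map (pat_seq \<Gamma> \<Delta>) ps) (pat_seq \<Gamma> \<Delta> c)" and neq: "\<Gamma> \<noteq> \<Delta>"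
    and right: "snd c = None \<or> (\<forall>p\<in>set ps. snd p \<noteq> None)"
    using assms by (simp_all add: has_pats_def)
  have inj: "inj (pat_seq g d)" for g d by (simp add: inj_def pat_seq_eq_iff)
  have left: "left_rule \<Gamma>' \<Delta>' I J P R \<longleftrightarrow> \<Gamma>' = \<Gamma> \<and> \<Delta>' = \<Delta> \<and> c = (P, None) \<and>
      mset ps = mset (map (\<lambda>(\<phi>, \<psi>). (\<phi>, Some \<psi>)) I @ map (\<lambda>\<theta>. (\<theta>, None)) J)" for \<Gamma>' \<Delta>' I J P
    unfolding left_rule_iff R rule.inject pat_seq_eq_iff
    using neq by (auto simp: inj_map_eq_map[OF inj])
  have right': "right_rule \<Gamma>' I P C R \<longleftrightarrow> \<Gamma>' = \<Gamma> \<and> c = (P, Some C) \<and>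
      mset ps = mset (map (\<lambda>(\<phi>, \<psi>). (\<phi>, Some \<psi>)) I)" for \<Gamma>' I P C
    unfolding right_rule_iff[where \<Delta> = \<Delta>] R rule.inject pat_seq_eq_iff
    by (auto simp: inj_map_eq_map[OF inj])
  show ?thesis
  proof
    assume "constructive_rule R"
    then show "constructive_pats ps c"
      unfolding constructive_rule_def
    proof
      assume "left_constructive R"
      then obtain I J P where c: "c = (P, None)"
        and mset: "mset ps = mset (map (\<lambda>(\<phi>, \<psi>). (\<phi>, Some \<psi>)) I @ map (\<lambda>\<theta>. (\<theta>, None)) J)"
        and con: "\<forall>(B, Q) \<in> set I. set_mset B \<subseteq> basic \<and> set_mset Q \<subseteq> almost_positive \<and> size Q \<le> 1"
          "\<forall>C \<in> set J. set_mset C \<subseteq> constructive" "set_mset P \<subseteq> almost_positive"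
          "length J > 1 \<longrightarrow> (\<forall>C \<in> set J. set_mset C \<subseteq> basic)"
        unfolding left_constructive_def left by blast
      from pats_of_families[OF mset] have "set (somes ps) = set I" "set (nones ps) = set J"
        "length (nones ps) = length J"
        by (auto dest: mset_eq_setD mset_eq_length)
      with c con show ?thesis by (simp add: constructive_pats_def)
    next
      assume "right_constructive R"
      then obtain I P C where c: "c = (P, Some C)"
        and mset: "mset ps = mset (map (\<lambda>(\<phi>, \<psi>). (\<phi>, Some \<psi>)) I)"
        and con: "\<forall>(B, Q) \<in> set I. set_mset B \<subseteq> basic \<and> set_mset Q \<subseteq> almost_positive \<and> size Q \<le> 1"
          "set_mset P \<subseteq> almost_positive" "set_mset C \<subseteq> constructive" "size C \<le> 1"
        unfolding right_constructive_def right' by blast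
      from pats_of_families(1)[of ps I "[]"] mset have "set (somes ps) = set I"
        by (auto dest: mset_eq_setD)
      with c con show ?thesis by (simp add: constructive_pats_def)
    qed
  next
    assume con: "constructive_pats ps c"
    show "constructive_rule R"
    proof (cases "snd c")
      case None
      then have "left_rule \<Gamma> \<Delta> (somes ps) (nones ps) (fst c) R"
        unfolding left using families_of_pats[of ps] by (auto simp: prod_eq_iff)
      moreover have "(\<forall>(B, Q)\<in>set (somes ps).
          set_mset B \<subseteq> basic \<and> set_mset Q \<subseteq> almost_positive \<and> size Q \<le> 1) \<and>
        (\<forall>C\<in>set (nones ps). set_mset C \<subseteq> constructive) \<and> set_mset (fst c) \<subseteq> almost_positive \<and>
        (length (nones ps) > 1 \<longrightarrow> (\<forall>C\<in>set (nones ps). set_mset C \<subseteq> basic))"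
        using con unfolding constructive_pats_def None option.case by (elim conjE) (intro conjI)
      ultimately show ?thesis
        unfolding constructive_rule_def left_constructive_def by blast
    next
      case (Some C)
      with right have "nones ps = []" by (auto simp: nones_def filter_empty_conv)
      with families_of_pats[of ps] Some have "right_rule \<Gamma> (somes ps) (fst c) C R"
        unfolding right' by (auto simp: prod_eq_iff)
      moreover have "(\<forall>(B, Q)\<in>set (somes ps).
          set_mset B \<subseteq> basic \<and> set_mset Q \<subseteq> almost_positive \<and> size Q \<le> 1) \<and>
        set_mset (fst c) \<subseteq> almost_positive \<and> set_mset C \<subseteq> constructive \<and> size C \<le> 1"
        using con unfolding constructive_pats_def Some option.case by (elim conjE) (intro conjI)
      ultimately show ?thesis
        unfolding constructive_rule_def right_constructive_def by blast
    qed
  qed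
qed

\<comment> \<open>Constructivity of the formula built from a rule\<close>
inductive_simps basic_simps [simp]:
  "Top \<in> basic" "Bot \<in> basic" "And A B \<in> basic" "Or A B \<in> basic" "Imp A B \<in> basic"

lemma almost_positive_simps [simp]:
  "Top \<in> almost_positive" "Bot \<in> almost_positive"
  "And A B \<in> almost_positive \<longleftrightarrow> A \<in> almost_positive \<and> B \<in> almost_positive"
  "Imp A B \<in> almost_positive \<longleftrightarrow> A \<in> basic \<and> B \<in> almost_positive"
  by (auto intro: almost_positive.intros
      simp: almost_positive.simps[of "And A B"] almost_positive.simps[of "Imp A B"])

lemma constructive_simps [simp]:
  "Top \<in> constructive" "Bot \<in> constructive"
  "And A B \<in> constructive \<longleftrightarrow> A \<in> constructive \<and> B \<in> constructive"
  "Or A B \<in> constructive \<longleftrightarrow> A \<in> basic \<and> B \<in> basic"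
  "Imp A B \<in> constructive \<longleftrightarrow> A \<in> almost_positive \<and> B \<in> constructive"
  by (auto intro: constructive.intros simp: constructive.simps[of "And A B"]
      constructive.simps[of "Or A B"] constructive.simps[of "Imp A B"])

text \<open>The final \<open>Top\<close> of \<open>conjs\<close> is harmless: it is basic, and all
  three classes are closed under conjunction.\<close>

lemma conj_in_iff [simp]:
  "conjs As \<in> basic \<longleftrightarrow> set As \<subseteq> basic"
  "conjs As \<in> almost_positive \<longleftrightarrow> set As \<subseteq> almost_positive"
  "conjs As \<in> constructive \<longleftrightarrow> set As \<subseteq> constructive"
  by (induction As) auto

lemma disj_basic: "disjs As \<in> basic \<longleftrightarrow> set As \<subseteq> basic"
  by (induction As rule: disjs.induct) auto

text \<open>With two or more disjuncts the outermost connective is \<open>Or\<close>, and a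
  constructive disjunction must be basic. This mirrors the extra condition on left rules with
  several premises ending in \<Delta>.\<close>

lemma disj_constructive:
  "disjs As \<in> constructive \<longleftrightarrow>
    set As \<subseteq> constructive \<and> (length As > 1 \<longrightarrow> set As \<subseteq> basic)"
  by (cases As rule: disjs.cases) (auto simp: disj_basic intro: constructive.intros)

lemma disj_list_of:
  assumes "size M \<le> 1"
  shows "disjs (list_of M) \<in> almost_positive \<longleftrightarrow> set_mset M \<subseteq> almost_positive"
    "disjs (list_of M) \<in> constructive \<longleftrightarrow> set_mset M \<subseteq> constructive"
  by (rule size_le_1_cases[OF assms]; simp)+

text \<open>Each condition on the rule governs one position in the formula: the hypotheses and the
  antecedent of the conclusion must be almost positive, the succedent constructive, and a hypothesis
  is almost positive if its antecedent is basic and its succedent almost positive. The size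
  conditions hold by instantiability.\<close>

lemma ax_fm_constructive_iff:
  assumes inst: "\<forall>p\<in>set (c # ps). instantiable p"
  shows "ax_fm ps c \<in> constructive \<longleftrightarrow> constructive_pats ps c"
proof -
  have size: "size Q \<le> 1" if "(B, Q) \<in> set (somes ps)" for B Q
    using inst that by (auto simp: set_somes instantiable_def)
  have "set (hyps ps) \<subseteq> almost_positive \<longleftrightarrow> (\<forall>(B, Q)\<in>set (somes ps).
      set_mset B \<subseteq> basic \<and> set_mset Q \<subseteq> almost_positive \<and> size Q \<le> 1)"
    unfolding hyps_def using size disj_list_of(1) by fastforce
  moreover have "ax_succ ps c \<in> constructive \<longleftrightarrow> (case snd c of
        None \<Rightarrow> (\<forall>C\<in>set (nones ps). set_mset C \<subseteq> constructive) \<and>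
          (length (nones ps) > 1 \<longrightarrow> (\<forall>C\<in>set (nones ps). set_mset C \<subseteq> basic))
      | Some C \<Rightarrow> set_mset C \<subseteq> constructive \<and> size C \<le> 1)"
  proof (cases "snd c")
    case None
    then show ?thesis by (auto simp: ax_succ_def alts_def disj_constructive image_subset_iff)
  next
    case (Some \<psi>)
    with inst have "size \<psi> \<le> 1" by (simp add: instantiable_def)
    with Some disj_list_of(2) show ?thesis by (simp add: ax_succ_def)
  qed
  ultimately show ?thesis
    by (auto simp: ax_fm_def ax_ante_def constructive_pats_def)
qed

lemma instantiable_if_constructive:
  assumes "constructive_pats ps c" "p \<in> set (c # ps)"
  shows "instantiable p"
  using assms by (cases p) (auto simp: constructive_pats_def instantiable_def set_somes)

lemma instantiable_if_instance:
  assumes "has_pats R \<Gamma> \<Delta> ps c" "rule_instance R Ss S" "p \<in> set (c # ps)"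
  shows "instantiable p"
  unfolding instantiable_def
proof (intro allI impI)
  fix \<psi> assume \<psi>: "snd p = Some \<psi>"
  from assms(2) obtain \<sigma> \<mu> where "Ss = map (inst_seq \<sigma> \<mu>) (prems R)" "S = inst_seq \<sigma> \<mu> (concl R)"
    and single: "\<forall>T\<in>set (S # Ss). single_conclusion T"
    unfolding rule_instance_def by blast
  with assms(1,3) have "inst_seq \<sigma> \<mu> (pat_seq \<Gamma> \<Delta> p) \<in> set (S # Ss)"
    by (auto simp: has_pats_def)
  with single have "single_conclusion (inst_seq \<sigma> \<mu> (pat_seq \<Gamma> \<Delta> p))" by blast
  with \<psi> show "size \<psi> \<le> 1" by (simp add: single_conclusion_def pat_seq_def inst_seq_def)
qed

text \<open>
  A rule with a succedent of two or more formulas has no instances and is not constructive, so any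
  derivable formula that is not constructive will do for it.
\<close>

theorem theorem3p11:
  fixes R :: rule
  assumes "R \<in> rule_class"
  shows "\<exists>Ax :: fm.
    feasibly_proves (LJ \<union> {R}) (axiom_rule Ax) \<and>
    feasibly_proves (LJ \<union> {axiom_rule Ax}) R \<and>
    (constructive_rule R \<longleftrightarrow> Ax \<in> constructive)"
proof -
  obtain \<Gamma> \<Delta> ps c where pats: "has_pats R \<Gamma> \<Delta> ps c"
    using rule_class_has_pats[OF assms] .
  then have R: "R = Rule (map (pat_seq \<Gamma> \<Delta>) ps) (pat_seq \<Gamma> \<Delta> c)" and neq: "\<Gamma> \<noteq> \<Delta>"
    and right: "snd c = None \<or> (\<forall>p\<in>set ps. snd p \<noteq> None)"
    by (simp_all add: has_pats_def)
  show ?thesis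
  proof (cases "\<forall>p\<in>set (c # ps). instantiable p")
    case True
    have "feasibly_proves (LJ \<union> {R}) (axiom_rule (ax_fm ps c))"
      by (rule feasibly_proves_axiom[OF der_axiom[OF _ _ R neq True right]]) auto
    moreover have "feasibly_proves (LJ \<union> {axiom_rule (ax_fm ps c)}) R"
      by (rule feasibly_proves_rule[OF R neq right _ _ der_conclusion[OF _ True right]]) auto
    ultimately show ?thesis
      using constructive_rule_iff[OF pats] ax_fm_constructive_iff[OF True] by blast
  next
    case False
    \<comment> \<open>Derivable through its right disjunct; not constructive, since a constructive
      disjunction has basic disjuncts and an implication is never basic.\<close>
    let ?Ax = "Or (Imp Top Top) Top"
    have LJ: "LJ \<subseteq> LJ \<union> {R}" by blast
    have "feasibly_proves (LJ \<union> {R}) (axiom_rule ?Ax)"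
      by (rule feasibly_proves_axiom[of _ 0], rule der_right(6)[OF LJ], rule der_right(2)[OF LJ])
    moreover have "\<not> rule_instance R Ss S" for Ss S
      using False instantiable_if_instance[OF pats] by blast
    then have "feasibly_proves (LJ \<union> {axiom_rule ?Ax}) R"
      unfolding feasibly_proves_def using pt_poly_time[OF pt_id] by blast
    moreover have "\<not> constructive_rule R"
      using False instantiable_if_constructive constructive_rule_iff[OF pats] by blast
    ultimately show ?thesis by (intro exI[of _ ?Ax]) simp
  qed
qed

end
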